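(* Let $\mathcal{O}$ be a complete discrete valuation ring with finite residue field and let $\Lambda=\mathcal{O}[\![T]\!]$. Let $M$ and $N$ be non-trivial finitely generated torsion $\Lambda$-modules. Then $M$ and $N$ are pseudo-isomorphic if and only if $\mathrm{Fitt}_i(M)\sim\mathrm{Fitt}_i(N)$ for all integers $i\geq 0$. In other words, the pseudo-isomorphism class of $M$ is uniquely determined by the classes modulo $\sim$ of the ideals $\mathrm{Fitt}_i(M)$, $i\geq0$.
   Context: For a finitely presented module $M$ over a commutative ring $R$, generated by $n$ elements with presentation $R^k\xrightarrow{\varphi}R^n\to M\to 0$ and $A$ the matrix of $\varphi$, the $i$-th Fitting ideal $\mathrm{Fitt}_i(M)$ is the ideal generated by the $(n-i)$-minors of $A$ if $i\leq n$ (minors of order $0$ equal $1$, and the ideal is $(0)$ if $n-i>k$), and $R$ if $i>n$; it is independent of the presentation. A finitely generated $\Lambda$-module is pseudo-null if it is finite; a pseudo-isomorphism is a $\Lambda$-homomorphism with pseudo-null kernel and cokernel, and two finitely generated torsion $\Lambda$-modules are pseudo-isomorphic if there is a pseudo-isomorphism between them. For ideals $I,J$ of $\Lambda$, $I\prec J$ means that there is an ideal $\mathfrak{a}$ of height $2$ with $\mathfrak{a}I\subset J$, and $I\sim J$ means $I\prec J$ and $J\prec I$. *)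

theory Defs
  imports "HOL-Library.Extended_Nat" "HOL-Computational_Algebra.Formal_Power_Series" "Jordan_Normal_Form.Determinant"
begin

definition is_ideal :: "'r::comm_ring_1 set \<Rightarrow> bool" where
  "is_ideal I \<longleftrightarrow> 0 \<in> I \<and> (\<forall>x\<in>I. \<forall>y\<in>I. x + y \<in> I) \<and> (\<forall>r. \<forall>x\<in>I. r * x \<in> I)"

definition ideal_gen :: "'r::comm_ring_1 set \<Rightarrow> 'r set" where
  "ideal_gen S = \<Inter>{J. is_ideal J \<and> S \<subseteq> J}"

definition ideal_prod :: "'r::comm_ring_1 set \<Rightarrow> 'r set \<Rightarrow> 'r set" where
  "ideal_prod A B = ideal_gen {x * y | x y. x \<in> A \<and> y \<in> B}"

primrec ideal_pow :: "'r::comm_ring_1 set \<Rightarrow> nat \<Rightarrow> 'r set" where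
  "ideal_pow A 0 = UNIV"
| "ideal_pow A (Suc k) = ideal_prod A (ideal_pow A k)"

definition prime_ideal :: "'r::comm_ring_1 set \<Rightarrow> bool" where
  "prime_ideal P \<longleftrightarrow> is_ideal P \<and> P \<noteq> UNIV \<and> (\<forall>a b. a * b \<in> P \<longrightarrow> a \<in> P \<or> b \<in> P)"

text \<open>Height of a prime ideal: supremum of lengths n of strictly increasing chains
  of primes P_0 < P_1 < ... < P_n = P. Height of an ideal I: infimum of the heights
  of primes containing I (infinity for the unit ideal).\<close>

definition prime_height :: "'r::comm_ring_1 set \<Rightarrow> enat" where
  "prime_height P = (SUP n \<in> {n. \<exists>C :: nat \<Rightarrow> 'r set.
       (\<forall>k\<le>n. prime_ideal (C k)) \<and> (\<forall>k<n. C k \<subset> C (Suc k)) \<and> C n = P}. enat n)"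

definition ideal_height :: "'r::comm_ring_1 set \<Rightarrow> enat" where
  "ideal_height I = (INF P \<in> {P. prime_ideal P \<and> I \<subseteq> P}. prime_height P)"

definition ideal_prec :: "'r::comm_ring_1 set \<Rightarrow> 'r set \<Rightarrow> bool" where
  "ideal_prec I J \<longleftrightarrow> (\<exists>\<aa>. is_ideal \<aa> \<and> ideal_height \<aa> = 2 \<and> ideal_prod \<aa> I \<subseteq> J)"

definition ideal_sim :: "'r::comm_ring_1 set \<Rightarrow> 'r set \<Rightarrow> bool" where
  "ideal_sim I J \<longleftrightarrow> ideal_prec I J \<and> ideal_prec J I"

text \<open>DVR (Serre, Local Fields): a principal ideal domain with exactly one nonzero
  prime ideal.\<close>

definition is_PID :: "'r::idom itself \<Rightarrow> bool" where
  "is_PID _ \<longleftrightarrow> (\<forall>I :: 'r set. is_ideal I \<longrightarrow> (\<exists>g. I = {g * r | r. True}))"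

definition is_DVR :: "'r::idom itself \<Rightarrow> bool" where
  "is_DVR T \<longleftrightarrow> is_PID T \<and> (\<exists>!P :: 'r set. prime_ideal P \<and> P \<noteq> {0})"

definition max_ideal :: "'r::idom itself \<Rightarrow> 'r set" where
  "max_ideal _ = (THE P :: 'r set. prime_ideal P \<and> P \<noteq> {0})"

definition adically_complete :: "'r::comm_ring_1 set \<Rightarrow> bool" where
  "adically_complete m \<longleftrightarrow>
     (\<forall>x :: nat \<Rightarrow> 'r. (\<forall>k. \<exists>N. \<forall>p\<ge>N. \<forall>q\<ge>N. x p - x q \<in> ideal_pow m k) \<longrightarrow>
        (\<exists>L. \<forall>k. \<exists>N. \<forall>p\<ge>N. x p - L \<in> ideal_pow m k))"

definition finite_residue_field :: "'r::comm_ring_1 set \<Rightarrow> bool" where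
  "finite_residue_field m \<longleftrightarrow> finite ((\<lambda>x. {y. x - y \<in> m}) ` UNIV)"

definition complete_DVR_finite_residue :: "'r::idom itself \<Rightarrow> bool" where
  "complete_DVR_finite_residue T \<longleftrightarrow> is_DVR T \<and> adically_complete (max_ideal T)
      \<and> finite_residue_field (max_ideal T)"

definition fin_gen :: "('r::comm_ring_1 \<Rightarrow> 'm::ab_group_add \<Rightarrow> 'm) \<Rightarrow> bool" where
  "fin_gen s \<longleftrightarrow> (\<exists>S. finite S \<and> Modules.module.span s S = UNIV)"

definition torsion_module :: "('r::comm_ring_1 \<Rightarrow> 'm::ab_group_add \<Rightarrow> 'm) \<Rightarrow> bool" where
  "torsion_module s \<longleftrightarrow> (\<forall>x. \<exists>r. r \<noteq> 0 \<and> s r x = 0)"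

definition pseudo_null :: "'m set \<Rightarrow> bool" where
  "pseudo_null X \<longleftrightarrow> finite X"

definition pseudo_isomorphism ::
  "('r::comm_ring_1 \<Rightarrow> 'm::ab_group_add \<Rightarrow> 'm) \<Rightarrow> ('r \<Rightarrow> 'n::ab_group_add \<Rightarrow> 'n) \<Rightarrow> ('m \<Rightarrow> 'n) \<Rightarrow> bool" where
  "pseudo_isomorphism s1 s2 f \<longleftrightarrow> Modules.module_hom s1 s2 f
     \<and> pseudo_null {x. f x = 0}
     \<and> pseudo_null ((\<lambda>y. {y + z | z. z \<in> range f}) ` UNIV)"

definition pseudo_isomorphic ::
  "('r::comm_ring_1 \<Rightarrow> 'm::ab_group_add \<Rightarrow> 'm) \<Rightarrow> ('r \<Rightarrow> 'n::ab_group_add \<Rightarrow> 'n) \<Rightarrow> bool" where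
  "pseudo_isomorphic s1 s2 \<longleftrightarrow> (\<exists>f. pseudo_isomorphism s1 s2 f)"

text \<open>Given generators g 0, ..., g (n-1), the relation module is the kernel of
  R^n \<rightarrow> M; its elements are the rows of the (full) relation matrix.
  Fitt_i is generated by all (n-i)-minors of this relation matrix
  (order-0 minors are 1, so Fitt_i = R for i \<ge> n).\<close>

definition relations :: "('r::comm_ring_1 \<Rightarrow> 'm::ab_group_add \<Rightarrow> 'm) \<Rightarrow> (nat \<Rightarrow> 'm) \<Rightarrow> nat \<Rightarrow> (nat \<Rightarrow> 'r) set" where
  "relations s g n = {c. (\<forall>j\<ge>n. c j = 0) \<and> (\<Sum>j<n. s (c j) (g j)) = 0}"

definition minors :: "('r::comm_ring_1 \<Rightarrow> 'm::ab_group_add \<Rightarrow> 'm) \<Rightarrow> (nat \<Rightarrow> 'm) \<Rightarrow> nat \<Rightarrow> nat \<Rightarrow> 'r set" where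
  "minors s g n m = {det (mat m m (\<lambda>(k, l). rows k (cols l))) | rows cols.
       (\<forall>k<m. rows k \<in> relations s g n) \<and> (\<forall>l<m. cols l < n)
       \<and> (\<forall>l l'. l < l' \<and> l' < m \<longrightarrow> cols l < cols l')}"

definition fitting_ideal :: "('r::comm_ring_1 \<Rightarrow> 'm::ab_group_add \<Rightarrow> 'm) \<Rightarrow> nat \<Rightarrow> 'r set" where
  "fitting_ideal s i =
     (let (g, n) = (SOME (g, n). Modules.module.span s (g ` {..<n}) = UNIV)
      in ideal_gen (minors s g n (n - i)))"

end

theory Submission
  imports Defs "HOL-Computational_Algebra.Factorial_Ring"
begin

text \<open>By Weierstrass division, an ideal of \<open>\<O>[[T]]\<close> that is saturated with respect to the uniformizer
  is principal. Hence \<open>\<O>[[T]]\<close> is factorial, its primes are \<open>0\<close>, the principal ideals \<open>(q)\<close> and the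
  maximal ideal, and an ideal lying in no \<open>(q)\<close> has finite quotient. So \<open>I \<prec> J\<close> can be tested at each
  prime element \<open>q\<close> separately, as can being a pseudo-isomorphism.

  Localizations are avoided: a statement ``at \<open>q\<close>'' holds up to multiplication by elements prime to
  \<open>q\<close>. At \<open>q\<close> a finitely generated torsion module is a direct sum of cyclic modules with annihilators
  \<open>(q ^ e\<^sub>0), (q ^ e\<^sub>1), \<dots>\<close>, where \<open>e\<^sub>0 \<ge> e\<^sub>1 \<ge> \<dots>\<close> are unique, and the \<open>q\<close>-valuation of its \<open>i\<close>-th
  Fitting ideal is \<open>\<Sum>j\<ge>i. e\<^sub>j\<close>. Thus the Fitting ideals up to \<open>\<sim>\<close> and the modules at all \<open>q\<close>
  determine each other. Finally, maps that are isomorphisms at the finitely many \<open>q\<close> dividing a common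
  annihilator are glued to a single map, using the factors of the annihilator as coefficients.\<close>

subsection \<open>Ideals and prime elements\<close>

text \<open>Neither side of the equivalence sees the maximal ideal. An ideal of height 2 is a proper
  ideal contained in no \<open>(q)\<close>, so \<open>ideal_prec\<close> only asks for a multiplier
  prime to each \<open>q\<close>. A finite module is killed by powers of every nonunit, and for each
  \<open>q\<close> some nonunit is prime to \<open>q\<close>. Conversely, finiteness of quotients
  turns multipliers prime to every \<open>q\<close> back into finite kernels and cokernels.

  Two points shape the details. \<open>fitting_ideal\<close> picks an unspecified generating family
  and takes all its relations, so valuations are computed for every generating family, by a
  triangular change of generators whose determinant is prime to \<open>q\<close>. And a kernel comes
  without generators of its own, so its finiteness is proved by induction on the generators of the
  ambient module, which requires control of colon ideals.\<close>

lemma is_idealD: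
  assumes "is_ideal I"
  shows "0 \<in> I" "x \<in> I \<Longrightarrow> y \<in> I \<Longrightarrow> x + y \<in> I" "x \<in> I \<Longrightarrow> r * x \<in> I" "x \<in> I \<Longrightarrow> x * r \<in> I"
    "x \<in> I \<Longrightarrow> - x \<in> I" "x \<in> I \<Longrightarrow> y \<in> I \<Longrightarrow> x - y \<in> I"
proof -
  show 0: "0 \<in> I" and add: "x \<in> I \<Longrightarrow> y \<in> I \<Longrightarrow> x + y \<in> I" and m: "x \<in> I \<Longrightarrow> r * x \<in> I" for x y r
    using assms by (auto simp: is_ideal_def)
  show "x \<in> I \<Longrightarrow> x * r \<in> I" using m[of x r] by (simp add: mult.commute)
  show neg: "x \<in> I \<Longrightarrow> - x \<in> I" for x using m[of x "-1"] by simp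
  show "x \<in> I \<Longrightarrow> y \<in> I \<Longrightarrow> x - y \<in> I" using add[of x "-y"] neg[of y] by simp
qed

lemma is_ideal_principal: "is_ideal {x. g dvd x}"
  by (auto simp: is_ideal_def)

lemma principal_eq_dvd: "{g * r | r. True} = {x. g dvd x}"
  by (auto simp: dvd_def)

lemma is_ideal_add_principal:
  assumes "is_ideal I"
  shows "is_ideal {x + a * r | x r. x \<in> I}"
  unfolding is_ideal_def
proof (intro conjI ballI allI)
  show "0 \<in> {x + a * r | x r. x \<in> I}"
    using is_idealD(1)[OF assms] by (auto intro!: exI[of _ 0])
next
  fix u v assume "u \<in> {x + a * r | x r. x \<in> I}" "v \<in> {x + a * r | x r. x \<in> I}"
  then obtain x r y s where "u = x + a * r" "v = y + a * s" "x \<in> I" "y \<in> I" by auto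
  then have "u + v = (x + y) + a * (r + s)" "x + y \<in> I"
    using is_idealD(2)[OF assms] by (auto simp: algebra_simps)
  then show "u + v \<in> {x + a * r | x r. x \<in> I}" by blast
next
  fix c u assume "u \<in> {x + a * r | x r. x \<in> I}"
  then obtain x r where "u = x + a * r" "x \<in> I" by auto
  then have "c * u = c * x + a * (c * r)" "c * x \<in> I"
    using is_idealD(3)[OF assms] by (simp_all add: distrib_left mult.left_commute)
  then show "c * u \<in> {x + a * r | x r. x \<in> I}" by blast
qed

lemma is_ideal_Union_chain:
  assumes "\<C> \<noteq> {}" and chain: "\<And>A B. A \<in> \<C> \<Longrightarrow> B \<in> \<C> \<Longrightarrow> A \<subseteq> B \<or> B \<subseteq> A"
    and ideal: "\<And>A. A \<in> \<C> \<Longrightarrow> is_ideal A"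
  shows "is_ideal (\<Union>\<C>)"
  unfolding is_ideal_def
proof (intro conjI ballI allI)
  show "0 \<in> \<Union>\<C>" using assms(1) is_idealD(1)[OF ideal] by blast
next
  fix x y assume "x \<in> \<Union>\<C>" "y \<in> \<Union>\<C>"
  then obtain A B where "A \<in> \<C>" "B \<in> \<C>" "x \<in> A" "y \<in> B" by blast
  then show "x + y \<in> \<Union>\<C>" using chain[of A B] is_idealD(2)[OF ideal] by blast
next
  fix r x assume "x \<in> \<Union>\<C>"
  then show "r * x \<in> \<Union>\<C>" using is_idealD(3)[OF ideal] by blast
qed

text \<open>An ideal maximal among those avoiding \<open>1\<close> is prime: if it contains
  \<open>a * b\<close> but not \<open>a\<close>, adjoining \<open>a\<close> produces
  \<open>1\<close>, and multiplying that equation by \<open>b\<close> shows that \<open>b\<close>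
  lies in it.\<close>

lemma ideal_subset_prime_ideal:
  assumes I: "is_ideal I" "1 \<notin> I"
  shows "\<exists>P. prime_ideal P \<and> I \<subseteq> P"
proof -
  define A where "A = {J. is_ideal J \<and> 1 \<notin> J \<and> I \<subseteq> J}"
  have "\<exists>M\<in>A. \<forall>X\<in>A. M \<subseteq> X \<longrightarrow> X = M"
  proof (rule subset_Zorn_nonempty)
    show "A \<noteq> {}" using I by (auto simp: A_def)
  next
    fix \<C> assume C: "\<C> \<noteq> {}" "subset.chain A \<C>"
    have "is_ideal (\<Union>\<C>)"
    proof (rule is_ideal_Union_chain[OF C(1)])
      show "X \<subseteq> Y \<or> Y \<subseteq> X" if "X \<in> \<C>" "Y \<in> \<C>" for X Y
        using C(2) that by (auto simp: subset.chain_def)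
      show "is_ideal X" if "X \<in> \<C>" for X
        using C(2) that by (auto simp: subset.chain_def A_def)
    qed
    then show "\<Union>\<C> \<in> A" using C by (auto simp: A_def subset.chain_def)
  qed
  then obtain M where "M \<in> A" and max': "\<forall>X\<in>A. M \<subseteq> X \<longrightarrow> X = M" ..
  then have M: "is_ideal M" "1 \<notin> M" "I \<subseteq> M" by (simp_all add: A_def)
  have max: "X = M" if "is_ideal X" "1 \<notin> X" "M \<subseteq> X" for X
    using max' that M(3) by (auto simp: A_def)
  have "a \<in> M \<or> b \<in> M" if ab: "a * b \<in> M" for a b
  proof (rule ccontr)
    assume "\<not> (a \<in> M \<or> b \<in> M)"
    then have a: "a \<notin> M" and b: "b \<notin> M" by auto
    let ?X = "{x + a * r | x r. x \<in> M}"
    have "M \<subseteq> ?X"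
    proof
      fix x assume "x \<in> M"
      then show "x \<in> ?X" by (intro CollectI exI[of _ x] exI[of _ 0]) simp
    qed
    moreover have "a \<in> ?X"
      using is_idealD(1)[OF M(1)] by (intro CollectI exI[of _ 0] exI[of _ 1]) simp
    ultimately have "1 \<in> ?X"
      using max[OF is_ideal_add_principal[OF M(1)], of a] a by auto
    then obtain x r where x: "x \<in> M" "1 = x + a * r" by auto
    have "b = b * (x + a * r)" using x(2) by simp
    also have "\<dots> = b * x + r * (a * b)" by (simp add: algebra_simps)
    also have "\<dots> \<in> M" by (intro is_idealD(2,3)[OF M(1)] x(1) ab)
    finally show False using b by simp
  qed
  then have "prime_ideal M" using M by (auto simp: prime_ideal_def)
  then show ?thesis using M(3) by blast
qed

lemma ideal_gen_is_ideal: "is_ideal (ideal_gen S)"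
  unfolding ideal_gen_def is_ideal_def by auto

lemma ideal_gen_superset: "S \<subseteq> ideal_gen S"
  unfolding ideal_gen_def by auto

lemma ideal_gen_least: "is_ideal J \<Longrightarrow> S \<subseteq> J \<Longrightarrow> ideal_gen S \<subseteq> J"
  unfolding ideal_gen_def by auto

lemma ideal_prod_subset_iff:
  assumes "is_ideal J"
  shows "ideal_prod A B \<subseteq> J \<longleftrightarrow> (\<forall>x\<in>A. \<forall>y\<in>B. x * y \<in> J)"
proof -
  let ?S = "{x * y | x y. x \<in> A \<and> y \<in> B}"
  have "ideal_gen ?S \<subseteq> J \<longleftrightarrow> ?S \<subseteq> J"
    using ideal_gen_least[OF assms, of ?S] ideal_gen_superset[of ?S] by (meson order_trans)
  also have "\<dots> \<longleftrightarrow> (\<forall>x\<in>A. \<forall>y\<in>B. x * y \<in> J)" by auto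
  finally show ?thesis by (simp add: ideal_prod_def)
qed

lemma ideal_pow_principal: "ideal_pow {x. g dvd x} k = {x. g ^ k dvd x}"
proof (induction k)
  case (Suc k)
  have "ideal_prod {x. g dvd x} {x. g ^ k dvd x} = {x. g * g ^ k dvd x}"
  proof
    show "ideal_prod {x. g dvd x} {x. g ^ k dvd x} \<subseteq> {x. g * g ^ k dvd x}"
      by (subst ideal_prod_subset_iff[OF is_ideal_principal]) (simp add: mult_dvd_mono)
    show "{x. g * g ^ k dvd x} \<subseteq> ideal_prod {x. g dvd x} {x. g ^ k dvd x}"
    proof
      fix x assume "x \<in> {x. g * g ^ k dvd x}"
      then obtain r where "x = g * g ^ k * r" by (auto elim: dvdE)
      then have "x = (g * r) * g ^ k" by (simp only: ac_simps)
      then have "x \<in> {x * y | x y. x \<in> {x. g dvd x} \<and> y \<in> {x. g ^ k dvd x}}"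
        by (intro CollectI exI[of _ "g * r"] exI[of _ "g ^ k"]) simp
      then show "x \<in> ideal_prod {x. g dvd x} {x. g ^ k dvd x}"
        unfolding ideal_prod_def by (rule subsetD[OF ideal_gen_superset])
    qed
  qed
  then show ?case using Suc by simp
qed simp

text \<open>This cancellation stands in for inverting the elements prime to \<open>q\<close>:
  cofactors that an argument has accumulated are removed by it.\<close>

lemma prime_power_dvd_mult_cancel:
  fixes q :: "'a::idom"
  assumes "prime_elem q" "\<not> q dvd u" "q ^ e dvd u * c"
  shows "q ^ e dvd c"
  using assms(3)
proof (induction e arbitrary: c)
  case (Suc e)
  have "q dvd u * c" using dvd_trans[OF dvd_power[of "Suc e" q] Suc.prems] by simp
  then have "q dvd c" using assms(2) prime_elem_dvd_multD[OF assms(1)] by blast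
  then obtain c' where c: "c = q * c'" by (rule dvdE)
  have "q * q ^ e dvd q * (u * c')" using Suc.prems by (simp add: c ac_simps)
  then have "q ^ e dvd u * c'" using prime_elem_not_zeroI[OF assms(1)] by simp
  then have "q ^ e dvd c'" by (rule Suc.IH)
  then show ?case by (simp add: c)
qed simp

subsection \<open>Decomposition of a torsion module at a prime element\<close>

lemma prime_power_dvd_power_imp_le:
  fixes q :: "'r::idom"
  assumes "prime_elem q" "q ^ a dvd q ^ b"
  shows "a \<le> b"
proof (rule ccontr)
  assume "\<not> a \<le> b"
  then have a: "a = b + Suc (a - b - 1)" by simp
  have "q ^ b * q ^ Suc (a - b - 1) dvd q ^ b * 1"
    using assms(2) by (subst (asm) a) (simp only: power_add mult_1_right)
  then have "q ^ Suc (a - b - 1) dvd 1"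
    using prime_elem_not_zeroI[OF assms(1)] by (metis dvd_times_left_cancel_iff power_not_zero)
  then have "q dvd 1" using dvd_trans[of q "q ^ Suc (a - b - 1)"] by simp
  then show False using prime_elem_not_unit[OF assms(1)] by simp
qed

lemma prime_elem_not_dvd_prod:
  fixes q :: "'r::idom"
  assumes "prime_elem q" "finite A" "\<And>i. i \<in> A \<Longrightarrow> \<not> q dvd f i"
  shows "\<not> q dvd prod f A"
  using assms(2,3)
proof (induction A rule: finite_induct)
  case empty
  then show ?case using prime_elem_not_unit[OF assms(1)] by simp
next
  case (insert x A)
  then show ?case using prime_elem_dvd_multD[OF assms(1)] by auto
qed

text \<open>Together with primality of \<open>q\<close>, this is what the module theory below asks
  of the ring, so that it works over any integral domain. Power series satisfy it by
  \<open>finite_valuation_prime\<close>.\<close>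

definition finite_valuation :: "'r::comm_ring_1 \<Rightarrow> bool" where
  "finite_valuation q \<longleftrightarrow> (\<forall>x. x \<noteq> 0 \<longrightarrow> (\<exists>k h. x = q ^ k * h \<and> \<not> q dvd h))"

locale idom_module = Modules.module scale
  for scale :: "'r::idom \<Rightarrow> 'm::ab_group_add \<Rightarrow> 'm" (infixr "*s" 75)
begin

lemma subspace_extend:
  assumes "subspace U"
  shows "subspace {w + d *s x | w d. w \<in> U}"
  unfolding subspace_def
proof (intro conjI ballI allI)
  show "0 \<in> {w + d *s x | w d. w \<in> U}"
    using subspace_0[OF assms] by (intro CollectI exI[of _ 0]) simp
next
  fix y z assume "y \<in> {w + d *s x | w d. w \<in> U}" "z \<in> {w + d *s x | w d. w \<in> U}"
  then obtain w d w' d' where "y = w + d *s x" "z = w' + d' *s x" "w \<in> U" "w' \<in> U" by auto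
  then have "y + z = (w + w') + (d + d') *s x" "w + w' \<in> U"
    using subspace_add[OF assms] by (simp_all add: scale_left_distrib)
  then show "y + z \<in> {w + d *s x | w d. w \<in> U}" by blast
next
  fix c y assume "y \<in> {w + d *s x | w d. w \<in> U}"
  then obtain w d where "y = w + d *s x" "w \<in> U" by auto
  then have "c *s y = c *s w + (c * d) *s x" "c *s w \<in> U"
    using subspace_scale[OF assms] by (simp_all add: scale_right_distrib)
  then show "c *s y \<in> {w + d *s x | w d. w \<in> U}" by blast
qed

text \<open>Splitting off a generator of maximal order modulo \<open>U\<close>: up to factors prime to \<open>q\<close>, the
  other generators can be corrected by multiples of it without increasing their orders.\<close>

lemma local_decomposition_mod:
  assumes q: "prime_elem q"
    and val: "finite_valuation q"
    and "subspace U" "finite G" "card G = m"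
    and r: "r \<noteq> 0" and ann: "\<And>x. r *s x \<in> U"
    and gen: "\<And>x. \<exists>c. x - (\<Sum>i\<in>G. c i *s g i) \<in> U"
  shows "\<exists>\<sigma> P e h. bij_betw \<sigma> {..<m} G \<and> (\<forall>j<m. h j = (\<Sum>k\<le>j. P j k *s g (\<sigma> k)))
    \<and> (\<forall>j<m. \<not> q dvd P j j) \<and> (\<forall>i j. i \<le> j \<longrightarrow> e j \<le> e i) \<and> (\<forall>j\<ge>m. e j = (0::nat))
    \<and> (\<exists>u. \<not> q dvd u \<and> (\<forall>j<m. (u * q ^ e j) *s h j \<in> U))
    \<and> (\<forall>c. (\<Sum>j<m. c j *s h j) \<in> U \<longrightarrow> (\<forall>j<m. q ^ e j dvd c j))
    \<and> (\<exists>u. \<not> q dvd u \<and> (\<forall>x. \<exists>c. u *s x - (\<Sum>j<m. c j *s h j) \<in> U))"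
  using assms(3-5) ann gen
\<comment> \<open>\<open>U\<close> varies because it absorbs the generators already split off; a
  growing submodule replaces the passage to quotient modules.\<close>
proof (induction m arbitrary: G U)
  case 0
  then have "G = {}" by simp
  then have "x \<in> U" for x using 0(5)[of x] by simp
  then show ?case using prime_elem_not_unit[OF q] \<open>G = {}\<close>
    by (intro exI[of _ "\<lambda>_. undefined"] exI[of _ "\<lambda>_ _. 1"] exI[of _ "\<lambda>_. 0"] exI[of _ "\<lambda>_. 0"])
      (auto simp: bij_betw_def intro!: exI[of _ 1])
next
  case (Suc m)
  note U = Suc.prems(1)
  \<comment> \<open>The exponent of the order of \<open>g i\<close> modulo \<open>U\<close> at
    \<open>q\<close>. It exists because \<open>r\<close> kills everything modulo \<open>U\<close>
    and is a power of \<open>q\<close> times an element prime to \<open>q\<close>.\<close>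
  define ord where "ord i = (LEAST k. \<exists>u. \<not> q dvd u \<and> (u * q ^ k) *s g i \<in> U)" for i
  have ord: "\<exists>u. \<not> q dvd u \<and> (u * q ^ ord i) *s g i \<in> U" for i
  proof -
    obtain k h where "r = q ^ k * h" "\<not> q dvd h" using val r unfolding finite_valuation_def by blast
    then have "\<exists>k. \<exists>u. \<not> q dvd u \<and> (u * q ^ k) *s g i \<in> U"
      using Suc.prems(4)[of "g i"] by (intro exI[of _ k] exI[of _ h]) (simp add: mult.commute)
    then show ?thesis unfolding ord_def by (rule LeastI_ex)
  qed
  then obtain v where v: "\<And>i. \<not> q dvd v i" "\<And>i. (v i * q ^ ord i) *s g i \<in> U" by metis
  have "G \<noteq> {}" using Suc.prems(3) by auto
  then have "Max (ord ` G) \<in> ord ` G" using Suc.prems(2) by (intro Max_in) auto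
  then obtain i0 where i0: "i0 \<in> G" "ord i0 = Max (ord ` G)" by auto
  define e0 where "e0 = ord i0"
  define x where "x = g i0"
  have le: "ord i \<le> e0" if "i \<in> G" for i using that i0 Suc.prems(2) by (simp add: e0_def)
  define u0 where "u0 = prod v G"
  have u0: "\<not> q dvd u0" unfolding u0_def using q Suc.prems(2) v(1) by (rule prime_elem_not_dvd_prod)
  \<comment> \<open>By maximality of \<open>e0\<close> a single element sends the whole module into
    \<open>U\<close>. The bound on the later exponents and the correction of the later generators
    both rest on this.\<close>
  have kill: "(u0 * q ^ e0) *s y \<in> U" for y
  proof -
    have gi: "(u0 * q ^ e0) *s g i \<in> U" if "i \<in> G" for i
    proof -
      have "u0 = v i * prod v (G - {i})" unfolding u0_def using that Suc.prems(2) by (simp add: prod.remove)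
      moreover have "q ^ e0 = q ^ ord i * q ^ (e0 - ord i)" using le[OF that] by (simp flip: power_add)
      ultimately have "u0 * q ^ e0 = (prod v (G - {i}) * q ^ (e0 - ord i)) * (v i * q ^ ord i)"
        by (simp add: ac_simps)
      then have "(u0 * q ^ e0) *s g i = (prod v (G - {i}) * q ^ (e0 - ord i)) *s ((v i * q ^ ord i) *s g i)"
        by (simp only: scale_scale)
      then show ?thesis using subspace_scale[OF U v(2)[of i]] by simp
    qed
    obtain c where c: "y - (\<Sum>i\<in>G. c i *s g i) \<in> U" using Suc.prems(5) by blast
    have "(u0 * q ^ e0) *s y = (u0 * q ^ e0) *s (y - (\<Sum>i\<in>G. c i *s g i))
        + (\<Sum>i\<in>G. c i *s ((u0 * q ^ e0) *s g i))"
      by (simp add: scale_right_diff_distrib scale_sum_right mult.commute)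
    also have "\<dots> \<in> U"
      by (rule subspace_add[OF U subspace_scale[OF U c] subspace_sum[OF U subspace_scale[OF U gi]]])
    finally show ?thesis .
  qed
  have exact: "q ^ e0 dvd c" if "c *s x \<in> U" for c
  proof (cases "c = 0")
    case False
    then obtain k h where h: "c = q ^ k * h" "\<not> q dvd h" using val unfolding finite_valuation_def by blast
    then have "\<exists>u. \<not> q dvd u \<and> (u * q ^ k) *s g i0 \<in> U"
      using that by (intro exI[of _ h]) (simp add: x_def mult.commute)
    then have "e0 \<le> k" unfolding e0_def ord_def by (rule Least_le)
    then show ?thesis using h(1) le_imp_power_dvd dvd_mult2 by blast
  qed simp
  define U' where "U' = {w + d *s x | w d. w \<in> U}"
  have U': "subspace U'" unfolding U'_def by (rule subspace_extend[OF U])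
  have UU': "w \<in> U'" if "w \<in> U" for w
    unfolding U'_def using that by (intro CollectI exI[of _ w] exI[of _ 0]) simp
  have xU': "d *s x \<in> U'" for d
    unfolding U'_def using subspace_0[OF U] by (intro CollectI exI[of _ 0] exI[of _ d]) simp
  have gen': "\<exists>c. y - (\<Sum>i\<in>G - {i0}. c i *s g i) \<in> U'" for y
  proof -
    obtain c where "y - (\<Sum>i\<in>G. c i *s g i) \<in> U" using Suc.prems(5) by blast
    then have "(y - (\<Sum>i\<in>G. c i *s g i)) + c i0 *s x \<in> U'"
      using UU' xU' subspace_add[OF U'] by blast
    moreover have "(\<Sum>i\<in>G. c i *s g i) = c i0 *s x + (\<Sum>i\<in>G - {i0}. c i *s g i)"
      using i0(1) Suc.prems(2) by (simp add: sum.remove x_def)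
    ultimately show ?thesis by (intro exI[of _ c]) simp
  qed
  have card: "card (G - {i0}) = m" using Suc.prems(2,3) i0(1) by simp
  obtain \<sigma>' P' e' h' u1 u2 where bij: "bij_betw \<sigma>' {..<m} (G - {i0})"
    and h': "\<forall>j<m. h' j = (\<Sum>k\<le>j. P' j k *s g (\<sigma>' k))" and P': "\<forall>j<m. \<not> q dvd P' j j"
    and mono: "\<forall>i j. i \<le> j \<longrightarrow> e' j \<le> e' i" and zero: "\<forall>j\<ge>m. e' j = (0::nat)"
    and u1: "\<not> q dvd u1" and u1_U': "\<forall>j<m. (u1 * q ^ e' j) *s h' j \<in> U'"
    and indep: "\<forall>c. (\<Sum>j<m. c j *s h' j) \<in> U' \<longrightarrow> (\<forall>j<m. q ^ e' j dvd c j)"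
    and u2: "\<not> q dvd u2" and u2_U': "\<forall>x. \<exists>c. u2 *s x - (\<Sum>j<m. c j *s h' j) \<in> U'"
    using Suc.IH[OF U' finite_Diff[OF Suc.prems(2)] card UU'[OF Suc.prems(4)] gen']
    by (elim exE conjE) (rule that; assumption)
  have e'_le: "e' j \<le> e0" for j
  proof (cases "j < m")
    case True
    have "(\<Sum>l<m. (if l = j then u0 * q ^ e0 else 0) *s h' l) = (\<Sum>l<m. if l = j then (u0 * q ^ e0) *s h' j else 0)"
      by (intro sum.cong) auto
    also have "\<dots> = (u0 * q ^ e0) *s h' j" using True by simp
    finally have "(\<Sum>l<m. (if l = j then u0 * q ^ e0 else 0) *s h' l) \<in> U'" using UU'[OF kill] by simp
    then have "q ^ e' j dvd u0 * q ^ e0" using indep[rule_format, OF _ True] by fastforce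
    then have "q ^ e' j dvd q ^ e0" by (rule prime_power_dvd_mult_cancel[OF q u0])
    then show ?thesis by (rule prime_power_dvd_power_imp_le[OF q])
  qed (use zero in simp)
  \<comment> \<open>The left element is some \<open>d *s x\<close> modulo \<open>U\<close>.
    Multiplication by \<open>u0 * q ^ (e0 - e' j)\<close> moves it into \<open>U\<close>, so
    \<open>exact\<close> forces \<open>q ^ e' j dvd d\<close>: the multiple of \<open>x\<close> to
    be subtracted has \<open>q ^ e' j\<close> as a factor.\<close>
  have "\<exists>b. (u1 * q ^ e' j) *s h' j - (q ^ e' j * b) *s x \<in> U" if j: "j < m" for j
  proof -
    obtain w d where w: "(u1 * q ^ e' j) *s h' j = w + d *s x" "w \<in> U"
      using u1_U' j unfolding U'_def by blast
    define a where "a = u0 * q ^ (e0 - e' j)"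
    have "q ^ e0 = q ^ e' j * q ^ (e0 - e' j)" using e'_le[of j] by (simp flip: power_add)
    then have "a * (u1 * q ^ e' j) = u1 * (u0 * q ^ e0)" by (simp add: a_def ac_simps)
    then have "a *s ((u1 * q ^ e' j) *s h' j) = u1 *s ((u0 * q ^ e0) *s h' j)" by (simp only: scale_scale)
    then have "a *s (w + d *s x) \<in> U" using subspace_scale[OF U kill] by (simp add: w(1))
    then have "a *s (w + d *s x) - a *s w \<in> U" using subspace_scale[OF U w(2)] subspace_diff[OF U] by blast
    then have "(a * d) *s x \<in> U" by (simp add: scale_right_distrib)
    then have "q ^ e0 dvd u0 * (q ^ (e0 - e' j) * d)" using exact by (simp add: a_def mult.assoc)
    then have "q ^ e0 dvd q ^ (e0 - e' j) * d" by (rule prime_power_dvd_mult_cancel[OF q u0])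
    then have "q ^ (e0 - e' j) * q ^ e' j dvd q ^ (e0 - e' j) * d" using e'_le[of j] by (simp flip: power_add)
    then have "q ^ e' j dvd d"
      using prime_elem_not_zeroI[OF q] by (metis dvd_times_left_cancel_iff power_not_zero)
    then obtain b where "d = q ^ e' j * b" by (rule dvdE)
    then show ?thesis using w by (intro exI[of _ b]) simp
  qed
  then obtain b where b: "\<And>j. j < m \<Longrightarrow> (u1 * q ^ e' j) *s h' j - (q ^ e' j * b j) *s x \<in> U" by metis
  \<comment> \<open>The new generator goes in front and the old ones are corrected by
    \<open>b\<close>; the triangular matrix gains the first column \<open>- b\<close>, and its old
    entries are multiplied by \<open>u1\<close>.\<close>
  define \<sigma> where "\<sigma> = case_nat i0 \<sigma>'"
  define e where "e = case_nat e0 e'"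
  define h where "h = case_nat x (\<lambda>j. u1 *s h' j - b j *s x)"
  define P where "P = case_nat (\<lambda>_. 1) (\<lambda>j. case_nat (- b j) (\<lambda>k. u1 * P' j k))"
  have hU: "q ^ e' j *s h (Suc j) \<in> U" if "j < m" for j
    using b[OF that] by (simp add: h_def scale_right_diff_distrib mult.commute)
  have "bij_betw \<sigma> {..<Suc m} G"
  proof -
    have "\<sigma> ` {..<Suc m} = insert i0 (\<sigma>' ` {..<m})"
      by (simp add: lessThan_Suc_eq_insert_0 \<sigma>_def image_image)
    then have "\<sigma> ` {..<Suc m} = G" using bij i0(1) by (auto simp: bij_betw_def)
    moreover have "inj_on \<sigma> {..<Suc m}"
      by (rule eq_card_imp_inj_on) (use calculation Suc.prems(3) in simp_all)
    ultimately show ?thesis by (simp add: bij_betw_def)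
  qed
  moreover have "h j = (\<Sum>k\<le>j. P j k *s g (\<sigma> k))" if "j < Suc m" for j
  proof (cases j)
    case 0
    then show ?thesis by (simp add: h_def P_def \<sigma>_def x_def)
  next
    case (Suc i)
    then have "h' i = (\<Sum>k\<le>i. P' i k *s g (\<sigma>' k))" using h' that by simp
    then show ?thesis
      by (simp add: Suc h_def P_def \<sigma>_def x_def sum.atMost_Suc_shift scale_sum_right del: sum.atMost_Suc)
  qed
  moreover have "\<not> q dvd P j j" if "j < Suc m" for j
    using P' u1 prime_elem_dvd_multD[OF q] prime_elem_not_unit[OF q] that
    by (cases j) (auto simp: P_def)
  moreover have "e j \<le> e i" if "i \<le> j" for i j
    using that mono e'_le by (cases i; cases j) (auto simp: e_def)
  moreover have "e j = 0" if "j \<ge> Suc m" for j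
    using that zero by (cases j) (auto simp: e_def)
  moreover have "\<exists>u. \<not> q dvd u \<and> (\<forall>j<Suc m. (u * q ^ e j) *s h j \<in> U)"
  \<comment> \<open>Only the first generator needs a cofactor: by \<open>hU\<close> the corrected
    ones are sent into \<open>U\<close> by their power of \<open>q\<close> alone.\<close>
  proof (intro exI[of _ "v i0"] conjI allI impI)
    fix j assume "j < Suc m"
    then show "(v i0 * q ^ e j) *s h j \<in> U"
    proof (cases j)
      case 0
      then show ?thesis using v(2)[of i0] by (simp add: e_def h_def e0_def x_def)
    next
      case (Suc i)
      then have "v i0 *s (q ^ e' i *s h (Suc i)) \<in> U"
        using \<open>j < Suc m\<close> by (intro subspace_scale[OF U] hU) simp
      then show ?thesis by (simp add: Suc e_def)
    qed
  qed (use v(1) in simp)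
  \<comment> \<open>Modulo \<open>U'\<close> the relation gives divisibility in the tail. Then each
    tail term lies in \<open>U\<close> by \<open>hU\<close>, leaving a relation for \<open>x\<close>
    alone, to which \<open>exact\<close> applies.\<close>
  moreover have "\<forall>j<Suc m. q ^ e j dvd c j" if c: "(\<Sum>j<Suc m. c j *s h j) \<in> U" for c
  proof -
    define z where "z = (\<Sum>j<m. c (Suc j) *s h (Suc j))"
    have cz: "c 0 *s x + z \<in> U"
      using c by (simp add: sum.lessThan_Suc_shift z_def h_def del: sum.lessThan_Suc)
    have "(\<Sum>j<m. (u1 * c (Suc j)) *s h' j) = z + (\<Sum>j<m. c (Suc j) * b j) *s x"
      by (simp add: z_def h_def scale_right_diff_distrib sum_subtractf scale_sum_left mult.commute)
    also have "\<dots> = (c 0 *s x + z) + ((\<Sum>j<m. c (Suc j) * b j) - c 0) *s x"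
      by (simp add: scale_left_diff_distrib)
    also have "\<dots> \<in> U'" using UU'[OF cz] xU' subspace_add[OF U'] by blast
    finally have "\<forall>j<m. q ^ e' j dvd u1 * c (Suc j)"
      using indep[THEN spec, of "\<lambda>j. u1 * c (Suc j)"] by blast
    then have dv: "q ^ e' j dvd c (Suc j)" if "j < m" for j
      using prime_power_dvd_mult_cancel[OF q u1] that by blast
    have "c (Suc j) *s h (Suc j) \<in> U" if j: "j < m" for j
    proof -
      obtain d where "c (Suc j) = q ^ e' j * d" using dv[OF j] by (rule dvdE)
      then have "c (Suc j) *s h (Suc j) = d *s (q ^ e' j *s h (Suc j))" by (simp add: mult.commute)
      then show ?thesis using subspace_scale[OF U hU[OF j]] by simp
    qed
    then have "z \<in> U" unfolding z_def by (intro subspace_sum[OF U]) simp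
    then have "c 0 *s x \<in> U" using subspace_diff[OF U cz] by fastforce
    then have c0: "q ^ e0 dvd c 0" by (rule exact)
    show ?thesis
    proof (intro allI impI)
      fix j assume "j < Suc m"
      then show "q ^ e j dvd c j" using c0 dv by (cases j) (auto simp: e_def)
    qed
  qed
  moreover have "\<exists>u. \<not> q dvd u \<and> (\<forall>y. \<exists>c. u *s y - (\<Sum>j<Suc m. c j *s h j) \<in> U)"
  proof (intro exI[of _ "u1 * u2"] conjI allI)
    show "\<not> q dvd u1 * u2" using u1 u2 prime_elem_dvd_multD[OF q] by blast
    fix y
    obtain c where "u2 *s y - (\<Sum>j<m. c j *s h' j) \<in> U'" using u2_U' by blast
    then obtain w d where w: "u2 *s y - (\<Sum>j<m. c j *s h' j) = w + d *s x" "w \<in> U"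
      unfolding U'_def by blast
    define c' where "c' = case_nat ((\<Sum>j<m. c j * b j) + u1 * d) c"
    have "(\<Sum>j<Suc m. c' j *s h j) = ((\<Sum>j<m. c j * b j) + u1 * d) *s x + (\<Sum>j<m. c j *s (u1 *s h' j - b j *s x))"
      by (simp add: sum.lessThan_Suc_shift c'_def h_def del: sum.lessThan_Suc)
    also have "\<dots> = u1 *s (d *s x) + u1 *s (\<Sum>j<m. c j *s h' j)"
      by (simp add: scale_left_distrib scale_right_diff_distrib sum_subtractf scale_sum_left
          scale_sum_right mult.commute)
    finally have "(u1 * u2) *s y - (\<Sum>j<Suc m. c' j *s h j) = u1 *s ((u2 *s y - (\<Sum>j<m. c j *s h' j)) - d *s x)"
      by (simp add: scale_right_diff_distrib)
    also have "\<dots> = u1 *s w" using w(1) by simp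
    finally show "\<exists>c. (u1 * u2) *s y - (\<Sum>j<Suc m. c j *s h j) \<in> U"
      using subspace_scale[OF U w(2)] by metis
  qed
  ultimately show ?case
    by (intro exI[of _ \<sigma>] exI[of _ P] exI[of _ e] exI[of _ h] conjI) blast+
qed

end

subsection \<open>Valuations of Fitting ideals\<close>

text \<open>For decreasing exponents the last indices are the cheapest choice. If \<open>n\<close>
  is not in \<open>S\<close>, the window is shifted down by one, which can only increase its
  sum.\<close>

lemma sum_tail_le:
  fixes e :: "nat \<Rightarrow> nat"
  assumes mono: "\<And>i j. i \<le> j \<Longrightarrow> e j \<le> e i" and "S \<subseteq> {..<n}"
  shows "sum e {n - card S..<n} \<le> sum e S"
  using assms(2)
proof (induction n arbitrary: S)
  case (Suc n)
  have fin: "finite S" using Suc.prems finite_subset by blast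
  show ?case
  proof (cases "n \<in> S")
    case True
    have sub: "S - {n} \<subseteq> {..<n}" using Suc.prems by auto
    have "card S = Suc (card (S - {n}))" using card.remove[OF fin True] .
    moreover have "card (S - {n}) \<le> n" using card_mono[OF _ sub] by simp
    ultimately have "{Suc n - card S..<Suc n} = insert n {n - card (S - {n})..<n}" by auto
    then have "sum e {Suc n - card S..<Suc n} = e n + sum e {n - card (S - {n})..<n}" by simp
    also have "\<dots> \<le> e n + sum e (S - {n})" using Suc.IH[OF sub] by simp
    also have "\<dots> = sum e S" using sum.remove[OF fin True] by metis
    finally show ?thesis .
  next
    case False
    then have sub: "S \<subseteq> {..<n}" using Suc.prems less_Suc_eq by fastforce
    have "card S \<le> n" using card_mono[OF _ sub] by simp
    then have "sum e {Suc n - card S..<Suc n} = (\<Sum>j\<in>{n - card S..<n}. e (Suc j))"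
      by (simp add: Suc_diff_le sum.shift_bounds_Suc_ivl del: sum.op_ivl_Suc)
    also have "\<dots> \<le> sum e {n - card S..<n}" by (intro sum_mono mono) simp
    also have "\<dots> \<le> sum e S" by (rule Suc.IH[OF sub])
    finally show ?thesis .
  qed
qed simp

text \<open>Multilinear expansion of the determinant along the rows: only injective choices of one index
  per row survive, and each contributes at least the sum of the \<open>m\<close> smallest exponents.\<close>

lemma prime_power_dvd_det:
  fixes q :: "'r::idom"
  assumes mono: "\<And>i j. i \<le> j \<Longrightarrow> e j \<le> e i"
    and D: "\<And>k j. k < m \<Longrightarrow> j < n \<Longrightarrow> q ^ e j dvd D k j"
  shows "q ^ sum e {n - m..<n} dvd det (mat m m (\<lambda>(k, l). \<Sum>j<n. D k j * B j l))"
proof -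
  define a where "a k j = D k j \<cdot>\<^sub>v vec m (B j)" for k j
  have a: "a \<in> {0..<m} \<rightarrow> {..<n} \<rightarrow> carrier_vec m" by (auto simp: a_def)
  have "mat m m (\<lambda>(k, l). \<Sum>j<n. D k j * B j l) = mat\<^sub>r m m (\<lambda>k. finsum_vec TYPE('r) m (a k) {..<n})"
  proof (rule eq_matI)
    fix k l assume kl: "k < dim_row (mat\<^sub>r m m (\<lambda>k. finsum_vec TYPE('r) m (a k) {..<n}))"
      "l < dim_col (mat\<^sub>r m m (\<lambda>k. finsum_vec TYPE('r) m (a k) {..<n}))"
    have "finsum_vec TYPE('r) m (a k) {..<n} $ l = (\<Sum>j<n. a k j $ l)"
      using kl by (intro index_finsum_vec) (auto simp: a_def)
    then show "mat m m (\<lambda>(k, l). \<Sum>j<n. D k j * B j l) $$ (k, l)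
        = mat\<^sub>r m m (\<lambda>k. finsum_vec TYPE('r) m (a k) {..<n}) $$ (k, l)"
      using kl by (simp add: a_def)
  qed simp_all
  then have "det (mat m m (\<lambda>(k, l). \<Sum>j<n. D k j * B j l)) = (\<Sum>f\<in>{f. (\<forall>i\<in>{0..<m}. f i \<in> {..<n}) \<and>
      (\<forall>i. i \<notin> {0..<m} \<longrightarrow> f i = i)}. det (mat\<^sub>r m m (\<lambda>k. a k (f k))))"
    using det_linear_rows_sum[OF _ a] by simp
  also have "q ^ sum e {n - m..<n} dvd \<dots>"
  proof (rule dvd_sum)
    fix f assume f: "f \<in> {f. (\<forall>i\<in>{0..<m}. f i \<in> {..<n}) \<and> (\<forall>i. i \<notin> {0..<m} \<longrightarrow> f i = i)}"
    have det: "det (mat\<^sub>r m m (\<lambda>k. a k (f k)))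
        = (\<Prod>k\<in>{0..<m}. D k (f k)) * det (mat\<^sub>r m m (\<lambda>k. vec m (B (f k))))"
      unfolding a_def by (rule det_rows_mul) simp
    show "q ^ sum e {n - m..<n} dvd det (mat\<^sub>r m m (\<lambda>k. a k (f k)))"
    proof (cases "inj_on f {0..<m}")
      case True
      have "(\<Prod>k\<in>{0..<m}. q ^ e (f k)) dvd (\<Prod>k\<in>{0..<m}. D k (f k))"
        using f by (intro prod_dvd_prod D) auto
      then have "q ^ (\<Sum>k\<in>{0..<m}. e (f k)) dvd (\<Prod>k\<in>{0..<m}. D k (f k))" by (simp add: power_sum)
      moreover have "(\<Sum>k\<in>{0..<m}. e (f k)) = sum e (f ` {0..<m})"
        using sum.reindex[OF True, of e] by simp
      moreover have "sum e {n - card (f ` {0..<m})..<n} \<le> sum e (f ` {0..<m})"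
      proof (rule sum_tail_le)
        show "e j \<le> e i" if "i \<le> j" for i j using that by (rule mono)
        show "f ` {0..<m} \<subseteq> {..<n}" using f by blast
      qed
      then have "sum e {n - m..<n} \<le> sum e (f ` {0..<m})" by (simp add: card_image[OF True])
      ultimately have "q ^ sum e {n - m..<n} dvd (\<Prod>k\<in>{0..<m}. D k (f k))"
        using dvd_trans[OF le_imp_power_dvd] by metis
      then show ?thesis unfolding det by (rule dvd_mult2)
    next
      case False
      then obtain i j where ij: "i < m" "j < m" "i \<noteq> j" "f i = f j" by (auto simp: inj_on_def)
      have "det (mat\<^sub>r m m (\<lambda>k. vec m (B (f k)))) = 0"
        by (rule det_identical_rows[OF _ ij(3,1,2)]) (use ij in simp_all)
      then show ?thesis by (simp add: det)
    qed
  qed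
  finally show ?thesis .
qed

lemma det_permute_cols:
  fixes f :: "nat \<Rightarrow> nat \<Rightarrow> 'r::comm_ring_1"
  assumes "\<tau> permutes {0..<m}"
  shows "det (mat m m (\<lambda>(k, l). f k (\<tau> l))) = signof \<tau> * det (mat m m (\<lambda>(k, l). f k l))"
proof -
  have "det (mat m m (\<lambda>(k, l). f k (\<tau> l))) = det (transpose_mat (mat m m (\<lambda>(k, l). f k (\<tau> l))))"
    by (rule det_transpose[symmetric, where n = m]) simp
  also have "transpose_mat (mat m m (\<lambda>(k, l). f k (\<tau> l)))
      = mat m m (\<lambda>(i, j). mat m m (\<lambda>(k, l). f l k) $$ (\<tau> i, j))"
    using permutes_in_image[OF assms] by (intro eq_matI) auto
  also have "det \<dots> = signof \<tau> * det (mat m m (\<lambda>(k, l). f l k))"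
    by (rule det_permute_rows[OF _ assms]) simp
  also have "mat m m (\<lambda>(k, l). f l k) = transpose_mat (mat m m (\<lambda>(k, l). f k l))"
    by (intro eq_matI) auto
  also have "det \<dots> = det (mat m m (\<lambda>(k, l). f k l))"
    by (rule det_transpose[where n = m]) simp
  finally show ?thesis .
qed

text \<open>\<open>minors\<close> admits only increasing columns, while the choice needed below
  comes in permuted order; sorting it costs at most the sign \<open>\<epsilon>\<close>.\<close>

lemma inj_cols_minor:
  fixes s :: "'r::comm_ring_1 \<Rightarrow> 'm::ab_group_add \<Rightarrow> 'm"
  assumes R: "\<And>k. k < m \<Longrightarrow> R k \<in> relations s g n"
    and inj: "inj_on c {..<m}" and c: "\<And>l. l < m \<Longrightarrow> c l < n"
  obtains \<epsilon> :: 'r where "\<epsilon> = 1 \<or> \<epsilon> = -1" "\<epsilon> * det (mat m m (\<lambda>(k, l). R k (c l))) \<in> minors s g n m"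
proof -
  define xs where "xs = sorted_list_of_set (c ` {..<m})"
  have len: "length xs = m" using card_image[OF inj] by (simp add: xs_def)
  have set: "set xs = c ` {..<m}" by (simp add: xs_def)
  have bij1: "bij_betw ((!) xs) {..<m} (c ` {..<m})"
    by (rule bij_betw_nth) (simp_all only: len set, simp add: xs_def)
  have bij2: "bij_betw c {..<m} (c ` {..<m})" using inj by (simp add: bij_betw_def)
  define \<tau> where "\<tau> l = (if l < m then inv_into {..<m} c (xs ! l) else l)" for l
  have "bij_betw (inv_into {..<m} c \<circ> (!) xs) {..<m} {..<m}"
    by (rule bij_betw_trans[OF bij1 bij_betw_inv_into[OF bij2]])
  then have "bij_betw \<tau> {..<m} {..<m}"
    by (rule bij_betw_cong[THEN iffD1, rotated]) (simp add: \<tau>_def)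
  then have perm: "\<tau> permutes {0..<m}"
    by (intro bij_imp_permutes) (auto simp: \<tau>_def atLeast0LessThan)
  have c_\<tau>: "c (\<tau> l) = xs ! l" if "l < m" for l
    using that bij1 f_inv_into_f[of "xs ! l" c "{..<m}"] by (auto simp: \<tau>_def bij_betw_def)
  have "det (mat m m (\<lambda>(k, l). R k (xs ! l))) = det (mat m m (\<lambda>(k, l). R k (c (\<tau> l))))"
    by (intro arg_cong[of _ _ det] eq_matI) (auto simp: c_\<tau>)
  also have "\<dots> = signof \<tau> * det (mat m m (\<lambda>(k, l). R k (c l)))"
    by (rule det_permute_cols[OF perm])
  finally have eq: "signof \<tau> * det (mat m m (\<lambda>(k, l). R k (c l))) = det (mat m m (\<lambda>(k, l). R k (xs ! l)))"
    by simp
  have "det (mat m m (\<lambda>(k, l). R k (xs ! l))) \<in> minors s g n m"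
    unfolding minors_def
  proof (intro CollectI exI[of _ R] exI[of _ "(!) xs"] conjI allI impI)
    fix l assume "l < m"
    then have "xs ! l \<in> c ` {..<m}" using len set nth_mem by metis
    then show "xs ! l < n" using c by auto
  next
    fix l l' assume "l < l' \<and> l' < m"
    then show "xs ! l < xs ! l'"
      using strict_sorted_list_of_set[of "c ` {..<m}"] len
      unfolding xs_def[symmetric] by (simp add: sorted_wrt_iff_nth_less)
  qed (use R in auto)
  then have "signof \<tau> * det (mat m m (\<lambda>(k, l). R k (c l))) \<in> minors s g n m" by (simp add: eq)
  moreover have "(signof \<tau> :: 'r) = 1 \<or> (signof \<tau> :: 'r) = -1" by (simp add: sign_def)
  ultimately show ?thesis by (rule that[rotated])
qed

text \<open>After inverting the elements prime to \<open>q\<close>, the module becomes the direct sum of the cyclic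
  modules generated by \<open>h j\<close>, with annihilator generated by \<open>q ^ e j\<close>.\<close>

definition local_decomp ::
  "('r::idom \<Rightarrow> 'm::ab_group_add \<Rightarrow> 'm) \<Rightarrow> 'r \<Rightarrow> nat \<Rightarrow> (nat \<Rightarrow> 'm) \<Rightarrow> (nat \<Rightarrow> nat) \<Rightarrow> bool" where
  "local_decomp s q n h e \<longleftrightarrow>
     (\<forall>i j. i \<le> j \<longrightarrow> e j \<le> e i) \<and> (\<forall>j\<ge>n. e j = 0) \<and>
     (\<exists>u. \<not> q dvd u \<and> (\<forall>x. \<exists>c. s u x = (\<Sum>j<n. s (c j) (h j)))) \<and>
     (\<exists>u. \<not> q dvd u \<and> (\<forall>j<n. s (u * q ^ e j) (h j) = 0)) \<and>
     (\<forall>c. (\<Sum>j<n. s (c j) (h j)) = 0 \<longrightarrow> (\<forall>j<n. q ^ e j dvd c j))"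

context idom_module
begin

lemma span_image_eq_sum:
  assumes "finite A" "x \<in> span (g ` A)"
  obtains c where "x = (\<Sum>i\<in>A. c i *s g i)"
proof -
  define S where "S = {(\<Sum>i\<in>A. c i *s g i) | c. True}"
  have "subspace S"
    unfolding subspace_def
  proof (intro conjI ballI allI)
    show "0 \<in> S" unfolding S_def by (intro CollectI exI[of _ "\<lambda>_. 0"]) simp
  next
    fix y z assume "y \<in> S" "z \<in> S"
    then obtain c d where "y = (\<Sum>i\<in>A. c i *s g i)" "z = (\<Sum>i\<in>A. d i *s g i)" by (auto simp: S_def)
    then have "y + z = (\<Sum>i\<in>A. (c i + d i) *s g i)" by (simp add: scale_left_distrib sum.distrib)
    then show "y + z \<in> S" unfolding S_def by (intro CollectI exI[of _ "\<lambda>i. c i + d i"]) simp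
  next
    fix r y assume "y \<in> S"
    then obtain c where "y = (\<Sum>i\<in>A. c i *s g i)" by (auto simp: S_def)
    then have "r *s y = (\<Sum>i\<in>A. (r * c i) *s g i)" by (simp add: scale_sum_right)
    then show "r *s y \<in> S" unfolding S_def by (intro CollectI exI[of _ "\<lambda>i. r * c i"]) simp
  qed
  moreover have "g ` A \<subseteq> S"
  proof
    fix y assume "y \<in> g ` A"
    then obtain j where j: "j \<in> A" "y = g j" by auto
    have "(\<Sum>i\<in>A. (if i = j then 1 else 0) *s g i) = (\<Sum>i\<in>A. if i = j then g j else 0)"
      by (intro sum.cong) auto
    then have "y = (\<Sum>i\<in>A. (if i = j then 1 else 0) *s g i)" using j assms(1) by simp
    then show "y \<in> S" unfolding S_def by (intro CollectI exI[of _ "\<lambda>i. if i = j then 1 else 0"]) simp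
  qed
  ultimately have "x \<in> S" using assms(2) span_minimal by blast
  then show ?thesis using that by (auto simp: S_def)
qed

text \<open>The families \<open>g\<close> and \<open>h\<close> differ by a permutation and a
  triangular matrix with determinant prime to \<open>q\<close>. For divisibility, relations among
  the \<open>g i\<close>, multiplied by that determinant, become relations among the
  \<open>h j\<close>, whose coefficients are divisible by \<open>q ^ e j\<close>. For sharpness, the
  relations \<open>(u * q ^ e j) *s h j = 0\<close> for the last \<open>n - i\<close> indices give a
  triangular minor.\<close>

lemma fitting_valuation:
  assumes q: "prime_elem q"
    and val: "finite_valuation q"
    and r: "r \<noteq> 0" and ann: "\<And>x. r *s x = 0"
    and span: "span (g ` {..<n}) = UNIV"
  obtains h e where "local_decomp scale q n h e"
    "\<And>i x. x \<in> ideal_gen (minors scale g n (n - i)) \<Longrightarrow> q ^ sum e {i..<n} dvd x"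
    "\<And>i. \<exists>t. \<not> q dvd t \<and> q ^ sum e {i..<n} * t \<in> ideal_gen (minors scale g n (n - i))"
proof -
  have gen: "\<exists>c. x - (\<Sum>i<n. c i *s g i) \<in> {0}" for x
  proof -
    have "x \<in> span (g ` {..<n})" by (simp add: span)
    then obtain c where "x = (\<Sum>i<n. c i *s g i)" using span_image_eq_sum[OF finite_lessThan] by metis
    then show ?thesis by (intro exI[of _ c]) simp
  qed
  have ann': "r *s x \<in> {0}" for x by (simp add: ann)
  obtain \<sigma> P e h u w where bij: "bij_betw \<sigma> {..<n} {..<n}"
    and h: "\<forall>j<n. h j = (\<Sum>k\<le>j. P j k *s g (\<sigma> k))" and P: "\<forall>j<n. \<not> q dvd P j j"
    and mono: "\<forall>i j. i \<le> j \<longrightarrow> e j \<le> e i" and zero: "\<forall>j\<ge>n. e j = (0::nat)"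
    and u: "\<not> q dvd u" and u_h: "\<forall>j<n. (u * q ^ e j) *s h j \<in> {0}"
    and indep: "\<forall>c. (\<Sum>j<n. c j *s h j) \<in> {0} \<longrightarrow> (\<forall>j<n. q ^ e j dvd c j)"
    and w: "\<not> q dvd w" and w_h: "\<forall>x. \<exists>c. w *s x - (\<Sum>j<n. c j *s h j) \<in> {0}"
    using local_decomposition_mod[OF q val subspace_single_0 finite_lessThan card_lessThan r ann' gen]
    by (elim exE conjE) (rule that; assumption)
  have decomp: "local_decomp scale q n h e"
    unfolding local_decomp_def using mono zero indep u u_h w w_h by auto
  define PM where "PM = mat n n (\<lambda>(j, k). if k \<le> j then P j k else 0)"
  have PM: "PM \<in> carrier_mat n n" by (simp add: PM_def)
  define d where "d = det PM"
  have "d = (\<Prod>j\<in>{0..<n}. PM $$ (j, j))"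
    unfolding d_def by (subst det_lower_triangular[OF _ PM]) (auto simp: PM_def prod_list_diag_prod)
  then have "d = (\<Prod>j\<in>{0..<n}. P j j)" by (simp add: PM_def)
  then have d: "\<not> q dvd d" using prime_elem_not_dvd_prod[OF q, of "{0..<n}" "\<lambda>j. P j j"] P by simp
  have hPM: "h j = (\<Sum>l<n. PM $$ (j, l) *s g (\<sigma> l))" if "j < n" for j
  proof -
    have "(\<Sum>l<n. PM $$ (j, l) *s g (\<sigma> l)) = (\<Sum>l\<in>{..j}. PM $$ (j, l) *s g (\<sigma> l))"
      using that by (intro sum.mono_neutral_right) (auto simp: PM_def)
    also have "\<dots> = (\<Sum>l\<le>j. P j l *s g (\<sigma> l))"
      using that by (intro sum.cong) (auto simp: PM_def)
    finally show ?thesis using h that by simp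
  qed
  define \<rho> where "\<rho> = inv_into {..<n} \<sigma>"
  have \<sigma>: "\<sigma> l < n" "\<rho> (\<sigma> l) = l" if "l < n" for l
    using that bij by (auto simp: \<rho>_def bij_betw_def)
  have \<rho>: "\<rho> i < n" "\<sigma> (\<rho> i) = i" if "i < n" for i
    using that bij bij_betw_apply[OF bij_betw_inv_into[OF bij]]
    by (auto simp: \<rho>_def bij_betw_inv_into_right)
  have reindex: "(\<Sum>i<n. f i) = (\<Sum>l<n. f (\<sigma> l))" for f :: "nat \<Rightarrow> 'm"
    using sum.reindex_bij_betw[OF bij, of f] by (rule sym)
  have upper: "q ^ sum e {i..<n} dvd x" if x: "x \<in> minors scale g n (n - i)" for i x
  proof -
    define m where "m = n - i"
    obtain R C where R: "\<And>k. k < m \<Longrightarrow> R k \<in> relations scale g n"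
      and C: "\<And>l. l < m \<Longrightarrow> C l < n" and xdet: "x = det (mat m m (\<lambda>(k, l). R k (C l)))"
      using x unfolding minors_def m_def by blast
    \<comment> \<open>The coefficients, with respect to \<open>h\<close>, of \<open>d\<close> times
      the relation \<open>R k\<close>: the adjugate of \<open>PM\<close> inverts the change of
      generators up to the factor \<open>d\<close>.\<close>
    define D where "D k j = (\<Sum>l<n. R k (\<sigma> l) * adj_mat PM $$ (l, j))" for k j
    have DP: "(\<Sum>j<n. D k j * PM $$ (j, l)) = d * R k (\<sigma> l)" if "l < n" for k l
    proof -
      have adj: "(\<Sum>j<n. adj_mat PM $$ (i, j) * PM $$ (j, l)) = (if i = l then d else 0)" if "i < n" for i
      proof -
        have "(\<Sum>j<n. adj_mat PM $$ (i, j) * PM $$ (j, l)) = (adj_mat PM * PM) $$ (i, l)"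
          using that \<open>l < n\<close> PM adj_mat(1)[OF PM]
          by (auto simp: scalar_prod_def atLeast0LessThan intro!: sum.cong)
        then show ?thesis using that \<open>l < n\<close> by (simp add: adj_mat(3)[OF PM] d_def)
      qed
      have "(\<Sum>j<n. D k j * PM $$ (j, l)) = (\<Sum>j<n. \<Sum>i<n. R k (\<sigma> i) * (adj_mat PM $$ (i, j) * PM $$ (j, l)))"
        by (simp add: D_def sum_distrib_right mult.assoc)
      also have "\<dots> = (\<Sum>i<n. R k (\<sigma> i) * (\<Sum>j<n. adj_mat PM $$ (i, j) * PM $$ (j, l)))"
        by (subst sum.swap) (simp add: sum_distrib_left)
      also have "\<dots> = (\<Sum>i<n. if i = l then R k (\<sigma> l) * d else 0)"
        by (intro sum.cong) (auto simp: adj)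
      also have "\<dots> = d * R k (\<sigma> l)" using that by (simp add: mult.commute)
      finally show ?thesis .
    qed
    have "q ^ e j dvd D k j" if "k < m" "j < n" for k j
    proof -
      have rel: "(\<Sum>i<n. R k i *s g i) = 0" using R[OF \<open>k < m\<close>] by (simp add: relations_def)
      have "(\<Sum>j<n. D k j *s h j) = (\<Sum>j<n. \<Sum>l<n. (D k j * PM $$ (j, l)) *s g (\<sigma> l))"
        by (intro sum.cong) (simp_all add: hPM scale_sum_right)
      also have "\<dots> = (\<Sum>l<n. (\<Sum>j<n. D k j * PM $$ (j, l)) *s g (\<sigma> l))"
        by (subst sum.swap) (simp add: scale_sum_left)
      also have "\<dots> = (\<Sum>l<n. d *s (R k (\<sigma> l) *s g (\<sigma> l)))"
        by (intro sum.cong) (simp_all add: DP)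
      also have "\<dots> = d *s (\<Sum>i<n. R k i *s g i)" 
        unfolding reindex[of "\<lambda>i. R k i *s g i"] by (simp add: scale_sum_right)
      finally have "(\<Sum>j<n. D k j *s h j) = 0" by (simp add: rel)
      then show ?thesis using indep that(2) by simp
    qed
    then have "q ^ sum e {n - m..<n} dvd det (mat m m (\<lambda>(k, l). \<Sum>j<n. D k j * PM $$ (j, \<rho> (C l))))"
      using mono by (intro prime_power_dvd_det) auto
    also have "mat m m (\<lambda>(k, l). \<Sum>j<n. D k j * PM $$ (j, \<rho> (C l))) = d \<cdot>\<^sub>m mat m m (\<lambda>(k, l). R k (C l))"
      using C \<rho> by (intro eq_matI) (auto simp: DP)
    also have "det \<dots> = d ^ m * x" by (simp add: xdet)
    finally have "q ^ sum e {n - m..<n} dvd d ^ m * x" .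
    moreover have "\<not> q dvd d ^ m" using d prime_elem_dvd_power[OF q] by blast
    ultimately have "q ^ sum e {n - m..<n} dvd x" by (rule prime_power_dvd_mult_cancel[OF q, rotated])
    moreover have "{n - m..<n} = {i..<n}" by (auto simp: m_def)
    ultimately show ?thesis by simp
  qed
  have upper': "q ^ sum e {i..<n} dvd x" if "x \<in> ideal_gen (minors scale g n (n - i))" for i x
  proof -
    have "ideal_gen (minors scale g n (n - i)) \<subseteq> {x. q ^ sum e {i..<n} dvd x}"
      using upper by (intro ideal_gen_least[OF is_ideal_principal]) blast
    then show ?thesis using that by blast
  qed
  have lower: "\<exists>t. \<not> q dvd t \<and> q ^ sum e {i..<n} * t \<in> ideal_gen (minors scale g n (n - i))" for i
  proof -
    define m where "m = n - i"
    \<comment> \<open>With truncated subtraction \<open>o'\<close> is the minimum of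
      \<open>i\<close> and \<open>n\<close>. For \<open>i > n\<close> the minor has order 0 and the
      sum of exponents is empty.\<close>
    define o' where "o' = n - m"
    have mo: "o' + m = n" by (simp add: o'_def m_def)
    \<comment> \<open>Row \<open>k\<close> is the relation
      \<open>(u * q ^ e (o' + k)) *s h (o' + k) = 0\<close> written out in the \<open>g i\<close>;
      the zeros from \<open>n\<close> on are demanded by \<open>relations\<close>.\<close>
    define R where "R k i = (if i < n then (u * q ^ e (o' + k)) * PM $$ (o' + k, \<rho> i) else 0)" for k i
    have R: "R k \<in> relations scale g n" if "k < m" for k
    proof -
      have "(\<Sum>i<n. R k i *s g i) = (\<Sum>l<n. (u * q ^ e (o' + k)) *s (PM $$ (o' + k, l) *s g (\<sigma> l)))"
        unfolding reindex[of "\<lambda>i. R k i *s g i"] by (intro sum.cong) (simp_all add: R_def \<sigma>)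
      also have "\<dots> = (u * q ^ e (o' + k)) *s h (o' + k)"
        using hPM[of "o' + k"] that mo by (simp add: scale_sum_right)
      also have "\<dots> = 0" using u_h that mo by simp
      finally show ?thesis by (simp add: relations_def R_def)
    qed
    \<comment> \<open>Columns with the same indices as the rows make the minor lower
      triangular.\<close>
    define c where "c l = \<sigma> (o' + l)" for l
    have c: "c l < n" if "l < m" for l using \<sigma> that mo by (simp add: c_def)
    have inj: "inj_on c {..<m}"
    proof (rule inj_onI)
      fix l l' assume *: "l \<in> {..<m}" "l' \<in> {..<m}" "c l = c l'"
      then have "\<rho> (\<sigma> (o' + l)) = \<rho> (\<sigma> (o' + l'))" by (simp add: c_def)
      then show "l = l'" using \<sigma>(2)[of "o' + l"] \<sigma>(2)[of "o' + l'"] * mo by simp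
    qed
    obtain \<epsilon> where \<epsilon>: "\<epsilon> = 1 \<or> \<epsilon> = -1" "\<epsilon> * det (mat m m (\<lambda>(k, l). R k (c l))) \<in> minors scale g n m"
      by (rule inj_cols_minor[OF R inj c])
    have entry: "R k (c l) = (u * q ^ e (o' + k)) * PM $$ (o' + k, o' + l)" if "l < m" for k l
      using c[OF that] \<sigma>(2)[of "o' + l"] that mo by (simp add: R_def c_def)
    have "det (mat m m (\<lambda>(k, l). R k (c l))) = (\<Prod>k\<in>{0..<m}. R k (c k))"
      using mo by (subst det_lower_triangular[where n = m]) (auto simp: entry PM_def prod_list_diag_prod)
    also have "\<dots> = (\<Prod>k\<in>{0..<m}. q ^ e (o' + k) * (u * P (o' + k) (o' + k)))"
      using mo by (intro prod.cong) (auto simp: entry PM_def)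
    also have "\<dots> = q ^ (\<Sum>k\<in>{0..<m}. e (o' + k)) * (\<Prod>k\<in>{0..<m}. u * P (o' + k) (o' + k))"
      by (simp add: prod.distrib power_sum)
    also have "(\<Sum>k\<in>{0..<m}. e (o' + k)) = sum e {o'..<n}"
      using sum.shift_bounds_nat_ivl[of e 0 o' m] mo by (simp add: add.commute)
    also have "{o'..<n} = {i..<n}" by (auto simp: o'_def m_def)
    finally have "q ^ sum e {i..<n} * (\<epsilon> * (\<Prod>k\<in>{0..<m}. u * P (o' + k) (o' + k))) \<in> minors scale g n m"
      using \<epsilon>(2) by (simp add: mult.left_commute)
    moreover have "\<not> q dvd (\<Prod>k\<in>{0..<m}. u * P (o' + k) (o' + k))"
    proof (rule prime_elem_not_dvd_prod[OF q])
      fix k assume "k \<in> {0..<m}"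
      then have "\<not> q dvd P (o' + k) (o' + k)" using P mo by simp
      then show "\<not> q dvd u * P (o' + k) (o' + k)" using u prime_elem_dvd_multD[OF q] by blast
    qed simp
    then have "\<not> q dvd \<epsilon> * (\<Prod>k\<in>{0..<m}. u * P (o' + k) (o' + k))" using \<epsilon>(1) by auto
    ultimately show ?thesis using ideal_gen_superset m_def by blast
  qed
  show ?thesis by (rule that[OF decomp upper' lower])
qed

end

subsection \<open>Uniqueness of exponents and local isomorphisms\<close>

lemma local_decompD:
  assumes "local_decomp s q n h e"
  shows "i \<le> j \<Longrightarrow> e j \<le> e i" "n \<le> j \<Longrightarrow> e j = 0"
    "(\<Sum>j<n. s (c j) (h j)) = 0 \<Longrightarrow> j < n \<Longrightarrow> q ^ e j dvd c j"
  using assms by (simp_all add: local_decomp_def)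

lemma local_decomp_generates:
  assumes "local_decomp s q n h e"
  obtains u where "\<not> q dvd u" "\<And>x. \<exists>c. s u x = (\<Sum>j<n. s (c j) (h j))"
proof -
  have "\<exists>u. \<not> q dvd u \<and> (\<forall>x. \<exists>c. s u x = (\<Sum>j<n. s (c j) (h j)))"
    using assms by (simp add: local_decomp_def)
  then show ?thesis using that by blast
qed

lemma local_decomp_annihilates:
  assumes "local_decomp s q n h e"
  obtains u where "\<not> q dvd u" "\<And>j. j < n \<Longrightarrow> s (u * q ^ e j) (h j) = 0"
proof -
  have "\<exists>u. \<not> q dvd u \<and> (\<forall>j<n. s (u * q ^ e j) (h j) = 0)"
    using assms by (simp add: local_decomp_def)
  then show ?thesis using that by blast
qed

text \<open>There are \<open>n\<close> equations in \<open>n + 1\<close> unknowns. Gaussian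
  elimination removes the last equation, cross-multiplied with the pivot \<open>A i0 n\<close>
  because the ring has no division.\<close>

lemma nontrivial_linear_relation:
  fixes A :: "'i \<Rightarrow> nat \<Rightarrow> 'r::idom"
  assumes "card I = Suc n"
  shows "\<exists>c. (\<exists>i\<in>I. c i \<noteq> 0) \<and> (\<forall>l<n. (\<Sum>i\<in>I. c i * A i l) = 0)"
  using assms
proof (induction n arbitrary: I A)
  case 0
  then obtain i where "i \<in> I" by (metis card.empty ex_in_conv nat.distinct(1))
  then show ?case by (intro exI[of _ "\<lambda>_. 1"]) auto
next
  case (Suc n)
  have fin: "finite I" using Suc.prems card.infinite by fastforce
  show ?case
  proof (cases "\<exists>i\<in>I. A i n \<noteq> 0")
    case True
    then obtain i0 where i0: "i0 \<in> I" "A i0 n \<noteq> 0" by blast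
    have "card (I - {i0}) = Suc n" using Suc.prems i0(1) fin by simp
    then obtain c where c: "\<exists>i\<in>I - {i0}. c i \<noteq> 0"
      and rel: "\<forall>l<n. (\<Sum>i\<in>I - {i0}. c i * (A i0 n * A i l - A i n * A i0 l)) = 0"
      using Suc.IH[of "I - {i0}" "\<lambda>i l. A i0 n * A i l - A i n * A i0 l"] by blast
    define d where "d i = (if i = i0 then - (\<Sum>i\<in>I - {i0}. c i * A i n) else A i0 n * c i)" for i
    have split: "(\<Sum>i\<in>I. d i * A i l) = (\<Sum>i\<in>I - {i0}. c i * (A i0 n * A i l - A i n * A i0 l))" for l
    proof -
      have "(\<Sum>i\<in>I. d i * A i l) = d i0 * A i0 l + (\<Sum>i\<in>I - {i0}. d i * A i l)"
        using fin i0(1) by (rule sum.remove)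
      also have "(\<Sum>i\<in>I - {i0}. d i * A i l) = (\<Sum>i\<in>I - {i0}. A i0 n * c i * A i l)"
        by (intro sum.cong) (auto simp: d_def)
      also have "d i0 * A i0 l = (\<Sum>i\<in>I - {i0}. - (c i * A i n * A i0 l))"
        by (simp add: d_def sum_distrib_right sum_negf)
      finally show ?thesis by (simp add: sum.distrib[symmetric] algebra_simps)
    qed
    have "(\<Sum>i\<in>I. d i * A i l) = 0" if "l < Suc n" for l
    proof (cases "l = n")
      case False
      then show ?thesis using rel that by (simp add: split)
    qed (simp add: split mult.commute)
    moreover have "\<exists>i\<in>I. d i \<noteq> 0" using c i0(2) by (auto simp: d_def)
    ultimately show ?thesis by blast
  next
    case False
    obtain i0 where i0: "i0 \<in> I" using Suc.prems by (metis card.empty ex_in_conv nat.distinct(1))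
    have "card (I - {i0}) = Suc n" using Suc.prems i0 fin by simp
    then obtain c where c: "\<exists>i\<in>I - {i0}. c i \<noteq> 0" "\<forall>l<n. (\<Sum>i\<in>I - {i0}. c i * A i l) = 0"
      using Suc.IH[of "I - {i0}" A] by blast
    define d where "d = c(i0 := 0)"
    have "(\<Sum>i\<in>I. d i * A i l) = (\<Sum>i\<in>I - {i0}. c i * A i l)" for l
      using fin i0 by (subst sum.remove[of _ i0]) (auto simp: d_def intro!: sum.cong)
    then have "(\<Sum>i\<in>I. d i * A i l) = 0" if "l < Suc n" for l
      using c(2) False that by (cases "l = n") auto
    moreover have "\<exists>i\<in>I. d i \<noteq> 0" using c(1) by (auto simp: d_def)
    ultimately show ?thesis by blast
  qed
qed

text \<open>A nontrivial relation is divided by the largest power \<open>q ^ K\<close> common to all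
  its coefficients.\<close>

lemma primitive_linear_relation:
  fixes A :: "'i \<Rightarrow> nat \<Rightarrow> 'r::idom"
  assumes q: "prime_elem q" "finite_valuation q" and "card I = Suc n"
  shows "\<exists>c. (\<exists>i\<in>I. \<not> q dvd c i) \<and> (\<forall>l<n. (\<Sum>i\<in>I. c i * A i l) = 0)"
proof -
  obtain c where c: "\<exists>i\<in>I. c i \<noteq> 0" "\<forall>l<n. (\<Sum>i\<in>I. c i * A i l) = 0"
    using nontrivial_linear_relation[OF assms(3)] by blast
  define K where "K = (LEAST k. \<exists>i\<in>I. \<not> q ^ Suc k dvd c i)"
  have "\<exists>k. \<exists>i\<in>I. \<not> q ^ Suc k dvd c i"
  proof -
    obtain i where i: "i \<in> I" "c i \<noteq> 0" using c(1) by blast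
    then obtain k h where h: "c i = q ^ k * h" "\<not> q dvd h" using q(2) unfolding finite_valuation_def by blast
    have "\<not> q ^ Suc k dvd c i"
    proof
      assume "q ^ Suc k dvd c i"
      then have "q ^ k * q dvd q ^ k * h" by (simp add: h(1) mult.commute)
      then have "q dvd h"
        using prime_elem_not_zeroI[OF q(1)] by (metis dvd_times_left_cancel_iff power_not_zero)
      then show False using h(2) by simp
    qed
    then show ?thesis using i(1) by blast
  qed
  then have K: "\<exists>i\<in>I. \<not> q ^ Suc K dvd c i" unfolding K_def by (rule LeastI_ex)
  have "q ^ K dvd c i" if "i \<in> I" for i
  proof (cases K)
    case (Suc k)
    then have "\<not> (\<exists>i\<in>I. \<not> q ^ Suc k dvd c i)" using not_less_Least[of k "\<lambda>k. \<exists>i\<in>I. \<not> q ^ Suc k dvd c i"] K_def by simp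
    then show ?thesis using that Suc by blast
  qed simp
  then have "\<forall>i\<in>I. \<exists>d. c i = q ^ K * d" by (auto simp: dvd_def)
  then obtain d where d: "\<And>i. i \<in> I \<Longrightarrow> c i = q ^ K * d i" by metis
  have "(\<Sum>i\<in>I. d i * A i l) = 0" if "l < n" for l
  proof -
    have "q ^ K * (\<Sum>i\<in>I. d i * A i l) = (\<Sum>i\<in>I. c i * A i l)"
      by (simp add: sum_distrib_left d mult.assoc)
    then show ?thesis using c(2) that prime_elem_not_zeroI[OF q(1)] by simp
  qed
  moreover have "\<exists>i\<in>I. \<not> q dvd d i"
  proof -
    obtain i where i: "i \<in> I" "\<not> q ^ Suc K dvd c i" using K by blast
    have "\<not> q dvd d i"
    proof
      assume "q dvd d i"
      then have "q ^ K * q dvd q ^ K * d i" by (rule mult_dvd_mono[OF dvd_refl])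
      then show False using i d[OF i(1)] by (simp add: mult.commute)
    qed
    then show ?thesis using i(1) by blast
  qed
  ultimately show ?thesis by blast
qed

text \<open>Compares ranks of \<open>q ^ k\<close> times the module for \<open>k = e' j\<close>. At
  \<open>q\<close> it is generated by multiples of the \<open>h' l\<close> with
  \<open>l < j\<close>, so the \<open>j + 1\<close> elements \<open>q ^ k *s h i\<close> with
  \<open>i \<le> j\<close> satisfy, up to cofactors, a relation with some coefficient prime to
  \<open>q\<close>. If \<open>k < e j\<close>, independence of the \<open>h i\<close> forces
  \<open>q\<close> to divide every coefficient.\<close>

lemma (in idom_module) local_decomp_exponent_le:
  assumes q: "prime_elem q" "finite_valuation q"
    and d: "local_decomp scale q n h e" and d': "local_decomp scale q n' h' e'"
  shows "e j \<le> e' j"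
proof (rule ccontr)
  assume "\<not> e j \<le> e' j"
  define k where "k = e' j"
  have ek: "k < e j" using \<open>\<not> e j \<le> e' j\<close> by (simp add: k_def)
  have "j < n" using d ek unfolding local_decomp_def by (metis not_less not_less0)
  have mono: "e j \<le> e i" if "i \<le> j" for i using d that by (simp add: local_decomp_def)
  have mono': "e' l \<le> k" if "j \<le> l" for l using d' that by (simp add: local_decomp_def k_def)
  obtain u where u: "\<not> q dvd u" "\<And>x. \<exists>c. u *s x = (\<Sum>l<n'. c l *s h' l)"
    using local_decomp_generates[OF d'] by metis
  obtain u' where u': "\<not> q dvd u'" "\<And>l. l < n' \<Longrightarrow> (u' * q ^ e' l) *s h' l = 0"
    using local_decomp_annihilates[OF d'] by metis
  have indep: "q ^ e i dvd c i" if "(\<Sum>i<n. c i *s h i) = 0" "i < n" for c i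
    using that by (rule local_decompD(3)[OF d])
  obtain A where A: "\<And>i. u *s h i = (\<Sum>l<n'. A i l *s h' l)" using u(2)[of "h _"] by metis
  obtain c where c: "\<exists>i\<in>{..j}. \<not> q dvd c i" "\<forall>l<j. (\<Sum>i\<le>j. c i * A i l) = 0"
    using primitive_linear_relation[OF q, of "{..j}" j A] by auto
  have kill: "(\<Sum>i\<le>j. c i * A i l) *s ((u' * q ^ k) *s h' l) = 0" if "l < n'" for l
  proof (cases "l < j")
    case False
    then have "k = e' l + (k - e' l)" using mono'[of l] by simp
    then have "u' * q ^ k = q ^ (k - e' l) * (u' * q ^ e' l)" by (metis mult.assoc mult.commute power_add)
    then have "(u' * q ^ k) *s h' l = q ^ (k - e' l) *s ((u' * q ^ e' l) *s h' l)" by (simp only: scale_scale)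
    then show ?thesis using u'(2)[OF that] by simp
  qed (use c(2) in simp)
  define a where "a i = (if i \<le> j then u * (u' * (q ^ k * c i)) else 0)" for i
  have "(\<Sum>i<n. a i *s h i) = (\<Sum>i\<le>j. a i *s h i)"
    using \<open>j < n\<close> by (intro sum.mono_neutral_right) (auto simp: a_def)
  also have "\<dots> = (\<Sum>i\<le>j. (c i * (u' * q ^ k)) *s (u *s h i))"
    by (intro sum.cong) (auto simp: a_def ac_simps)
  also have "\<dots> = (\<Sum>i\<le>j. \<Sum>l<n'. (c i * A i l) *s ((u' * q ^ k) *s h' l))"
    by (simp add: A scale_sum_right ac_simps)
  also have "\<dots> = (\<Sum>l<n'. (\<Sum>i\<le>j. c i * A i l) *s ((u' * q ^ k) *s h' l))"
    by (subst sum.swap) (simp only: scale_sum_left)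
  also have "\<dots> = 0" using kill by simp
  finally have rel: "(\<Sum>i<n. a i *s h i) = 0" .
  have "q dvd c i" if "i \<le> j" for i
  proof -
    have "q ^ e i dvd u * (u' * (q ^ k * c i))" using indep[OF rel, of i] that \<open>j < n\<close> by (simp add: a_def)
    then have "q ^ e i dvd q ^ k * c i"
      using prime_power_dvd_mult_cancel[OF q(1)] u(1) u'(1) by blast
    moreover have "q ^ k * q dvd q ^ e i"
      using le_imp_power_dvd[of "Suc k" "e i" q] ek mono[OF that] by (simp add: mult.commute)
    ultimately have "q ^ k * q dvd q ^ k * c i" using dvd_trans by blast
    then show ?thesis
      using prime_elem_not_zeroI[OF q(1)] by (metis dvd_times_left_cancel_iff power_not_zero)
  qed
  then show False using c(1) by auto
qed

text \<open>Brings decompositions with different numbers of generators to a common length; the added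
  zeros match the vanishing exponents from \<open>n\<close> on.\<close>

lemma (in idom_module) local_decomp_pad:
  assumes d: "local_decomp scale q n h e" and "n \<le> m"
  shows "local_decomp scale q m (\<lambda>j. if j < n then h j else 0) e"
proof -
  have sum_eq: "(\<Sum>j<m. c j *s (if j < n then h j else 0)) = (\<Sum>j<n. c j *s h j)" for c
  proof -
    have "(\<Sum>j<m. c j *s (if j < n then h j else 0)) = (\<Sum>j<n. c j *s (if j < n then h j else 0))"
      using \<open>n \<le> m\<close> by (intro sum.mono_neutral_right) auto
    then show ?thesis by simp
  qed
  have "q ^ e j dvd c j" if "\<forall>j<n. q ^ e j dvd c j" for c j
    using that d unfolding local_decomp_def by (cases "j < n") auto
  moreover have "\<exists>u. \<not> q dvd u \<and> (\<forall>j<m. (u * q ^ e j) *s (if j < n then h j else 0) = 0)"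
    using d unfolding local_decomp_def by auto
  ultimately show ?thesis
    using d \<open>n \<le> m\<close> unfolding local_decomp_def sum_eq by auto
qed

text \<open>The map becomes bijective after inverting the elements prime to \<open>q\<close>.\<close>

definition local_iso ::
  "('r::idom \<Rightarrow> 'm::ab_group_add \<Rightarrow> 'm) \<Rightarrow> ('r \<Rightarrow> 'n::ab_group_add \<Rightarrow> 'n) \<Rightarrow> 'r \<Rightarrow> ('m \<Rightarrow> 'n) \<Rightarrow> bool" where
  "local_iso s1 s2 q f \<longleftrightarrow> Modules.module_hom s1 s2 f \<and>
     (\<exists>v. \<not> q dvd v \<and> (\<forall>x. f x = 0 \<longrightarrow> s1 v x = 0)) \<and> (\<exists>v. \<not> q dvd v \<and> (\<forall>y. \<exists>x. s2 v y = f x))"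

locale idom_module_pair = m1: idom_module s1 + m2: idom_module s2
  for s1 :: "'r::idom \<Rightarrow> 'm::ab_group_add \<Rightarrow> 'm" (infixr "*a" 75)
    and s2 :: "'r \<Rightarrow> 'n::ab_group_add \<Rightarrow> 'n" (infixr "*b" 75)
begin

lemma module_homI:
  assumes "\<And>x y. f (x + y) = f x + f y" "\<And>r x. f (r *a x) = r *b f x"
  shows "Modules.module_hom s1 s2 f"
  using assms m1.module_axioms m2.module_axioms
  by (simp add: Modules.module_hom_def Modules.module_hom_axioms_def)

text \<open>Surjectivity at \<open>q\<close> carries over generation and injectivity at
  \<open>q\<close> carries over independence. The exponents of both modules can then be compared
  inside one of them.\<close>

lemma local_decomp_transport:
  assumes q: "prime_elem q" and f: "local_iso s1 s2 q f" and d: "local_decomp s1 q n h e"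
  shows "local_decomp s2 q n (\<lambda>j. f (h j)) e"
proof -
  interpret f: Modules.module_hom s1 s2 f using f by (simp add: local_iso_def)
  obtain v where v: "\<not> q dvd v" "\<And>x. f x = 0 \<Longrightarrow> v *a x = 0" using f unfolding local_iso_def by blast
  obtain w where w: "\<not> q dvd w" "\<And>y. \<exists>x. w *b y = f x" using f unfolding local_iso_def by blast
  obtain u where u: "\<not> q dvd u" "\<And>x. \<exists>c. u *a x = (\<Sum>j<n. c j *a h j)"
    using local_decomp_generates[OF d] by metis
  obtain t where t: "\<not> q dvd t" "\<And>j. j < n \<Longrightarrow> (t * q ^ e j) *a h j = 0"
    using local_decomp_annihilates[OF d] by metis
  have gen: "\<exists>c. (u * w) *b y = (\<Sum>j<n. c j *b f (h j))" for y
  proof -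
    obtain x where x: "w *b y = f x" using w(2) by blast
    obtain c where c: "u *a x = (\<Sum>j<n. c j *a h j)" using u(2) by blast
    have "(u * w) *b y = u *b (w *b y)" by simp
    also have "\<dots> = f (u *a x)" by (simp only: x f.scale)
    finally have "(u * w) *b y = (\<Sum>j<n. c j *b f (h j))" by (simp add: c f.sum f.scale)
    then show ?thesis by blast
  qed
  have "\<not> q dvd u * w" using u(1) w(1) prime_elem_dvd_multD[OF q] by blast
  with gen have gen': "\<exists>u. \<not> q dvd u \<and> (\<forall>y. \<exists>c. u *b y = (\<Sum>j<n. c j *b f (h j)))" by blast
  have "(t * q ^ e j) *b f (h j) = 0" if "j < n" for j
    using t(2)[OF that] by (metis f.scale f.zero)
  then have ann: "\<exists>u. \<not> q dvd u \<and> (\<forall>j<n. (u * q ^ e j) *b f (h j) = 0)" using t(1) by blast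
  have "q ^ e j dvd c j" if c: "(\<Sum>j<n. c j *b f (h j)) = 0" and j: "j < n" for c j
  proof -
    have "f (\<Sum>j<n. c j *a h j) = 0" using c by (simp add: f.sum f.scale)
    then have "v *a (\<Sum>j<n. c j *a h j) = 0" by (rule v(2))
    then have "(\<Sum>j<n. (v * c j) *a h j) = 0" by (simp add: m1.scale_sum_right)
    then have "q ^ e j dvd v * c j" using j by (rule local_decompD(3)[OF d])
    then show ?thesis by (rule prime_power_dvd_mult_cancel[OF q v(1)])
  qed
  then show ?thesis
    unfolding local_decomp_def using local_decompD(1,2)[OF d] gen' ann by (intro conjI) simp_all
qed

text \<open>If \<open>u *a x\<close> has coefficients \<open>c j\<close> with respect to
  \<open>h\<close>, then \<open>x\<close> is sent to the sum of the
  \<open>(t * c j) *b h' j\<close>. The \<open>c j\<close> are determined only modulo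
  \<open>q ^ e j\<close>, and \<open>t * q ^ e j\<close> kills \<open>h' j\<close>; hence the factor
  \<open>t\<close>, which makes the map well defined (\<open>f_eq\<close>) and linear.\<close>

lemma local_iso_exists:
  assumes q: "prime_elem q" and d: "local_decomp s1 q n h e" and d': "local_decomp s2 q n h' e"
  obtains f where "local_iso s1 s2 q f"
proof -
  obtain u where u: "\<not> q dvd u" "\<And>x. \<exists>c. u *a x = (\<Sum>j<n. c j *a h j)"
    using local_decomp_generates[OF d] by metis
  then obtain c where c: "\<And>x. u *a x = (\<Sum>j<n. c x j *a h j)" by metis
  obtain v where v: "\<not> q dvd v" "\<And>j. j < n \<Longrightarrow> (v * q ^ e j) *a h j = 0"
    using local_decomp_annihilates[OF d] by metis
  obtain u' where u': "\<not> q dvd u'" "\<And>y. \<exists>c. u' *b y = (\<Sum>j<n. c j *b h' j)"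
    using local_decomp_generates[OF d'] by metis
  obtain t where t: "\<not> q dvd t" "\<And>j. j < n \<Longrightarrow> (t * q ^ e j) *b h' j = 0"
    using local_decomp_annihilates[OF d'] by metis
  define f where "f x = (\<Sum>j<n. (t * c x j) *b h' j)" for x
  have f_eq: "f x = (\<Sum>j<n. (t * a j) *b h' j)" if "u *a x = (\<Sum>j<n. a j *a h j)" for x a
  proof -
    have "(\<Sum>j<n. (c x j - a j) *a h j) = 0"
      using c[of x] that by (simp add: m1.scale_left_diff_distrib sum_subtractf)
    then have dv: "q ^ e j dvd c x j - a j" if "j < n" for j
      using that by (rule local_decompD(3)[OF d])
    have "(t * (c x j - a j)) *b h' j = 0" if j: "j < n" for j
    proof -
      obtain b where "c x j - a j = q ^ e j * b" using dv[OF j] by (rule dvdE)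
      then have "t * (c x j - a j) = b * (t * q ^ e j)" by (simp add: ac_simps)
      then have "(t * (c x j - a j)) *b h' j = b *b ((t * q ^ e j) *b h' j)" by (simp only: m2.scale_scale)
      then show ?thesis using t(2)[OF j] by simp
    qed
    then have "(\<Sum>j<n. (t * (c x j - a j)) *b h' j) = 0" by simp
    then show ?thesis
      by (simp add: f_def right_diff_distrib m2.scale_left_diff_distrib sum_subtractf)
  qed
  have hom: "Modules.module_hom s1 s2 f"
  proof (rule module_homI)
    fix x y
    have "u *a (x + y) = (\<Sum>j<n. (c x j + c y j) *a h j)"
      by (simp add: m1.scale_right_distrib c m1.scale_left_distrib sum.distrib)
    then have "f (x + y) = (\<Sum>j<n. (t * (c x j + c y j)) *b h' j)" by (rule f_eq)
    then show "f (x + y) = f x + f y"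
      by (simp add: f_def[of x] f_def[of y] distrib_left m2.scale_left_distrib sum.distrib)
  next
    fix r x
    have "u *a (r *a x) = r *a (u *a x)" by (simp add: mult.commute)
    then have "u *a (r *a x) = (\<Sum>j<n. (r * c x j) *a h j)"
      by (simp add: c m1.scale_sum_right)
    then have "f (r *a x) = (\<Sum>j<n. (t * (r * c x j)) *b h' j)" by (rule f_eq)
    then show "f (r *a x) = r *b f x"
      by (simp add: f_def[of x] m2.scale_sum_right mult.left_commute)
  qed
  have ker: "(v * u) *a x = 0" if "f x = 0" for x
  proof -
    have dv: "q ^ e j dvd c x j" if "j < n" for j
      using prime_power_dvd_mult_cancel[OF q t(1) local_decompD(3)[OF d' \<open>f x = 0\<close>[unfolded f_def] that]] .
    have "(v * c x j) *a h j = 0" if j: "j < n" for j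
    proof -
      obtain b where "c x j = q ^ e j * b" using dv[OF j] by (rule dvdE)
      then have "v * c x j = b * (v * q ^ e j)" by (simp add: ac_simps)
      then have "(v * c x j) *a h j = b *a ((v * q ^ e j) *a h j)" by (simp only: m1.scale_scale)
      then show ?thesis using v(2)[OF j] by simp
    qed
    then have "v *a (u *a x) = 0" by (simp add: c m1.scale_sum_right)
    then show ?thesis by simp
  qed
  have coker: "\<exists>x. (u * t * u') *b y = f x" for y
  proof -
    obtain a where a: "u' *b y = (\<Sum>j<n. a j *b h' j)" using u'(2) by blast
    define x where "x = (\<Sum>j<n. a j *a h j)"
    have "u *a x = (\<Sum>j<n. (u * a j) *a h j)" by (simp add: x_def m1.scale_sum_right)
    then have "f x = (\<Sum>j<n. (t * (u * a j)) *b h' j)" by (rule f_eq)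
    also have "\<dots> = (u * t) *b (u' *b y)" by (simp only: a m2.scale_sum_right) (simp add: ac_simps)
    finally show ?thesis by (intro exI[of _ x]) simp
  qed
  have "\<not> q dvd v * u" "\<not> q dvd u * t * u'"
    using u(1) v(1) t(1) u'(1) prime_elem_dvd_multD[OF q] by blast+
  then have "local_iso s1 s2 q f" unfolding local_iso_def using hom ker coker by blast
  then show ?thesis by (rule that)
qed

text \<open>If \<open>r = a * b\<close> annihilates both modules and \<open>q\<close> does not divide \<open>a\<close>, then multiplication by
  \<open>a\<close> is invertible at \<open>q\<close> and makes the summand \<open>b * g\<close> vanish there.\<close>

lemma local_iso_combine:
  assumes q: "prime_elem q" and a: "\<not> q dvd a" and ann: "\<And>y. (a * b) *b y = 0"
    and f: "local_iso s1 s2 q f" and g: "Modules.module_hom s1 s2 g"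
  shows "local_iso s1 s2 q (\<lambda>x. a *b f x + b *b g x)"
proof -
  interpret f: Modules.module_hom s1 s2 f using f by (simp add: local_iso_def)
  interpret g: Modules.module_hom s1 s2 g by fact
  let ?F = "\<lambda>x. a *b f x + b *b g x"
  have aF: "a *b ?F x = (a * a) *b f x" for x
    using ann[of "g x"] by (simp add: m2.scale_right_distrib)
  have hom: "Modules.module_hom s1 s2 ?F"
    by (rule module_homI)
      (simp_all add: f.add g.add f.scale g.scale m2.scale_right_distrib mult.commute)
  obtain v where v: "\<not> q dvd v" "\<And>x. f x = 0 \<Longrightarrow> v *a x = 0" using f unfolding local_iso_def by blast
  obtain w where w: "\<not> q dvd w" "\<And>y. \<exists>x. w *b y = f x" using f unfolding local_iso_def by blast
  have "(v * (a * a)) *a x = 0" if "?F x = 0" for x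
  proof -
    have "f ((a * a) *a x) = a *b ?F x" unfolding aF by (rule f.scale)
    then have "v *a ((a * a) *a x) = 0" using that v(2)[of "(a * a) *a x"] by simp
    then show ?thesis by simp
  qed
  moreover have "\<exists>x. (a * a * w) *b y = ?F x" for y
  proof -
    obtain x where x: "w *b y = f x" using w(2) by blast
    have "(a * a * w) *b y = (a * a) *b (w *b y)" by simp
    also have "\<dots> = a *b ?F x" unfolding aF x ..
    also have "\<dots> = ?F (a *a x)" using Modules.module_hom.scale[OF hom, of a x] by simp
    finally show ?thesis by blast
  qed
  moreover have "\<not> q dvd v * (a * a)" "\<not> q dvd a * a * w"
    using a v(1) w(1) prime_elem_dvd_multD[OF q] by blast+
  ultimately show ?thesis unfolding local_iso_def using hom by blast
qed

lemma local_iso_assoc: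
  assumes "local_iso s1 s2 q f" "q dvd q'"
  shows "local_iso s1 s2 q' f"
  using assms dvd_trans unfolding local_iso_def by blast

text \<open>With \<open>r = q ^ k * a\<close>, the map \<open>a *b g x + q ^ k *b f x\<close> is
  governed by \<open>g\<close> at \<open>q\<close>, where \<open>a\<close> is invertible, and by
  \<open>f\<close> at the earlier primes, where \<open>q ^ k\<close> is invertible.\<close>

lemma local_isos_glue:
  assumes r: "r \<noteq> 0" and ann: "\<And>y. r *b y = 0"
    and prime: "\<And>q. q \<in> set qs \<Longrightarrow> prime_elem q" and val: "\<And>q. q \<in> set qs \<Longrightarrow> finite_valuation q"
    and loc: "\<And>q. q \<in> set qs \<Longrightarrow> \<exists>f. local_iso s1 s2 q f"
  shows "\<exists>f. Modules.module_hom s1 s2 f \<and> (\<forall>q\<in>set qs. local_iso s1 s2 q f)"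
  using prime val loc
proof (induction qs)
  case Nil
  have "Modules.module_hom s1 s2 (\<lambda>_. 0)" by (rule module_homI) simp_all
  then show ?case by auto
next
  case (Cons q qs)
  then obtain f where f: "Modules.module_hom s1 s2 f" "\<forall>q\<in>set qs. local_iso s1 s2 q f" by auto
  have q: "prime_elem q" using Cons.prems(1) by simp
  show ?case
  \<comment> \<open>If an earlier prime is associated to \<open>q\<close>, then \<open>q ^ k\<close>
    may fail to be prime to it, but \<open>f\<close> already serves \<open>q\<close>.\<close>
  proof (cases "\<exists>q'\<in>set qs. q' dvd q")
    case True
    then have "local_iso s1 s2 q f" using f(2) local_iso_assoc by blast
    then show ?thesis using f by auto
  next
    case False
    obtain g where g: "local_iso s1 s2 q g" using Cons.prems(3)[of q] by auto
    have g_hom: "Modules.module_hom s1 s2 g" using g by (simp add: local_iso_def)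
    have "finite_valuation q" using Cons.prems(2) by simp
    then obtain k a where a: "r = q ^ k * a" "\<not> q dvd a" using r unfolding finite_valuation_def by blast
    have F: "local_iso s1 s2 q (\<lambda>x. a *b g x + q ^ k *b f x)"
      using ann by (intro local_iso_combine[OF q a(2) _ g f(1)]) (simp add: a(1) mult.commute)
    have "local_iso s1 s2 q' (\<lambda>x. a *b g x + q ^ k *b f x)" if "q' \<in> set qs" for q'
    proof -
      have q': "prime_elem q'" using Cons.prems(1) that by simp
      have "\<not> q' dvd q ^ k" using False that prime_elem_dvd_power[OF q'] by blast
      then have "local_iso s1 s2 q' (\<lambda>x. q ^ k *b f x + a *b g x)"
        using ann f(2) that by (intro local_iso_combine[OF q' _ _ _ g_hom]) (simp_all add: a(1))
      then show ?thesis by (simp add: add.commute)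
    qed
    moreover have "Modules.module_hom s1 s2 (\<lambda>x. a *b g x + q ^ k *b f x)" using F by (simp add: local_iso_def)
    ultimately show ?thesis using F by auto
  qed
qed

end

subsection \<open>Weierstrass division and factorization\<close>

text \<open>Elementwise form of \<open>complete_DVR_finite_residue\<close> for a uniformizer
  \<open>p\<close>. Limits are postulated for sequences with the explicit rate \<open>p ^ n\<close>,
  as the iteration in Weierstrass division produces them.\<close>

locale complete_dvr =
  fixes p :: "'a::idom"
  assumes p_nonzero: "p \<noteq> 0"
    and p_nonunit: "\<not> p dvd 1"
    and unitI: "\<not> p dvd x \<Longrightarrow> x dvd 1"
    and separated: "(\<And>k. p ^ k dvd x) \<Longrightarrow> x = 0"
    and complete: "(\<And>n. p ^ n dvd y (Suc n) - y n) \<Longrightarrow> \<exists>L. \<forall>n. p ^ n dvd L - y n"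
    and finite_residues: "\<exists>F. finite F \<and> (\<forall>x. \<exists>y\<in>F. p dvd x - y)"

lemma power_dvd_telescope:
  fixes p :: "'a::idom"
  assumes "\<And>n. p ^ n dvd y (Suc n) - y n" and "n \<le> m"
  shows "p ^ n dvd y m - y n"
  using assms(2)
proof (induction m rule: dec_induct)
  case (step m)
  have "p ^ n dvd y (Suc m) - y m" by (rule dvd_trans[OF le_imp_power_dvd assms(1)]) (use step in simp)
  then have "p ^ n dvd (y (Suc m) - y m) + (y m - y n)" using step.IH by (rule dvd_add)
  then show ?case by simp
qed simp

lemma complete_DVR_uniformizer:
  assumes "complete_DVR_finite_residue TYPE('a::idom)"
  obtains p :: "'a::idom" where "complete_dvr p"
proof -
  from assms have pid: "is_PID TYPE('a)" and ex1: "\<exists>!P :: 'a set. prime_ideal P \<and> P \<noteq> {0}"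
    and comp: "adically_complete (max_ideal TYPE('a))" and fin: "finite_residue_field (max_ideal TYPE('a))"
    by (auto simp: complete_DVR_finite_residue_def is_DVR_def)
  define m where "m = max_ideal TYPE('a)"
  have m: "prime_ideal m \<and> m \<noteq> {0}" unfolding m_def max_ideal_def by (rule theI'[OF ex1])
  have uniq: "P = m" if "prime_ideal P" "P \<noteq> {0}" for P using ex1 m that by blast
  obtain p where mp: "m = {x. p dvd x}"
    using pid[unfolded is_PID_def principal_eq_dvd, rule_format, of m] m by (auto simp: prime_ideal_def)
  have p0: "p \<noteq> 0" using m mp by (auto simp: prime_ideal_def)
  have p1: "\<not> p dvd 1"
  proof
    assume "p dvd 1"
    then have "m = UNIV" unfolding mp using dvd_trans[of p 1] by auto
    then show False using m by (simp add: prime_ideal_def)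
  qed
  have unit: "x dvd 1" if x: "\<not> p dvd x" for x
  proof (rule ccontr)
    assume "\<not> x dvd 1"
    then obtain P where P: "prime_ideal P" "{y. x dvd y} \<subseteq> P"
      using ideal_subset_prime_ideal[OF is_ideal_principal, of x] by auto
    have "x \<in> P" using P(2) by (rule subsetD) simp
    moreover have "x \<noteq> 0" using x by (metis dvd_0_right)
    ultimately have "P = m" using uniq[OF P(1)] by blast
    then show False using \<open>x \<in> P\<close> x mp by simp
  qed
  \<comment> \<open>If \<open>x = p ^ k * y k\<close> for all \<open>k\<close> and
    \<open>x \<noteq> 0\<close>, the principal ideals of the \<open>y k\<close> increase strictly.
    Their union is principal, so its generator already lies in one of them, a contradiction.\<close>
  have sep: "x = 0" if x: "\<And>k. p ^ k dvd x" for x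
  proof (rule ccontr)
    assume x0: "x \<noteq> 0"
    have "\<forall>k. \<exists>y. x = p ^ k * y" using x by (auto simp: dvd_def)
    then obtain y where y: "\<And>k. x = p ^ k * y k" by metis
    have "p ^ k * y k = p ^ k * (p * y (Suc k))" for k
      using trans[OF y[of k, symmetric] y[of "Suc k"]] by (simp only: power_Suc ac_simps)
    then have y_step: "y k = p * y (Suc k)" for k using p0 by (metis mult_cancel_left power_not_zero)
    define \<C> where "\<C> = range (\<lambda>k. {z. y k dvd z})"
    have mono: "{z. y k dvd z} \<subseteq> {z. y l dvd z}" if "k \<le> l" for k l
      using that
    proof (induction l rule: dec_induct)
      case (step l)
      have "y (Suc l) dvd y l" using y_step[of l] by (metis dvd_triv_right)
      then have "{z. y l dvd z} \<subseteq> {z. y (Suc l) dvd z}" using dvd_trans[of "y (Suc l)" "y l"] by auto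
      then show ?case using step.IH by blast
    qed simp
    have "is_ideal (\<Union>\<C>)"
    proof (rule is_ideal_Union_chain)
      show "X \<subseteq> Y \<or> Y \<subseteq> X" if "X \<in> \<C>" "Y \<in> \<C>" for X Y
      proof -
        obtain k l where "X = {z. y k dvd z}" "Y = {z. y l dvd z}" using \<open>X \<in> \<C>\<close> \<open>Y \<in> \<C>\<close> by (auto simp: \<C>_def)
        then show ?thesis using mono[of k l] mono[of l k] by (cases "k \<le> l") auto
      qed
    qed (auto simp: \<C>_def is_ideal_principal)
    then obtain g where g: "\<Union>\<C> = {z. g dvd z}"
      using pid[unfolded is_PID_def principal_eq_dvd] by meson
    have "g \<in> \<Union>\<C>" using g by simp
    then obtain k where "y k dvd g" by (auto simp: \<C>_def)
    moreover have "y (Suc k) \<in> \<Union>\<C>" unfolding \<C>_def by (rule UN_I[of "Suc k"]) auto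
    ultimately have "y k dvd y (Suc k)" using g dvd_trans[of "y k" g "y (Suc k)"] by simp
    then have "p * y (Suc k) dvd 1 * y (Suc k)" using y_step[of k] by simp
    moreover have "y (Suc k) \<noteq> 0" using y[of "Suc k"] x0 by auto
    ultimately show False using p1 by (metis dvd_mult_cancel_right)
  qed
  have pow: "ideal_pow m k = {x. p ^ k dvd x}" for k unfolding mp by (rule ideal_pow_principal)
  have "\<exists>L. \<forall>n. p ^ n dvd L - y n" if y: "\<And>n. p ^ n dvd y (Suc n) - y n" for y
  proof -
    have "\<exists>N. \<forall>i\<ge>N. \<forall>j\<ge>N. y i - y j \<in> ideal_pow m k" for k
    proof (intro exI allI impI)
      fix i j assume "k \<le> i" "k \<le> j"
      then have "p ^ k dvd (y i - y k) - (y j - y k)"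
        by (intro dvd_diff[OF power_dvd_telescope[OF y] power_dvd_telescope[OF y]])
      then show "y i - y j \<in> ideal_pow m k" by (simp add: pow)
    qed
    then obtain L where L: "\<And>k. \<exists>N. \<forall>i\<ge>N. y i - L \<in> ideal_pow m k"
      using comp[folded m_def, unfolded adically_complete_def, rule_format, of y] by blast
    have "p ^ n dvd L - y n" for n
    proof -
      obtain N where "\<forall>i\<ge>N. y i - L \<in> ideal_pow m n" using L by blast
      then have "p ^ n dvd y (max N n) - L" by (simp add: pow)
      moreover have "p ^ n dvd y (max N n) - y n" using power_dvd_telescope[OF y] by simp
      ultimately have "p ^ n dvd (y (max N n) - y n) - (y (max N n) - L)" by (rule dvd_diff[rotated])
      then show ?thesis by simp
    qed
    then show ?thesis by blast
  qed
  moreover have "\<exists>F. finite F \<and> (\<forall>x. \<exists>y\<in>F. p dvd x - y)"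
  proof -
    have "finite (range (\<lambda>x. {y. x - y \<in> m}))" using fin by (simp add: finite_residue_field_def m_def)
    then obtain F where "finite F" and F: "range (\<lambda>x. {y. x - y \<in> m}) = (\<lambda>x. {y. x - y \<in> m}) ` F"
      using finite_subset_image[of "range (\<lambda>x. {y. x - y \<in> m})" "\<lambda>x. {y. x - y \<in> m}" UNIV] by auto
    have "\<exists>y\<in>F. p dvd x - y" for x
    proof -
      obtain y where y: "y \<in> F" "{z. x - z \<in> m} = {z. y - z \<in> m}" using F by blast
      have "y \<in> {z. y - z \<in> m}" by (simp add: mp)
      then have "y \<in> {z. x - z \<in> m}" by (simp only: y(2))
      then show ?thesis using y(1) by (auto simp: mp)
    qed
    then show ?thesis using \<open>finite F\<close> by blast
  qed
  ultimately have "complete_dvr p" by unfold_locales (use p0 p1 unit sep in auto)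
  then show ?thesis using that by blast
qed

unbundle fps_syntax
no_notation vec_index (infixl "$" 100)

section \<open>Divisibility in power series rings\<close>

lemma fps_const_dvd_iff:
  fixes f :: "'a::comm_ring_1 fps"
  shows "fps_const c dvd f \<longleftrightarrow> (\<forall>i. c dvd f $ i)"
proof
  assume "fps_const c dvd f"
  then obtain g where "f = fps_const c * g" by (rule dvdE)
  then show "\<forall>i. c dvd f $ i" by simp
next
  assume "\<forall>i. c dvd f $ i"
  then have "\<forall>i. \<exists>r. f $ i = c * r" by (simp add: dvd_def)
  then obtain r where "\<And>i. f $ i = c * r i" by metis
  then have "f = fps_const c * Abs_fps r" by (simp add: fps_eq_iff)
  then show "fps_const c dvd f" by simp
qed

lemma fps_unit_iff:
  fixes f :: "'a::comm_ring_1 fps"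
  shows "f dvd 1 \<longleftrightarrow> f $ 0 dvd 1"
proof
  assume "f dvd 1"
  then obtain g where "1 = f * g" by (rule dvdE)
  then have "f $ 0 * g $ 0 = 1" by (metis fps_mult_nth_0 fps_one_nth)
  then show "f $ 0 dvd 1" by (metis dvd_triv_left)
next
  assume "f $ 0 dvd 1"
  then obtain y where "f $ 0 * y = 1" by (metis dvdE)
  then have "f * fps_right_inverse f y = 1" by (rule fps_right_inverse)
  then show "f dvd 1" by (metis dvd_triv_left)
qed

lemma fps_shift_const_mult: "fps_shift l (fps_const c * f) = fps_const c * fps_shift l (f :: 'a::comm_ring_1 fps)"
  by (simp add: fps_eq_iff)

lemma fps_shift_diff': "fps_shift l (f - g) = fps_shift l f - fps_shift l (g :: 'a::ring_1 fps)"
  by (simp add: fps_eq_iff)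

lemma exact_power_factor:
  fixes q :: "'a::comm_ring_1"
  assumes "\<not> q ^ n dvd f"
  obtains k h where "f = q ^ k * h" "\<not> q dvd h"
proof -
  define m where "m = (LEAST n. \<not> q ^ n dvd f)"
  have m: "\<not> q ^ m dvd f" unfolding m_def using assms by (rule LeastI)
  then have "m \<noteq> 0" by (intro notI) simp
  then obtain k where k: "m = Suc k" using not0_implies_Suc by blast
  have "q ^ k dvd f"
  proof (rule ccontr)
    assume "\<not> q ^ k dvd f"
    then have "m \<le> k" unfolding m_def by (rule Least_le)
    then show False using k by simp
  qed
  then obtain h where h: "f = q ^ k * h" by (rule dvdE)
  have "\<not> q dvd h"
  proof
    assume "q dvd h"
    then have "q ^ k * q dvd q ^ k * h" by (rule mult_dvd_mono[OF dvd_refl])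
    then show False using m by (simp add: k h mult.commute)
  qed
  then show ?thesis using that h by blast
qed

text \<open>The unit \<open>u\<close> is carried through the induction because a factor associated
  to \<open>q\<close> can be stripped off only up to a unit.\<close>

lemma prime_power_dvd_prod_list:
  fixes q :: "'a::idom"
  assumes "prime_elem q" "\<forall>a\<in>set qs. prime_elem a" "u dvd 1" "q ^ k dvd u * prod_list qs"
  shows "k \<le> length qs"
  using assms(2-)
proof (induction qs arbitrary: u k)
  case Nil
  then have "q ^ k dvd 1" using dvd_trans[of "q ^ k" u 1] by simp
  moreover have "q dvd q ^ k" if "k \<noteq> 0" using that by (simp add: dvd_power)
  ultimately have "k = 0" using prime_elem_not_unit[OF assms(1)] dvd_trans by blast
  then show ?case by simp
next
  case (Cons a qs)
  show ?case
  proof (cases "q dvd a")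
    case True
    then obtain c where c: "a = q * c" by (rule dvdE)
    have "irreducible a" using Cons.prems(1) by (simp add: prime_elem_imp_irreducible)
    then have "c dvd 1" using irreducibleD[of a q c] c prime_elem_not_unit[OF assms(1)] by blast
    then have uc: "u * c dvd 1" using mult_dvd_mono[OF Cons.prems(2), of c 1] by simp
    show ?thesis
    proof (cases k)
      case (Suc k')
      have "q * q ^ k' dvd q * (u * c * prod_list qs)" using Cons.prems(3) by (simp add: Suc c ac_simps)
      then have "q ^ k' dvd u * c * prod_list qs" using prime_elem_not_zeroI[OF assms(1)] by simp
      then have "k' \<le> length qs" using Cons.IH[OF _ uc] Cons.prems(1) by simp
      then show ?thesis using Suc by simp
    qed simp
  next
    case False
    have "q ^ k dvd a * (u * prod_list qs)" using Cons.prems(3) by (simp add: ac_simps)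
    then have "q ^ k dvd u * prod_list qs" by (rule prime_power_dvd_mult_cancel[OF assms(1) False])
    then show ?thesis using Cons.IH[of u k] Cons.prems by simp
  qed
qed

context complete_dvr
begin

lemma unit_iff: "x dvd 1 \<longleftrightarrow> \<not> p dvd x"
  using unitI p_nonunit dvd_trans by blast

lemma prime_elem_p: "prime_elem p"
proof (rule prime_elemI[OF p_nonzero p_nonunit])
  fix a b assume "p dvd a * b"
  show "p dvd a \<or> p dvd b"
  proof (rule ccontr)
    assume "\<not> (p dvd a \<or> p dvd b)"
    then have "a dvd 1" "b dvd 1" using unitI by blast+
    then have "a * b dvd 1" using mult_dvd_mono[of a 1 b 1] by simp
    then show False using \<open>p dvd a * b\<close> unit_iff by blast
  qed
qed

definition \<pi> :: "'a fps" where "\<pi> = fps_const p"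

lemma pi_power: "\<pi> ^ k = fps_const (p ^ k)"
  by (simp add: \<pi>_def)

lemma pi_power_dvd_iff: "\<pi> ^ k dvd f \<longleftrightarrow> (\<forall>i. p ^ k dvd f $ i)"
  by (simp add: pi_power fps_const_dvd_iff)

lemma pi_dvd_iff: "\<pi> dvd f \<longleftrightarrow> (\<forall>i. p dvd f $ i)"
  by (simp add: \<pi>_def fps_const_dvd_iff)

lemma fps_separated:
  assumes "\<And>k. \<pi> ^ k dvd f"
  shows "f = 0"
  using assms separated unfolding pi_power_dvd_iff by (simp add: fps_eq_iff)

text \<open>The Weierstrass degree; it carries no information if \<open>\<pi>\<close> divides \<open>f\<close>.\<close>

definition wdeg :: "'a fps \<Rightarrow> nat" where
  "wdeg f = (LEAST i. \<not> p dvd f $ i)"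

lemma wdeg_nth:
  assumes "\<not> \<pi> dvd f"
  shows "\<not> p dvd f $ wdeg f"
  using assms unfolding pi_dvd_iff wdeg_def by (metis (mono_tags, lifting) LeastI)

lemma dvd_nth_less_wdeg: "i < wdeg f \<Longrightarrow> p dvd f $ i"
  unfolding wdeg_def using not_less_Least by blast

lemma wdeg_le: "\<not> p dvd f $ i \<Longrightarrow> wdeg f \<le> i"
  unfolding wdeg_def by (rule Least_le)

text \<open>Modulo the prime \<open>p\<close>, the lowest term of a product is the product of the
  lowest terms.\<close>

lemma wdeg_mult:
  assumes f: "\<not> \<pi> dvd f" and g: "\<not> \<pi> dvd g"
  shows "\<not> \<pi> dvd f * g" "wdeg (f * g) = wdeg f + wdeg g"
proof -
  let ?n = "wdeg f + wdeg g"
  have low: "p dvd (f * g) $ i" if "i < ?n" for i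
    unfolding fps_mult_nth
  proof (rule dvd_sum)
    fix j assume "j \<in> {0..i}"
    then have "j < wdeg f \<or> i - j < wdeg g" using that by auto
    then show "p dvd f $ j * g $ (i - j)"
      using dvd_nth_less_wdeg dvd_mult dvd_mult2 by blast
  qed
  have "(f * g) $ ?n = f $ wdeg f * g $ wdeg g + (\<Sum>j\<in>{0..?n} - {wdeg f}. f $ j * g $ (?n - j))"
    unfolding fps_mult_nth by (subst sum.remove[of _ "wdeg f"]) auto
  moreover have "p dvd (\<Sum>j\<in>{0..?n} - {wdeg f}. f $ j * g $ (?n - j))"
  proof (rule dvd_sum)
    fix j assume "j \<in> {0..?n} - {wdeg f}"
    then have "j < wdeg f \<or> ?n - j < wdeg g" by auto
    then show "p dvd f $ j * g $ (?n - j)"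
      using dvd_nth_less_wdeg dvd_mult dvd_mult2 by blast
  qed
  moreover have "\<not> p dvd f $ wdeg f * g $ wdeg g"
    using wdeg_nth[OF f] wdeg_nth[OF g] prime_elem_dvd_multD[OF prime_elem_p] by blast
  ultimately have top: "\<not> p dvd (f * g) $ ?n" by (simp add: dvd_add_left_iff)
  then show "\<not> \<pi> dvd f * g" by (auto simp: pi_dvd_iff)
  show "wdeg (f * g) = ?n"
    using wdeg_le[OF top] low wdeg_nth[OF \<open>\<not> \<pi> dvd f * g\<close>] by (meson le_neq_implies_less)
qed

lemma prime_elem_pi: "prime_elem \<pi>"
  using p_nonzero p_nonunit wdeg_mult(1)
  by (intro prime_elemI) (auto simp: fps_unit_iff \<pi>_def)

lemma pi_factor:
  assumes "f \<noteq> 0"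
  obtains k h where "f = \<pi> ^ k * h" "\<not> \<pi> dvd h"
  using assms fps_separated exact_power_factor by metis

lemma wdeg_eq_0_iff: "\<not> \<pi> dvd f \<Longrightarrow> wdeg f = 0 \<longleftrightarrow> f dvd 1"
  using wdeg_nth[of f] wdeg_le[of f 0] by (auto simp: fps_unit_iff unit_iff)

lemma wdeg_decomp:
  assumes "\<not> \<pi> dvd g"
  obtains a u where "g = \<pi> * a + fps_X ^ wdeg g * u" "u dvd 1"
proof -
  let ?l = "wdeg g"
  have "p dvd (g - fps_X ^ ?l * fps_shift ?l g) $ i" for i
    using dvd_nth_less_wdeg[of i g] by (simp add: fps_X_power_mult_nth)
  then have "\<pi> dvd g - fps_X ^ ?l * fps_shift ?l g" by (simp add: pi_dvd_iff)
  then obtain a where "g - fps_X ^ ?l * fps_shift ?l g = \<pi> * a" by (rule dvdE)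
  then have "g = \<pi> * a + fps_X ^ ?l * fps_shift ?l g" by (simp add: algebra_simps)
  moreover have "fps_shift ?l g dvd 1"
    using wdeg_nth[OF assms] by (simp add: fps_unit_iff unit_iff)
  ultimately show ?thesis using that by blast
qed

text \<open>Let \<open>l = wdeg g\<close>, \<open>g = \<pi> * a + fps_X ^ l * u\<close> and
  \<open>v\<close> the inverse of \<open>u\<close>. The quotient is sought as \<open>Z * v\<close>:
  the remainder has no terms from degree \<open>l\<close> on if \<open>Z + \<pi> * \<psi> Z\<close>
  equals \<open>f\<close> shifted by \<open>l\<close>. The factor \<open>\<pi>\<close> makes
  \<open>F\<close> a contraction, so iterating it from 0 converges to such a
  \<open>Z\<close>.\<close>

lemma weierstrass_division:
  assumes g: "\<not> \<pi> dvd g"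
  obtains q r where "f = q * g + r" "\<And>i. wdeg g \<le> i \<Longrightarrow> r $ i = 0"
proof -
  let ?l = "wdeg g"
  obtain a u where gau: "g = \<pi> * a + fps_X ^ ?l * u" and "u dvd 1" by (rule wdeg_decomp[OF g])
  then obtain v where uv: "u * v = 1" by (metis dvdE)
  define \<psi> where "\<psi> z = fps_shift ?l (z * (v * a))" for z
  have \<psi>_diff: "\<psi> y - \<psi> z = \<psi> (y - z)" for y z
    by (simp add: \<psi>_def fps_shift_diff' left_diff_distrib)
  have \<psi>_dvd: "\<pi> ^ n dvd \<psi> z" if "\<pi> ^ n dvd z" for n z
  proof -
    from that obtain y where "z = \<pi> ^ n * y" by (rule dvdE)
    then have "\<psi> z = \<pi> ^ n * \<psi> y"
      by (simp only: \<psi>_def mult.assoc fps_shift_const_mult pi_power)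
    then show ?thesis by (rule dvdI)
  qed
  define F where "F z = fps_shift ?l f - \<pi> * \<psi> z" for z
  define S where "S n = (F ^^ n) 0" for n
  have S_Suc: "S (Suc n) = F (S n)" for n by (simp add: S_def)
  have F_diff: "F y - F z = - (\<pi> * \<psi> (y - z))" for y z
    by (simp add: F_def \<psi>_diff[symmetric] right_diff_distrib)
  have S_cauchy: "\<pi> ^ n dvd S (Suc n) - S n" for n
  proof (induction n)
    case (Suc n)
    have "\<pi> * \<pi> ^ n dvd \<pi> * \<psi> (S (Suc n) - S n)"
      by (rule mult_dvd_mono[OF dvd_refl \<psi>_dvd[OF Suc]])
    moreover have "S (Suc (Suc n)) - S (Suc n) = - (\<pi> * \<psi> (S (Suc n) - S n))"
      using F_diff[of "S (Suc n)" "S n"] by (simp add: S_Suc[symmetric])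
    ultimately show ?case by simp
  qed simp
  have "\<exists>L. \<forall>n. p ^ n dvd L - S n $ i" for i
    using S_cauchy[unfolded pi_power_dvd_iff] by (intro complete) simp
  then obtain L where L: "\<And>i n. p ^ n dvd L i - S n $ i" by metis
  define Z where "Z = Abs_fps L"
  have Z: "\<pi> ^ n dvd Z - S n" for n by (simp add: pi_power_dvd_iff Z_def L)
  have "Z - F Z = 0"
  proof (rule fps_separated)
    fix n
    have "\<pi> ^ n dvd Z - S (Suc n)" by (rule dvd_trans[OF le_imp_power_dvd Z]) simp
    moreover have "\<pi> ^ n dvd S (Suc n) - F Z"
      unfolding S_Suc F_diff dvd_minus_iff using Z[of n]
      by (intro dvd_mult \<psi>_dvd) (metis dvd_minus_iff minus_diff_eq)
    ultimately have "\<pi> ^ n dvd (Z - S (Suc n)) + (S (Suc n) - F Z)" by (rule dvd_add)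
    then show "\<pi> ^ n dvd Z - F Z" by simp
  qed
  then have Zeq: "fps_shift ?l f = Z + \<pi> * \<psi> Z" by (simp add: F_def algebra_simps)
  have "Z * v * (\<pi> * a + fps_X ^ ?l * u) = \<pi> * (Z * (v * a)) + Z * fps_X ^ ?l * (u * v)"
    by (simp add: algebra_simps)
  then have "Z * v * g = \<pi> * (Z * (v * a)) + Z * fps_X ^ ?l" by (simp add: uv gau[symmetric])
  then have "fps_shift ?l (Z * v * g) = fps_shift ?l f"
    by (simp add: fps_shift_add fps_shift_const_mult \<pi>_def \<psi>_def Zeq fps_shift_times_fps_X_power)
  then have shift: "fps_shift ?l (f - Z * v * g) = 0" by (simp add: fps_shift_diff')
  have "(f - Z * v * g) $ i = 0" if "?l \<le> i" for i
  proof -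
    have "fps_shift ?l (f - Z * v * g) $ (i - ?l) = 0" by (simp only: shift fps_zero_nth)
    then show ?thesis using that by simp
  qed
  then show ?thesis using that[of "Z * v" "f - Z * v * g"] by simp
qed

text \<open>A generator is an element of minimal Weierstrass degree: the remainder of the division by it
  is a power of \<open>p\<close> times an element of smaller degree, which again lies in the ideal.\<close>

lemma saturated_ideal_principal:
  assumes I: "is_ideal I" and sat: "\<And>x. \<pi> * x \<in> I \<Longrightarrow> x \<in> I" and "f \<in> I" "f \<noteq> 0"
  obtains g where "\<not> \<pi> dvd g" "I = {x. g dvd x}"
proof -
  have sat': "x \<in> I" if "\<pi> ^ k * x \<in> I" for k x
    using that by (induction k) (auto simp: mult.assoc intro: sat)
  have "\<exists>h. h \<in> I \<and> \<not> \<pi> dvd h"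
    using pi_factor[OF \<open>f \<noteq> 0\<close>] \<open>f \<in> I\<close> sat' by metis
  then obtain g where g: "g \<in> I" "\<not> \<pi> dvd g"
    and min: "\<And>h. h \<in> I \<Longrightarrow> \<not> \<pi> dvd h \<Longrightarrow> wdeg g \<le> wdeg h"
    using ex_has_least_nat[of "\<lambda>h. h \<in> I \<and> \<not> \<pi> dvd h" _ wdeg] by blast
  have "g dvd x" if x: "x \<in> I" for x
  proof -
    obtain q r where qr: "x = q * g + r" "\<And>i. wdeg g \<le> i \<Longrightarrow> r $ i = 0"
      using weierstrass_division[OF g(2), of x] by metis
    have "r = x - q * g" using qr(1) by simp
    then have rI: "r \<in> I" using is_idealD(3,6)[OF I] x g(1) by metis
    have "r = 0"
    proof (rule ccontr)
      assume "r \<noteq> 0"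
      then obtain k h where h: "r = \<pi> ^ k * h" "\<not> \<pi> dvd h" by (rule pi_factor)
      \<comment> \<open>As \<open>r\<close> has no coefficients from \<open>wdeg g\<close> on, the
        coefficient of \<open>h\<close> at \<open>wdeg h\<close> vanishes, although \<open>p\<close>
        does not divide it.\<close>
      have "wdeg g \<le> wdeg h" using min[OF _ h(2)] sat' rI h(1) by blast
      then have "r $ wdeg h = 0" by (rule qr(2))
      then have "h $ wdeg h = 0" using p_nonzero by (simp add: h(1) pi_power)
      then show False using wdeg_nth[OF h(2)] by simp
    qed
    then show ?thesis using qr(1) by simp
  qed
  moreover have "x \<in> I" if "g dvd x" for x
    using that is_idealD(4)[OF I g(1)] by (metis dvdE)
  ultimately have "I = {x. g dvd x}" by blast
  then show ?thesis using that g(2) by blast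
qed

lemma dvd_pi_power_mult_cancel:
  assumes "\<not> \<pi> dvd g" "g dvd \<pi> ^ k * b"
  shows "g dvd b"
proof -
  obtain c where c: "\<pi> ^ k * b = g * c" using assms(2) by (rule dvdE)
  have "\<pi> ^ k dvd c"
    by (rule prime_power_dvd_mult_cancel[OF prime_elem_pi assms(1)]) (metis c dvd_triv_left)
  then obtain d where "c = \<pi> ^ k * d" by (rule dvdE)
  then have "\<pi> ^ k * b = \<pi> ^ k * (g * d)" using c by (simp only: mult.left_commute)
  then have "b = g * d" using prime_elem_not_zeroI[OF prime_elem_pi] by (metis mult_cancel_left power_not_zero)
  then show ?thesis by simp
qed

text \<open>A nonunit divisor \<open>g\<close> of least Weierstrass degree is prime. For
  \<open>g dvd a * b\<close>, the saturation of the ideal generated by \<open>g\<close> and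
  \<open>a\<close> is generated by some \<open>h\<close>. If \<open>h\<close> is a unit, some
  \<open>\<pi> ^ k\<close> is a combination of \<open>g\<close> and \<open>a\<close>, so
  \<open>g\<close> divides \<open>\<pi> ^ k * b\<close> and hence \<open>b\<close>. Otherwise
  minimality makes \<open>h\<close> an associate of \<open>g\<close>, and \<open>h\<close> divides
  \<open>a\<close>.\<close>

lemma prime_divisor_exists:
  assumes "\<not> \<pi> dvd f" "\<not> f dvd 1"
  obtains g where "prime_elem g" "g dvd f"
proof -
  obtain g where g: "g dvd f" "\<not> g dvd 1"
    and min: "\<And>h. h dvd f \<Longrightarrow> \<not> h dvd 1 \<Longrightarrow> wdeg g \<le> wdeg h"
    using ex_has_least_nat[of "\<lambda>h. h dvd f \<and> \<not> h dvd 1" f wdeg] assms(2) dvd_refl[of f] by metis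
  have pg: "\<not> \<pi> dvd h" if "h dvd g" for h
    using assms(1) dvd_trans[OF _ dvd_trans[OF that g(1)]] by blast
  have "prime_elem g"
  proof (rule prime_elemI)
    show "g \<noteq> 0" using pg[OF dvd_refl] by auto
    show "\<not> g dvd 1" by fact
    fix a b assume ab: "g dvd a * b"
    define J where "J = {x. \<exists>k y z. \<pi> ^ k * x = y * g + z * a}"
    have "is_ideal J"
      unfolding is_ideal_def
    proof (intro conjI ballI allI)
      show "0 \<in> J" unfolding J_def by (intro CollectI exI[of _ 0]) simp
    next
      fix x x' assume "x \<in> J" "x' \<in> J"
      then obtain k y z k' y' z' where
        "\<pi> ^ k * x = y * g + z * a" "\<pi> ^ k' * x' = y' * g + z' * a" by (auto simp: J_def)
      note eqs = this
      have "\<pi> ^ (k + k') * (x + x') = \<pi> ^ k' * (\<pi> ^ k * x) + \<pi> ^ k * (\<pi> ^ k' * x')"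
        by (simp add: power_add algebra_simps)
      also have "\<dots> = (\<pi> ^ k' * y + \<pi> ^ k * y') * g + (\<pi> ^ k' * z + \<pi> ^ k * z') * a"
        unfolding eqs by (simp add: algebra_simps)
      finally show "x + x' \<in> J" unfolding J_def by blast
    next
      fix r x assume "x \<in> J"
      then obtain k y z where "\<pi> ^ k * x = y * g + z * a" by (auto simp: J_def)
      then have "\<pi> ^ k * (r * x) = r * (y * g + z * a)" by (simp only: mult.left_commute)
      then have "\<pi> ^ k * (r * x) = (r * y) * g + (r * z) * a" by (simp add: algebra_simps)
      then show "r * x \<in> J" unfolding J_def by blast
    qed
    moreover have "x \<in> J" if x: "\<pi> * x \<in> J" for x
    proof -
      obtain k y z where "\<pi> ^ k * (\<pi> * x) = y * g + z * a" using x by (auto simp: J_def)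
      then have "\<pi> ^ Suc k * x = y * g + z * a" by (simp only: power_Suc ac_simps)
      then show ?thesis unfolding J_def by blast
    qed
    moreover have gJ: "g \<in> J" unfolding J_def
      by (intro CollectI exI[of _ 0] exI[of _ 1]) simp
    ultimately obtain h where h: "J = {x. h dvd x}"
      using saturated_ideal_principal[of J g] \<open>g \<noteq> 0\<close> by metis
    have aJ: "a \<in> J" unfolding J_def
      by (intro CollectI exI[of _ 0] exI[of _ 0] exI[of _ 1]) simp
    show "g dvd a \<or> g dvd b"
    proof (cases "h dvd 1")
      case True
      then have "1 \<in> J" by (simp add: h)
      then obtain k y z where "\<pi> ^ k * 1 = y * g + z * a" by (auto simp: J_def)
      then have "\<pi> ^ k * b = g * (y * b) + z * (a * b)" by (simp add: algebra_simps)
      moreover have "g dvd g * (y * b) + z * (a * b)" by (rule dvd_add[OF dvd_triv_left dvd_mult[OF ab]])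
      ultimately have "g dvd \<pi> ^ k * b" by simp
      then show ?thesis using dvd_pi_power_mult_cancel[OF pg[OF dvd_refl]] by blast
    next
      case False
      have "h dvd g" "h dvd a" using gJ aJ by (simp_all add: h)
      then obtain c where c: "g = h * c" by (metis dvdE)
      have nh: "\<not> \<pi> dvd h" "\<not> \<pi> dvd c" using pg[of h] pg[of c] c by simp_all
      have "wdeg g \<le> wdeg h" using min[OF _ False] \<open>h dvd g\<close> g(1) dvd_trans by blast
      then have "wdeg c = 0" using wdeg_mult(2)[OF nh] c by simp
      then have "c dvd 1" using wdeg_eq_0_iff[OF nh(2)] by simp
      then have "h * c dvd h * 1" by (rule mult_dvd_mono[OF dvd_refl])
      then have "g dvd h" by (simp add: c)
      then show ?thesis using \<open>h dvd a\<close> dvd_trans by blast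
    qed
  qed
  then show ?thesis using that g(1) by blast
qed

text \<open>Powers of \<open>\<pi>\<close> are split off first, because \<open>wdeg\<close> is a
  measure for the induction only on elements that \<open>\<pi>\<close> does not divide.\<close>

lemma prime_factorization_exists:
  fixes f :: "'a fps"
  assumes "f \<noteq> 0"
  obtains u qs where "u dvd 1" "\<forall>q\<in>set qs. prime_elem q" "f = u * prod_list qs"
proof -
  have *: "\<exists>u qs. u dvd 1 \<and> (\<forall>q\<in>set qs. prime_elem q) \<and> f = u * prod_list qs" if "\<not> \<pi> dvd f" for f
    using that
  proof (induction "wdeg f" arbitrary: f rule: less_induct)
    case less
    show ?case
    proof (cases "f dvd 1")
      case True
      then show ?thesis by (intro exI[of _ f] exI[of _ "[]"]) simp
    next
      case False
      obtain g where g: "prime_elem g" "g dvd f" by (rule prime_divisor_exists[OF less.prems False])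
      then obtain c where c: "f = g * c" by (metis dvdE)
      have nn: "\<not> \<pi> dvd g" "\<not> \<pi> dvd c" using less.prems c dvd_mult dvd_mult2 by blast+
      have "wdeg g \<noteq> 0" using wdeg_eq_0_iff[OF nn(1)] prime_elem_not_unit[OF g(1)] by blast
      then have "wdeg c < wdeg f" using wdeg_mult(2)[OF nn] c by simp
      then obtain u qs where "u dvd 1" "\<forall>q\<in>set qs. prime_elem q" "c = u * prod_list qs"
        using less.hyps nn(2) by blast
      then show ?thesis using g(1) c by (intro exI[of _ u] exI[of _ "g # qs"]) (simp add: ac_simps)
    qed
  qed
  obtain k h where h: "f = \<pi> ^ k * h" "\<not> \<pi> dvd h" by (rule pi_factor[OF assms])
  obtain u qs where "u dvd 1" "\<forall>q\<in>set qs. prime_elem q" "h = u * prod_list qs"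
    using *[OF h(2)] by blast
  then have "u dvd 1" "\<forall>q\<in>set (replicate k \<pi> @ qs). prime_elem q" "f = u * prod_list (replicate k \<pi> @ qs)"
    using prime_elem_pi h(1) by (auto simp: prod_list_replicate ac_simps)
  then show ?thesis by (rule that)
qed

lemma prime_factor:
  fixes q f :: "'a fps"
  assumes "prime_elem q" "f \<noteq> 0"
  obtains k h where "f = q ^ k * h" "\<not> q dvd h"
proof -
  obtain u qs where qs: "u dvd 1" "\<forall>q\<in>set qs. prime_elem q" "f = u * prod_list qs"
    by (rule prime_factorization_exists[OF assms(2)])
  have "\<not> q ^ Suc (length qs) dvd f"
  proof
    assume "q ^ Suc (length qs) dvd f"
    then have "Suc (length qs) \<le> length qs"
      using prime_power_dvd_prod_list[OF assms(1) qs(2,1)] qs(3) by blast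
    then show False by simp
  qed
  then show ?thesis using exact_power_factor that by metis
qed

end

subsection \<open>Prime ideals and heights\<close>

lemma is_ideal_dvd: "is_ideal I \<Longrightarrow> g \<in> I \<Longrightarrow> g dvd x \<Longrightarrow> x \<in> I"
  using is_idealD(4) by (metis dvdE)

lemma prime_ideal_power: "prime_ideal I \<Longrightarrow> x ^ k \<in> I \<Longrightarrow> x \<in> I"
proof (induction k)
  case 0
  then have "y \<in> I" for y using is_idealD(4)[of I 1 y] by (simp add: prime_ideal_def)
  then show ?case .
next
  case (Suc k)
  then show ?case by (auto simp: prime_ideal_def)
qed

lemma prime_ideal_not_one: "prime_ideal I \<Longrightarrow> 1 \<notin> I"
  unfolding prime_ideal_def using is_idealD(4)[of I 1] by auto

lemma prime_ideal_zero: "prime_ideal {0 :: 'a::idom}"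
proof -
  have "(1 :: 'a) \<notin> {0}" by simp
  then have "{0 :: 'a} \<noteq> UNIV" by blast
  then show ?thesis by (auto simp: prime_ideal_def is_ideal_def)
qed

lemma prime_ideal_principal: "prime_elem q \<Longrightarrow> prime_ideal {x. q dvd x}"
  using is_ideal_principal[of q] unfolding prime_ideal_def prime_elem_def by auto

lemma prime_elem_dvd_imp_dvd:
  fixes q q' :: "'a::idom"
  assumes "prime_elem q" "prime_elem q'" "q dvd q'"
  shows "q' dvd q"
proof -
  obtain c where c: "q' = q * c" using assms(3) by (rule dvdE)
  have "irreducible q'" using assms(2) by (simp add: prime_elem_imp_irreducible)
  then have "c dvd 1" using irreducibleD[of q' q c] c prime_elem_not_unit[OF assms(1)] by blast
  then have "q * c dvd q * 1" by (rule mult_dvd_mono[OF dvd_refl])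
  then show ?thesis by (simp add: c)
qed

definition prime_chain :: "(nat \<Rightarrow> 'r::comm_ring_1 set) \<Rightarrow> nat \<Rightarrow> 'r set \<Rightarrow> bool" where
  "prime_chain C n I \<longleftrightarrow> (\<forall>k\<le>n. prime_ideal (C k)) \<and> (\<forall>k<n. C k \<subset> C (Suc k)) \<and> C n = I"

lemma prime_chain_Suc:
  assumes "prime_chain C (Suc n) I"
  shows "prime_chain C n (C n)" "C n \<subset> I" "prime_ideal (C n)"
  using assms by (auto simp: prime_chain_def)

lemma prime_height_le_iff: "prime_height I \<le> enat m \<longleftrightarrow> (\<forall>C n. prime_chain C n I \<longrightarrow> n \<le> m)"
  unfolding prime_height_def prime_chain_def by (auto simp: SUP_le_iff)

lemma prime_height_ge:
  assumes "prime_chain C n I"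
  shows "enat n \<le> prime_height I"
  unfolding prime_height_def using assms unfolding prime_chain_def
  by (intro SUP_upper CollectI exI[of _ C])

context complete_dvr
begin

lemma nonunit_add:
  fixes f g :: "'a fps"
  assumes "\<not> f dvd 1" "\<not> g dvd 1"
  shows "\<not> f + g dvd 1"
  using assms by (simp add: fps_unit_iff unit_iff)

lemma is_ideal_nonunits: "is_ideal {f :: 'a fps. \<not> f dvd 1}"
proof -
  have "\<not> r * x dvd 1" if "\<not> x dvd 1" for r x :: "'a fps"
    using that dvd_trans[of x "r * x" 1] by auto
  moreover have "\<not> (0 :: 'a fps) dvd 1" by simp
  ultimately show ?thesis unfolding is_ideal_def using nonunit_add by blast
qed

lemma not_pi_dvd_X: "\<not> \<pi> dvd fps_X"
  using p_nonunit by (auto simp: pi_dvd_iff fps_X_def)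

lemma pi_nonunit: "\<not> \<pi> dvd 1"
  using prime_elem_pi by (rule prime_elem_not_unit)

lemma X_nonunit: "\<not> (fps_X :: 'a fps) dvd 1"
  by (simp add: fps_unit_iff)

text \<open>A common prime divisor would be associated to \<open>\<pi>\<close>, and then
  \<open>\<pi>\<close> would divide \<open>fps_X\<close>. This provides, for each \<open>q\<close>,
  a nonunit prime to \<open>q\<close>.\<close>

lemma prime_not_dvd_pi_or_X:
  assumes "prime_elem q"
  shows "\<not> q dvd \<pi> \<or> \<not> q dvd fps_X"
  using prime_elem_dvd_imp_dvd[OF assms prime_elem_pi] not_pi_dvd_X dvd_trans by blast

text \<open>If \<open>\<pi> \<notin> I\<close>, primality makes \<open>I\<close> saturated, hence
  zero or principal. If \<open>I\<close> contains \<open>\<pi>\<close> and an element that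
  \<open>\<pi>\<close> does not divide, that element is modulo \<open>\<pi>\<close> a unit times a
  power of \<open>fps_X\<close>, so \<open>fps_X\<close> and with it every nonunit lies in
  \<open>I\<close>.\<close>

lemma prime_ideal_cases:
  fixes I :: "'a fps set"
  assumes I: "prime_ideal I"
  obtains "I = {0}" | q where "prime_elem q" "I = {x. q dvd x}" | "I = {f. \<not> f dvd 1}"
proof -
  have id: "is_ideal I" using I by (simp add: prime_ideal_def)
  have one: "1 \<notin> I" using I by (rule prime_ideal_not_one)
  consider "I = {0}" | f where "f \<in> I" "f \<noteq> 0" "\<pi> \<notin> I" | "\<pi> \<in> I" "I \<subseteq> {x. \<pi> dvd x}"
    | g where "\<pi> \<in> I" "g \<in> I" "\<not> \<pi> dvd g"
    using is_idealD(1)[OF id] by blast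
  then show ?thesis
  proof cases
    case 1
    then show ?thesis by (rule that)
  next
    case 2
    then have "x \<in> I" if "\<pi> * x \<in> I" for x using that I by (auto simp: prime_ideal_def)
    then obtain g where g: "I = {x. g dvd x}"
      using saturated_ideal_principal[OF id _ 2(1,2)] by metis
    have "g \<noteq> 0" using 2(1,2) g by auto
    moreover have "\<not> g dvd 1" using one g by simp
    moreover have "g dvd a \<or> g dvd b" if "g dvd a * b" for a b
      using that I unfolding g prime_ideal_def by auto
    ultimately have "prime_elem g" by (rule prime_elemI)
    then show ?thesis using g by (rule that)
  next
    case 3
    then have "I = {x. \<pi> dvd x}" using is_ideal_dvd[OF id 3(1)] by blast
    then show ?thesis using prime_elem_pi by (rule that(2)[rotated])
  next
    case 4
    obtain a u where g: "g = \<pi> * a + fps_X ^ wdeg g * u" and "u dvd 1" by (rule wdeg_decomp[OF 4(3)])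
    then obtain v where v: "u * v = 1" by (metis dvdE)
    have "fps_X ^ wdeg g * u = g - \<pi> * a" using g by (simp add: algebra_simps)
    also have "\<dots> \<in> I" using 4(1,2) by (intro is_idealD[OF id])
    finally have "fps_X ^ wdeg g * u * v \<in> I" by (rule is_idealD(4)[OF id])
    then have "fps_X ^ wdeg g \<in> I" by (simp add: mult.assoc v)
    then have X: "fps_X \<in> I" by (rule prime_ideal_power[OF I])
    have "f \<in> I" if "\<not> f dvd 1" for f
    proof -
      have "\<pi> dvd fps_const (f $ 0)" using that by (simp add: fps_unit_iff unit_iff pi_dvd_iff)
      then have "fps_const (f $ 0) \<in> I" using is_ideal_dvd[OF id 4(1)] by blast
      moreover have "f = fps_const (f $ 0) + fps_X * fps_shift 1 f"
        by (simp add: fps_eq_iff)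
      ultimately show ?thesis using X is_idealD(2,4)[OF id] by metis
    qed
    moreover have "\<not> f dvd 1" if "f \<in> I" for f using that one is_ideal_dvd[OF id] by blast
    ultimately have "I = {f. \<not> f dvd 1}" by blast
    then show ?thesis by (rule that)
  qed
qed

lemma prime_ideal_nonunits: "prime_ideal {f :: 'a fps. \<not> f dvd 1}"
proof -
  have "a * b dvd 1" if "a dvd 1" "b dvd 1" for a b :: "'a fps"
    using mult_dvd_mono[OF that] by simp
  then have "\<forall>a b. a * b \<in> {f :: 'a fps. \<not> f dvd 1} \<longrightarrow> a \<in> {f. \<not> f dvd 1} \<or> b \<in> {f. \<not> f dvd 1}"
    by blast
  moreover have "1 \<notin> {f :: 'a fps. \<not> f dvd 1}" by simp
  then have "{f :: 'a fps. \<not> f dvd 1} \<noteq> UNIV" by (metis UNIV_I)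
  ultimately show ?thesis using is_ideal_nonunits unfolding prime_ideal_def by blast
qed

text \<open>Divisibility between prime elements is symmetric, so no \<open>(q')\<close> lies
  strictly below \<open>(q)\<close>; only the zero ideal does.\<close>

lemma height_principal_prime:
  fixes q :: "'a fps"
  assumes q: "prime_elem q"
  shows "prime_height {x. q dvd x} \<le> enat 1"
  unfolding prime_height_le_iff
proof (intro allI impI)
  fix C :: "nat \<Rightarrow> 'a fps set" and n assume C: "prime_chain C n {x. q dvd x}"
  show "n \<le> 1"
  proof (rule ccontr)
    assume "\<not> n \<le> 1"
    then have n: "n = Suc (Suc (n - 2))" by simp
    define m where "m = n - 2"
    note n = n[folded m_def]
    note C1 = prime_chain_Suc[OF C[unfolded n]]
    note C2 = prime_chain_Suc[OF C1(1)]
    from C1(3) show False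
    proof (cases rule: prime_ideal_cases)
      case 1
      moreover have "0 \<in> C m" using C2(3) is_idealD(1)[of "C m"] by (simp add: prime_ideal_def)
      ultimately show False using C2(2) by auto
    next
      case (2 q')
      then have "q' \<in> C (Suc m)" by simp
      then have "q dvd q'" using C1(2) by blast
      then have "q' dvd q" by (rule prime_elem_dvd_imp_dvd[OF q 2(1)])
      then have "{x. q dvd x} \<subseteq> C (Suc m)"
        unfolding 2(2) by (intro Collect_mono impI) (rule dvd_trans)
      then show False using C1(2) by blast
    next
      case 3
      have "\<not> x dvd 1" if "q dvd x" for x using that prime_elem_not_unit[OF q] dvd_trans by blast
      then show False using C1(2) 3 by blast
    qed
  qed
qed

lemma height_nonunits: "prime_height {f :: 'a fps. \<not> f dvd 1} = 2"
proof (rule antisym)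
  have "n \<le> 2" if C: "prime_chain C n {f :: 'a fps. \<not> f dvd 1}" for C n
  proof (rule ccontr)
    assume "\<not> n \<le> 2"
    then have n: "n = Suc (Suc (n - 2))" and "1 \<le> n - 2" by simp_all
    define m where "m = n - 2"
    note n = n[folded m_def]
    note C1 = prime_chain_Suc[OF C[unfolded n]]
    note C2 = prime_chain_Suc[OF C1(1)]
    from C1(3) show False
    proof (cases rule: prime_ideal_cases)
      case 1
      moreover have "0 \<in> C m" using C2(3) is_idealD(1)[of "C m"] by (simp add: prime_ideal_def)
      ultimately show False using C2(2) by auto
    next
      case (2 q)
      then have "Suc m \<le> 1"
        using height_principal_prime[OF 2(1)] C1(1) unfolding prime_height_le_iff by metis
      then show False using \<open>1 \<le> n - 2\<close> by (simp add: m_def)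
    next
      case 3
      then show False using C1(2) by blast
    qed
  qed
  then have "prime_height {f :: 'a fps. \<not> f dvd 1} \<le> enat 2" unfolding prime_height_le_iff by blast
  then show "prime_height {f :: 'a fps. \<not> f dvd 1} \<le> 2" by (simp add: numeral_eq_enat)
  define C where "C n = (if n = 0 then {0} else if n = Suc 0 then {x. \<pi> dvd x} else {f. \<not> f dvd 1})"
    for n :: nat
  have "\<pi> \<in> C 1" "\<pi> \<notin> C 0" "C 0 \<subseteq> C 1"
    using prime_elem_not_zeroI[OF prime_elem_pi] by (simp_all add: C_def)
  then have "C 0 \<subset> C 1" by blast
  moreover have "C 1 \<subset> C 2"
  proof -
    have "\<not> x dvd 1" if "\<pi> dvd x" for x using that pi_nonunit dvd_trans by blast
    then have "C 1 \<subseteq> C 2" by (auto simp: C_def)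
    moreover have "fps_X \<in> C 2" "fps_X \<notin> C 1"
      using X_nonunit not_pi_dvd_X by (simp_all add: C_def)
    ultimately show ?thesis by blast
  qed
  ultimately have "\<forall>k<2. C k \<subset> C (Suc k)"
    using less_2_cases by (metis One_nat_def numeral_2_eq_2)
  moreover have "prime_ideal (C k)" for k
    using prime_ideal_zero[where 'a="'a fps"] prime_ideal_principal[OF prime_elem_pi] prime_ideal_nonunits
    unfolding C_def by presburger
  moreover have "C 2 = {f. \<not> f dvd 1}" by (simp add: C_def)
  ultimately have "prime_chain C 2 {f. \<not> f dvd 1}" by (simp add: prime_chain_def)
  then show "2 \<le> prime_height {f :: 'a fps. \<not> f dvd 1}"
    using prime_height_ge by (metis numeral_eq_enat)
qed

lemma ideal_height_2D:
  fixes I :: "'a fps set"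
  assumes "ideal_height I = 2" "prime_elem q"
  shows "\<not> I \<subseteq> {x. q dvd x}"
proof
  assume "I \<subseteq> {x. q dvd x}"
  then have "ideal_height I \<le> prime_height {x. q dvd x}"
    unfolding ideal_height_def using prime_ideal_principal[OF assms(2)] by (intro INF_lower) simp
  also have "\<dots> \<le> enat 1" by (rule height_principal_prime[OF assms(2)])
  finally show False using assms(1) by (simp add: numeral_eq_enat)
qed

text \<open>The nonunits form the only prime ideal above \<open>I\<close>. Units are excluded
  because the unit ideal lies in no prime and has infinite height.\<close>

lemma ideal_height_2I:
  fixes I :: "'a fps set"
  assumes "\<And>x. x \<in> I \<Longrightarrow> \<not> x dvd 1" "\<And>q. prime_elem q \<Longrightarrow> \<not> I \<subseteq> {x. q dvd x}"
  shows "ideal_height I = 2"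
proof -
  have "{P. prime_ideal P \<and> I \<subseteq> P} = {{f. \<not> f dvd 1}}"
  proof (intro equalityI subsetI)
    fix P assume "P \<in> {P. prime_ideal P \<and> I \<subseteq> P}"
    then have P: "prime_ideal P" "I \<subseteq> P" by auto
    have "\<not> I \<subseteq> {0}" using assms(2)[OF prime_elem_pi] by auto
    then have "P \<noteq> {0}" using P(2) by blast
    then show "P \<in> {{f. \<not> f dvd 1}}"
      using P prime_ideal_cases[OF P(1)] assms(2) by (metis singletonI)
  next
    fix P assume "P \<in> {{f :: 'a fps. \<not> f dvd 1}}"
    then show "P \<in> {P. prime_ideal P \<and> I \<subseteq> P}" using prime_ideal_nonunits assms(1) by auto
  qed
  then show ?thesis unfolding ideal_height_def using height_nonunits by simp
qed

text \<open>The nonunits carrying \<open>I\<close> into \<open>J\<close> form an ideal, and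
  \<open>ideal_height_2D\<close> and \<open>ideal_height_2I\<close> reduce height 2 to not being
  contained in any \<open>(q)\<close>.\<close>

lemma ideal_prec_iff:
  fixes I J :: "'a fps set"
  assumes J: "is_ideal J"
  shows "ideal_prec I J \<longleftrightarrow> (\<forall>q. prime_elem q \<longrightarrow> (\<exists>t. \<not> q dvd t \<and> (\<forall>x\<in>I. t * x \<in> J)))"
proof (intro iffI allI impI)
  fix q :: "'a fps" assume "ideal_prec I J" and q: "prime_elem q"
  then obtain A where A: "ideal_height A = 2" "\<forall>t\<in>A. \<forall>x\<in>I. t * x \<in> J"
    by (auto simp: ideal_prec_def ideal_prod_subset_iff[OF J])
  then show "\<exists>t. \<not> q dvd t \<and> (\<forall>x\<in>I. t * x \<in> J)" using ideal_height_2D[OF A(1) q] by blast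
next
  assume *: "\<forall>q. prime_elem q \<longrightarrow> (\<exists>t. \<not> q dvd t \<and> (\<forall>x\<in>I. t * x \<in> J))"
  define A where "A = {t. \<not> t dvd 1 \<and> (\<forall>x\<in>I. t * x \<in> J)}"
  have "is_ideal A"
    unfolding is_ideal_def A_def
    using is_idealD[OF is_ideal_nonunits] is_idealD[OF J]
    by (auto simp: distrib_right mult.assoc)
  moreover have "ideal_height A = 2"
  proof (rule ideal_height_2I)
    show "\<not> x dvd 1" if "x \<in> A" for x using that by (simp add: A_def)
    fix q :: "'a fps" assume q: "prime_elem q"
    then obtain t where t: "\<not> q dvd t" "\<forall>x\<in>I. t * x \<in> J" using * by blast
    \<comment> \<open>\<open>t\<close> may be a unit; multiplying it by a nonunit prime to
      \<open>q\<close> brings it into \<open>A\<close>.\<close>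
    obtain s :: "'a fps" where s: "\<not> q dvd s" "\<not> s dvd 1"
      using prime_not_dvd_pi_or_X[OF q] pi_nonunit X_nonunit by blast
    have "\<not> s * t dvd 1" using s(2) dvd_trans[of s "s * t" 1] by auto
    moreover have "\<forall>x\<in>I. s * t * x \<in> J" using t(2) is_idealD(3)[OF J] by (simp add: mult.assoc)
    moreover have "\<not> q dvd s * t" using s t prime_elem_dvd_multD[OF q] by blast
    ultimately show "\<not> A \<subseteq> {x. q dvd x}" unfolding A_def by blast
  qed
  moreover have "ideal_prod A I \<subseteq> J" by (auto simp: ideal_prod_subset_iff[OF J] A_def)
  ultimately show "ideal_prec I J" unfolding ideal_prec_def by blast
qed

section \<open>Finite quotients of the power series ring\<close>

lemma finite_residues_power: "\<exists>F. finite F \<and> (\<forall>x. \<exists>y\<in>F. p ^ k dvd x - y)"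
proof (induction k)
  case 0
  then show ?case by (intro exI[of _ "{0}"]) simp
next
  case (Suc k)
  then obtain F where F: "finite F" "\<And>x. \<exists>y\<in>F. p ^ k dvd x - y" by blast
  obtain G where G: "finite G" "\<And>x. \<exists>y\<in>G. p dvd x - y" using finite_residues by blast
  have "\<exists>y\<in>(\<lambda>(y, z). y + p ^ k * z) ` (F \<times> G). p ^ Suc k dvd x - y" for x
  proof -
    obtain y where y: "y \<in> F" "p ^ k dvd x - y" using F(2) by blast
    then obtain w where w: "x - y = p ^ k * w" by (metis dvdE)
    obtain z where z: "z \<in> G" "p dvd w - z" using G(2) by blast
    have "x - (y + p ^ k * z) = p ^ k * (w - z)" using w by (simp add: algebra_simps)
    moreover have "p ^ k * p dvd p ^ k * (w - z)" by (rule mult_dvd_mono[OF dvd_refl z(2)])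
    ultimately have "p ^ Suc k dvd x - (y + p ^ k * z)" by (simp add: mult.commute)
    then show ?thesis using y(1) z(1) by (intro bexI[of _ "y + p ^ k * z"] image_eqI[of _ _ "(y, z)"]) auto
  qed
  then show ?case using F(1) G(1) by (intro exI[of _ "(\<lambda>(y, z). y + p ^ k * z) ` (F \<times> G)"]) auto
qed

text \<open>The saturation of \<open>I\<close> is principal, and its generator has no prime divisor,
  so it is a unit and some \<open>\<pi> ^ k\<close> lies in \<open>I\<close>. Division by an element
  \<open>g\<close> of \<open>I\<close> leaves remainders with \<open>wdeg g\<close> coefficients,
  which matter only modulo \<open>p ^ k\<close>.\<close>

lemma finite_quotient:
  fixes I :: "'a fps set"
  assumes I: "is_ideal I" and no: "\<And>q. prime_elem q \<Longrightarrow> \<not> I \<subseteq> {x. q dvd x}"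
  obtains F where "finite F" "\<And>x. \<exists>y\<in>F. x - y \<in> I"
proof -
  define J where "J = {x. \<exists>k. \<pi> ^ k * x \<in> I}"
  obtain g where g: "g \<in> I" "\<not> \<pi> dvd g" using no[OF prime_elem_pi] by blast
  have IJ: "x \<in> J" if "x \<in> I" for x unfolding J_def using that by (intro CollectI exI[of _ 0]) simp
  have "is_ideal J"
    unfolding is_ideal_def
  proof (intro conjI ballI allI)
    show "0 \<in> J" using IJ is_idealD(1)[OF I] .
  next
    fix x y assume "x \<in> J" "y \<in> J"
    then obtain k l where "\<pi> ^ k * x \<in> I" "\<pi> ^ l * y \<in> I" by (auto simp: J_def)
    then have "\<pi> ^ l * (\<pi> ^ k * x) + \<pi> ^ k * (\<pi> ^ l * y) \<in> I"
      by (rule is_idealD(2)[OF I is_idealD(3)[OF I] is_idealD(3)[OF I]])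
    moreover have "\<pi> ^ l * (\<pi> ^ k * x) + \<pi> ^ k * (\<pi> ^ l * y) = \<pi> ^ (k + l) * (x + y)"
      by (simp add: power_add algebra_simps)
    ultimately show "x + y \<in> J" by (auto simp: J_def)
  next
    fix r x assume "x \<in> J"
    then obtain k where "\<pi> ^ k * x \<in> I" by (auto simp: J_def)
    then have "r * (\<pi> ^ k * x) \<in> I" by (rule is_idealD(3)[OF I])
    then show "r * x \<in> J" by (auto simp: J_def mult.left_commute)
  qed
  moreover have "x \<in> J" if x: "\<pi> * x \<in> J" for x
  proof -
    obtain k where "\<pi> ^ k * (\<pi> * x) \<in> I" using x unfolding J_def by blast
    then have "\<pi> ^ Suc k * x \<in> I" by (simp add: ac_simps)
    then show ?thesis unfolding J_def by blast
  qed
  moreover have "g \<noteq> 0" using g(2) by auto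
  ultimately obtain h where h: "\<not> \<pi> dvd h" "J = {x. h dvd x}"
    using saturated_ideal_principal[OF _ _ IJ[OF g(1)]] by metis
  have "h dvd 1"
  proof (rule ccontr)
    assume "\<not> h dvd 1"
    then obtain q where q: "prime_elem q" "q dvd h" by (rule prime_divisor_exists[OF h(1)])
    then have "I \<subseteq> {x. q dvd x}" using IJ dvd_trans[OF q(2)] unfolding h(2) by blast
    then show False using no[OF q(1)] by simp
  qed
  then have "1 \<in> J" using h(2) by simp
  then obtain k where k: "\<pi> ^ k \<in> I" by (auto simp: J_def)
  obtain F where F: "finite F" "\<And>x. \<exists>y\<in>F. p ^ k dvd x - y" using finite_residues_power by blast
  define G where "G = (\<lambda>c. Abs_fps (\<lambda>i. if i < wdeg g then c i else 0)) ` ({..<wdeg g} \<rightarrow>\<^sub>E F)"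
  have "finite G" unfolding G_def using F(1) by (intro finite_imageI finite_PiE) auto
  moreover have "\<exists>y\<in>G. x - y \<in> I" for x
  proof -
    obtain q r where qr: "x = q * g + r" "\<And>i. wdeg g \<le> i \<Longrightarrow> r $ i = 0"
      using weierstrass_division[OF g(2), of x] by metis
    obtain c where c: "\<And>i. c i \<in> F" "\<And>i. p ^ k dvd r $ i - c i" using F(2)[of "r $ _"] by metis
    define y where "y = Abs_fps (\<lambda>i. if i < wdeg g then c i else 0)"
    have "y \<in> G" unfolding G_def
      by (rule image_eqI[of _ _ "restrict c {..<wdeg g}"]) (auto simp: y_def c fps_eq_iff)
    have "p ^ k dvd (r - y) $ i" for i using c(2)[of i] qr(2)[of i] by (simp add: y_def)
    then have "\<pi> ^ k dvd r - y" by (simp add: pi_power_dvd_iff)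
    then have "r - y \<in> I" by (rule is_ideal_dvd[OF I k])
    moreover have "q * g \<in> I" using is_idealD(3)[OF I g(1)] .
    ultimately have "q * g + (r - y) \<in> I" using is_idealD(2)[OF I] by blast
    then show ?thesis using \<open>y \<in> G\<close> qr(1) by (intro bexI[of _ y]) (simp_all add: algebra_simps)
  qed
  ultimately show ?thesis by (rule that)
qed

end

subsection \<open>Pseudo-isomorphisms\<close>

lemma prime_dvd_prod_listD:
  assumes "prime_elem q" "q dvd prod_list qs"
  shows "\<exists>b\<in>set qs. q dvd b"
  using assms(2)
proof (induction qs)
  case Nil
  then show ?case using prime_elem_not_unit[OF assms(1)] by simp
next
  case (Cons a qs)
  then show ?case using prime_elem_dvd_multD[OF assms(1), of a "prod_list qs"] by auto
qed

lemma not_prime_dvd_unit: "prime_elem q \<Longrightarrow> u dvd 1 \<Longrightarrow> \<not> q dvd u"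
  using prime_elem_not_unit dvd_trans by blast

lemma prime_dvd_factorization:
  fixes q :: "'r::idom"
  assumes q: "prime_elem q" and qs: "\<forall>a\<in>set qs. prime_elem a" and u: "u dvd 1"
    and dvd: "q dvd u * prod_list qs"
  obtains u' qs' where "u' dvd 1" "\<forall>a\<in>set qs'. prime_elem a" "length qs = Suc (length qs')"
    "u * prod_list qs = q * (u' * prod_list qs')"
proof -
  have "q dvd prod_list qs"
    using prime_elem_dvd_multD[OF q dvd] not_prime_dvd_unit[OF q u] by blast
  then obtain b where b: "b \<in> set qs" "q dvd b" using prime_dvd_prod_listD[OF q] by blast
  then obtain qs1 qs2 where split: "qs = qs1 @ b # qs2" by (metis split_list)
  obtain c where c: "b = q * c" using b(2) by (rule dvdE)
  have "irreducible b" using qs b(1) by (simp add: prime_elem_imp_irreducible)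
  then have "c dvd 1" using irreducibleD[of b q c] c prime_elem_not_unit[OF q] by blast
  then have "u * c dvd 1" using mult_dvd_mono[OF u, of c 1] by simp
  moreover have "\<forall>a\<in>set (qs1 @ qs2). prime_elem a" using qs split by auto
  moreover have "u * prod_list qs = q * (u * c * prod_list (qs1 @ qs2))"
    by (simp add: split c ac_simps)
  ultimately show ?thesis using that[of "u * c" "qs1 @ qs2"] split by simp
qed

text \<open>For an ideal \<open>I\<close> and a prime \<open>q\<close>: inverting the elements prime
  to \<open>q\<close> turns \<open>I\<close> into the ideal generated by
  \<open>q ^ k\<close>.\<close>

definition val_at :: "'r::comm_ring_1 \<Rightarrow> 'r set \<Rightarrow> nat \<Rightarrow> bool" where
  "val_at q I k \<longleftrightarrow> (\<forall>x\<in>I. q ^ k dvd x) \<and> (\<exists>t. \<not> q dvd t \<and> q ^ k * t \<in> I)"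

lemma val_at_le_iff:
  fixes q :: "'r::idom"
  assumes q: "prime_elem q" and J: "is_ideal J" and I: "val_at q I k" and Jl: "val_at q J l"
  shows "(\<exists>t. \<not> q dvd t \<and> (\<forall>x\<in>I. t * x \<in> J)) \<longleftrightarrow> l \<le> k"
proof
  assume "\<exists>t. \<not> q dvd t \<and> (\<forall>x\<in>I. t * x \<in> J)"
  then obtain t where t: "\<not> q dvd t" "\<forall>x\<in>I. t * x \<in> J" by blast
  obtain s where s: "\<not> q dvd s" "q ^ k * s \<in> I" using I unfolding val_at_def by blast
  have "q ^ l dvd t * (q ^ k * s)" using t(2) s(2) Jl unfolding val_at_def by blast
  then have "q ^ l dvd q ^ k * s" by (rule prime_power_dvd_mult_cancel[OF q t(1)])
  then have "q ^ l dvd s * q ^ k" by (simp only: mult.commute)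
  then have "q ^ l dvd q ^ k" by (rule prime_power_dvd_mult_cancel[OF q s(1)])
  then show "l \<le> k" by (rule prime_power_dvd_power_imp_le[OF q])
next
  assume "l \<le> k"
  obtain t where t: "\<not> q dvd t" "q ^ l * t \<in> J" using Jl unfolding val_at_def by blast
  have "t * x \<in> J" if "x \<in> I" for x
  proof -
    have "q ^ k dvd x" using I that unfolding val_at_def by blast
    then have "q ^ l dvd x" using dvd_trans[OF le_imp_power_dvd[OF \<open>l \<le> k\<close>]] by blast
    then obtain y where "x = q ^ l * y" by (rule dvdE)
    then have "t * x = y * (q ^ l * t)" by (simp add: ac_simps)
    then show ?thesis using is_idealD(3)[OF J t(2)] by (simp only:)
  qed
  then show "\<exists>t. \<not> q dvd t \<and> (\<forall>x\<in>I. t * x \<in> J)" using t(1) by blast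
qed

text \<open>The choice made in \<open>fitting_ideal\<close> does not depend on \<open>i\<close>, so
  one generating family serves all Fitting ideals of the module.\<close>

lemma fitting_ideal_presentation:
  fixes s :: "'r::comm_ring_1 \<Rightarrow> 'm::ab_group_add \<Rightarrow> 'm"
  assumes "fin_gen s"
  obtains g n where "Modules.module.span s (g ` {..<n}) = UNIV"
    "\<And>i. fitting_ideal s i = ideal_gen (minors s g n (n - i))"
proof -
  define z :: "(nat \<Rightarrow> 'm) \<times> nat"
    where "z = (SOME (g, n). Modules.module.span s (g ` {..<n}) = UNIV)"
  obtain S where S: "finite S" "Modules.module.span s S = UNIV" using assms unfolding fin_gen_def by blast
  obtain xs where xs: "set xs = S" using finite_list[OF S(1)] by blast
  have "(!) xs ` {..<length xs} = S" using xs by (auto simp: set_conv_nth)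
  then have "case ((!) xs, length xs) of (g, n) \<Rightarrow> Modules.module.span s (g ` {..<n}) = UNIV"
    using S(2) by simp
  then have "case z of (g, n) \<Rightarrow> Modules.module.span s (g ` {..<n}) = UNIV"
    unfolding z_def by (rule someI)
  then have "Modules.module.span s (fst z ` {..<snd z}) = UNIV" by (simp add: case_prod_beta)
  moreover have "fitting_ideal s i = ideal_gen (minors s (fst z) (snd z) (snd z - i))" for i
    unfolding fitting_ideal_def z_def[symmetric] by (simp add: case_prod_beta)
  ultimately show ?thesis by (rule that)
qed

lemma (in idom_module) annihilator_exists:
  assumes "torsion_module scale" "finite A" "span (g ` A) = UNIV"
  obtains r where "r \<noteq> 0" "\<And>x. r *s x = 0"
proof -
  obtain r where r: "\<And>x. r x \<noteq> 0" "\<And>x. r x *s x = 0"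
    using assms(1) unfolding torsion_module_def by metis
  let ?r = "\<Prod>i\<in>A. r (g i)"
  have kill: "?r *s g i = 0" if "i \<in> A" for i
  proof -
    have "?r = (\<Prod>j\<in>A - {i}. r (g j)) * r (g i)"
      using assms(2) that by (simp add: prod.remove mult.commute)
    then have "?r *s g i = (\<Prod>j\<in>A - {i}. r (g j)) *s (r (g i) *s g i)" by (simp only: scale_scale)
    then show ?thesis using r(2) by simp
  qed
  have "?r *s x = 0" for x
  proof -
    have "x \<in> span (g ` A)" by (simp add: assms(3))
    then obtain c where "x = (\<Sum>i\<in>A. c i *s g i)" by (rule span_image_eq_sum[OF assms(2)])
    then have "?r *s x = (\<Sum>i\<in>A. c i *s (?r *s g i))" by (simp add: scale_sum_right mult.commute)
    then show ?thesis using kill by simp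
  qed
  moreover have "?r \<noteq> 0" using r(1) assms(2) by simp
  ultimately show ?thesis by (rule that[rotated])
qed

lemma (in idom_module) local_decomp_exponent_unique:
  assumes "prime_elem q" "finite_valuation q" "local_decomp scale q n h e" "local_decomp scale q n' h' e'"
  shows "e = e'"
  using local_decomp_exponent_le[OF assms] local_decomp_exponent_le[OF assms(1,2,4,3)]
  by (intro ext antisym)

text \<open>By pigeonhole two multiples \<open>a ^ i *s y\<close> and \<open>a ^ j *s y\<close>
  agree modulo \<open>U\<close>, and \<open>1 - a ^ (j - i)\<close> is a unit; finitely many
  representatives then give one exponent. It is applied to a kernel with \<open>U = {0}\<close> and
  to a cokernel with \<open>S = UNIV\<close>.\<close>

lemma (in idom_module) power_mem_subspace_of_finite_quotient:
  assumes U: "subspace U" and S: "subspace S"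
    and fin: "finite ((\<lambda>y. {y + z | z. z \<in> U}) ` S)"
    and unit: "\<And>k. 0 < k \<Longrightarrow> 1 - a ^ k dvd 1"
  obtains N where "\<And>y. y \<in> S \<Longrightarrow> a ^ N *s y \<in> U"
proof -
  define C where "C y = {y + z | z. z \<in> U}" for y
  have fin: "finite (C ` S)" using fin by (simp add: C_def)
  have coset: "y - y' \<in> U" if "C y = C y'" for y y'
  proof -
    have "y + 0 \<in> C y" unfolding C_def using subspace_0[OF U] by blast
    then have "y \<in> C y'" using that by simp
    then show ?thesis by (auto simp: C_def)
  qed
  have ex: "\<exists>N. a ^ N *s y \<in> U" if y: "y \<in> S" for y
  proof -
    have "range (\<lambda>i. C (a ^ i *s y)) \<subseteq> C ` S" by (intro image_subsetI imageI subspace_scale[OF S y])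
    then have "finite (range (\<lambda>i. C (a ^ i *s y)))" using fin finite_subset by blast
    then have "\<not> inj (\<lambda>i :: nat. C (a ^ i *s y))" using finite_imageD by blast
    then obtain i j :: nat where ij: "i < j" "C (a ^ i *s y) = C (a ^ j *s y)"
      unfolding inj_def by (metis nat_neq_iff)
    have "1 - a ^ (j - i) dvd 1" using ij(1) by (intro unit) simp
    then obtain w where "1 = (1 - a ^ (j - i)) * w" by (rule dvdE)
    then have w: "w * (1 - a ^ (j - i)) = 1" by (simp add: mult.commute)
    have "a ^ j = a ^ (j - i) * a ^ i" using ij(1) by (simp flip: power_add)
    then have "w * (a ^ i - a ^ j) = w * (1 - a ^ (j - i)) * a ^ i" by (simp add: algebra_simps)
    then have "w *s (a ^ i *s y - a ^ j *s y) = a ^ i *s y"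
      by (simp add: w scale_left_diff_distrib[symmetric])
    moreover have "w *s (a ^ i *s y - a ^ j *s y) \<in> U" by (intro subspace_scale[OF U] coset ij(2))
    ultimately show ?thesis by metis
  qed
  then obtain N where N: "\<And>y. y \<in> S \<Longrightarrow> a ^ N y *s y \<in> U" by metis
  obtain T where T: "T \<subseteq> S" "finite T" "C ` S = C ` T" using finite_subset_image[OF fin order_refl] by blast
  let ?N = "Max (N ` T)"
  have "a ^ ?N *s y \<in> U" if y: "y \<in> S" for y
  proof -
    obtain t where t: "t \<in> T" "C y = C t" using T(3) y by blast
    have "N t \<le> ?N" using t(1) T(2) by simp
    then have "a ^ ?N = a ^ (?N - N t) * a ^ N t" by (simp flip: power_add)
    then have "a ^ ?N *s t = a ^ (?N - N t) *s (a ^ N t *s t)" by (simp only: scale_scale)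
    then have "a ^ ?N *s t \<in> U" using subspace_scale[OF U N] t(1) T(1) by auto
    moreover have "a ^ ?N *s (y - t) \<in> U" by (intro subspace_scale[OF U] coset t(2))
    ultimately have "a ^ ?N *s (y - t) + a ^ ?N *s t \<in> U" using subspace_add[OF U] by blast
    then show ?thesis by (simp add: scale_right_diff_distrib)
  qed
  then show ?thesis by (rule that)
qed

context complete_dvr
begin

lemma finite_valuation_prime: "prime_elem (q :: 'a fps) \<Longrightarrow> finite_valuation q"
  unfolding finite_valuation_def using prime_factor by metis

lemma one_minus_power_unit:
  fixes a :: "'a fps"
  assumes "\<not> a dvd 1" "0 < k"
  shows "1 - a ^ k dvd 1"
proof (rule ccontr)
  assume "\<not> 1 - a ^ k dvd 1"
  moreover have "\<not> a ^ k dvd 1" using assms dvd_trans[OF dvd_power[of k a]] by blast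
  ultimately have "\<not> (1 - a ^ k) + a ^ k dvd 1" by (rule nonunit_add)
  then show False by simp
qed

text \<open>Finiteness of the colon ideal \<open>(J : I)\<close> modulo \<open>J\<close>, by
  induction on the number of prime factors of a nonzero element of \<open>J\<close>. If
  \<open>J\<close> lies in some \<open>(q)\<close>, so does the colon ideal, because
  \<open>I\<close> has an element prime to \<open>q\<close>; dividing by \<open>q\<close> shortens
  the factorization. If \<open>J\<close> lies in no \<open>(q)\<close>, its whole quotient is
  finite.\<close>

lemma finite_colon_quotient:
  fixes I J :: "'a fps set"
  assumes no: "\<And>q. prime_elem q \<Longrightarrow> \<not> I \<subseteq> {x. q dvd x}" and J: "is_ideal J"
  obtains C where "finite C" "\<And>c. (\<And>v. v \<in> I \<Longrightarrow> v * c \<in> J) \<Longrightarrow> \<exists>d\<in>C. c - d \<in> J"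
proof (cases "J = {0}")
  case True
  have c0: "c = 0" if "\<And>v. v \<in> I \<Longrightarrow> v * c \<in> J" for c
  proof -
    have "{0} \<subseteq> {x. \<pi> dvd x}" by simp
    then have "\<not> I \<subseteq> {0}" using no[OF prime_elem_pi] by (metis subset_trans)
    then obtain v where v: "v \<in> I" "v \<noteq> 0" by blast
    then have "v * c \<in> {0}" using that[OF v(1)] True by simp
    then show ?thesis using v(2) by simp
  qed
  show ?thesis
  proof (rule that[of "{0}"])
    fix c assume "\<And>v. v \<in> I \<Longrightarrow> v * c \<in> J"
    then have "c = 0" by (rule c0)
    then show "\<exists>d\<in>{0}. c - d \<in> J" by (simp add: True)
  qed simp
next
  case False
  then obtain f where f: "f \<in> J" "f \<noteq> 0" using is_idealD(1)[OF J] by blast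
  obtain u qs where "u dvd 1" "\<forall>q\<in>set qs. prime_elem q" "f = u * prod_list qs"
    by (rule prime_factorization_exists[OF f(2)])
  then have "\<exists>C. finite C \<and> (\<forall>c. (\<forall>v\<in>I. v * c \<in> J) \<longrightarrow> (\<exists>d\<in>C. c - d \<in> J))"
    using J f(1)
  proof (induction "length qs" arbitrary: u qs f J rule: less_induct)
    case less
    show ?case
    proof (cases "\<exists>q. prime_elem q \<and> J \<subseteq> {x. q dvd x}")
      case False
      then obtain F where "finite F" "\<And>x. \<exists>y\<in>F. x - y \<in> J" using finite_quotient[OF less.prems(4)] by metis
      then show ?thesis by blast
    next
      case True
      then obtain q where q: "prime_elem q" "J \<subseteq> {x. q dvd x}" by blast
      then have "q dvd u * prod_list qs" using less.prems(3,5) by blast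
      then obtain u' qs' where qs': "u' dvd 1" "\<forall>a\<in>set qs'. prime_elem a" "length qs = Suc (length qs')"
        "u * prod_list qs = q * (u' * prod_list qs')"
        by (rule prime_dvd_factorization[OF q(1) less.prems(2,1)])
      define J' where "J' = {x. q * x \<in> J}"
      have "is_ideal J'"
        using is_idealD[OF less.prems(4)] unfolding is_ideal_def J'_def
        by (simp add: distrib_left mult.left_commute)
      moreover have "u' * prod_list qs' \<in> J'" using less.prems(3,5) qs'(4) by (simp add: J'_def)
      ultimately obtain C where C: "finite C" "\<And>c. (\<forall>v\<in>I. v * c \<in> J') \<Longrightarrow> \<exists>d\<in>C. c - d \<in> J'"
        using less.hyps[of qs' u' "u' * prod_list qs'" J'] qs'(1-3) by auto
      have "\<exists>d\<in>(*) q ` C. c - d \<in> J" if c: "\<forall>v\<in>I. v * c \<in> J" for c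
      proof -
        obtain v where v: "v \<in> I" "\<not> q dvd v" using no[OF q(1)] by blast
        then have "q dvd v * c" using c q(2) by blast
        then have "q dvd c" using v(2) prime_elem_dvd_multD[OF q(1)] by blast
        then obtain b where b: "c = q * b" by (rule dvdE)
        have "\<forall>v\<in>I. v * b \<in> J'" using c by (simp add: J'_def b mult.left_commute)
        then obtain d where "d \<in> C" "b - d \<in> J'" using C(2) by blast
        then show ?thesis by (auto simp: J'_def b right_diff_distrib)
      qed
      then show ?thesis using C(1) by blast
    qed
  qed
  then obtain C where "finite C" "\<forall>c. (\<forall>v\<in>I. v * c \<in> J) \<longrightarrow> (\<exists>d\<in>C. c - d \<in> J)" by blast
  then show ?thesis by (intro that[of C]) simp_all
qed

text \<open>Induction on the generators. Let \<open>J\<close> consist of the multipliers that send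
  the last generator into the span of the others. The last coefficient of an element killed by
  \<open>I\<close> is multiplied into \<open>J\<close> by \<open>I\<close>, so
  \<open>finite_colon_quotient\<close> leaves finitely many classes for it modulo
  \<open>J\<close>.\<close>

lemma finite_annihilated_submodule:
  fixes s :: "'a fps \<Rightarrow> 'm::ab_group_add \<Rightarrow> 'm"
  assumes "idom_module s" and no: "\<And>q. prime_elem q \<Longrightarrow> \<not> I \<subseteq> {x. q dvd x}"
  shows "finite {x \<in> Modules.module.span s (g ` {..<n :: nat}). \<forall>v\<in>I. s v x = 0}"
proof -
  interpret idom_module s by fact
  show ?thesis
  proof (induction n)
    case 0
    then show ?case by (simp add: Collect_conv_if)
  next
    case (Suc n)
    let ?S = "span (g ` {..<n})"
    define Z where "Z = {x \<in> ?S. \<forall>v\<in>I. s v x = 0}"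
    define Z' where "Z' = {x \<in> span (g ` {..<Suc n}). \<forall>v\<in>I. s v x = 0}"
    define J where "J = {c. s c (g n) \<in> ?S}"
    have "is_ideal J"
      unfolding is_ideal_def J_def
      using span_zero span_add span_scale by (auto simp: scale_left_distrib simp flip: scale_scale)
    then obtain C where C: "finite C" "\<And>c. (\<And>v. v \<in> I \<Longrightarrow> v * c \<in> J) \<Longrightarrow> \<exists>d\<in>C. c - d \<in> J"
      using finite_colon_quotient[OF no] by metis
    have "\<exists>d\<in>C. x - s d (g n) \<in> ?S" if x: "x \<in> Z'" for x
    proof -
      have "x \<in> span (insert (g n) (g ` {..<n}))" using x by (simp add: Z'_def lessThan_Suc)
      then obtain c where c: "x - s c (g n) \<in> ?S" by (auto simp: span_insert)
      have "v * c \<in> J" if "v \<in> I" for v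
      proof -
        have "s v (x - s c (g n)) \<in> ?S" using c by (rule span_scale)
        moreover have "s v (x - s c (g n)) = - s (v * c) (g n)"
          using x that by (simp add: Z'_def scale_right_diff_distrib)
        ultimately show ?thesis unfolding J_def using span_neg by fastforce
      qed
      then obtain d where d: "d \<in> C" "c - d \<in> J" using C(2) by blast
      have "(x - s c (g n)) + s (c - d) (g n) \<in> ?S" using c d(2) unfolding J_def by (intro span_add) simp_all
      then show ?thesis using d(1) by (auto simp: scale_left_diff_distrib)
    qed
    then have "\<forall>x\<in>Z'. \<exists>d. d \<in> C \<and> x - s d (g n) \<in> ?S" by blast
    then obtain d where "\<forall>x\<in>Z'. d x \<in> C \<and> x - s (d x) (g n) \<in> ?S" by (rule bchoice[THEN exE])
    then have d: "\<And>x. x \<in> Z' \<Longrightarrow> d x \<in> C" "\<And>x. x \<in> Z' \<Longrightarrow> x - s (d x) (g n) \<in> ?S" by simp_all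
    \<comment> \<open>Two elements with the same representative differ by an element of
      \<open>Z\<close>, which is finite by the induction hypothesis.\<close>
    have "finite {x \<in> Z'. d x = k}" for k
    proof (cases "\<exists>x0\<in>Z'. d x0 = k")
      case True
      then obtain x0 where x0: "x0 \<in> Z'" "d x0 = k" by blast
      have "{x \<in> Z'. d x = k} \<subseteq> (\<lambda>z. x0 + z) ` Z"
      proof
        fix x assume x: "x \<in> {x \<in> Z'. d x = k}"
        then have "x - s k (g n) \<in> ?S" "x0 - s k (g n) \<in> ?S" using d(2)[of x] d(2)[OF x0(1)] x0(2) by auto
        then have "(x - s k (g n)) - (x0 - s k (g n)) \<in> ?S" by (rule span_diff)
        then have "x - x0 \<in> ?S" by simp
        moreover have "\<forall>v\<in>I. s v (x - x0) = 0" using x x0(1) by (simp add: Z'_def scale_right_diff_distrib)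
        ultimately show "x \<in> (\<lambda>z. x0 + z) ` Z" by (intro image_eqI[of _ _ "x - x0"]) (simp_all add: Z_def)
      qed
      then show ?thesis using Suc[folded Z_def] finite_subset by blast
    next
      case False
      then have "{x \<in> Z'. d x = k} = {}" by blast
      then show ?thesis by (simp only: finite.emptyI)
    qed
    then have "finite (\<Union>k\<in>C. {x \<in> Z'. d x = k})" using C(1) by blast
    moreover have "Z' \<subseteq> (\<Union>k\<in>C. {x \<in> Z'. d x = k})" using d(1) by blast
    ultimately show ?case unfolding Z'_def[symmetric] using finite_subset by blast
  qed
qed

end

section \<open>Pseudo-isomorphisms as maps bijective at every prime element\<close>

context complete_dvr
begin

text \<open>A finite kernel and a finite cokernel are killed by powers of any nonunit; one that is
  prime to \<open>q\<close> provides both multipliers.\<close>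

lemma pseudo_isomorphism_local_iso:
  fixes s1 :: "'a fps \<Rightarrow> 'm::ab_group_add \<Rightarrow> 'm" and s2 :: "'a fps \<Rightarrow> 'n::ab_group_add \<Rightarrow> 'n"
  assumes "pseudo_isomorphism s1 s2 f" and q: "prime_elem q"
  shows "local_iso s1 s2 q f"
proof -
  interpret f: Modules.module_hom s1 s2 f using assms(1) by (simp add: pseudo_isomorphism_def)
  interpret m1: idom_module s1 by (simp add: idom_module_def f.m1.module_axioms)
  interpret m2: idom_module s2 by (simp add: idom_module_def f.m2.module_axioms)
  obtain a :: "'a fps" where a: "\<not> q dvd a" "\<not> a dvd 1"
    using prime_not_dvd_pi_or_X[OF q] pi_nonunit X_nonunit by blast
  note unit = one_minus_power_unit[OF a(2)]
  have not_dvd: "\<not> q dvd a ^ N" for N using a(1) prime_elem_dvd_power[OF q] by blast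
  have ker: "f.m1.subspace {x. f x = 0}"
    by (auto simp: f.m1.subspace_def f.zero f.add f.scale)
  have "finite ((\<lambda>y. {y + z | z. z \<in> {0}}) ` {x. f x = 0})"
    using assms(1) by (simp add: pseudo_isomorphism_def pseudo_null_def)
  then obtain N where N: "\<And>x. x \<in> {x. f x = 0} \<Longrightarrow> s1 (a ^ N) x \<in> {0}"
    using m1.power_mem_subspace_of_finite_quotient[OF f.m1.subspace_single_0 ker _ unit] by metis
  have range: "f.m2.subspace (range f)"
    unfolding f.m2.subspace_def
  proof (intro conjI ballI allI)
    show "0 \<in> range f" by (rule range_eqI[of _ _ 0]) (simp add: f.zero)
    show "y + z \<in> range f" if "y \<in> range f" "z \<in> range f" for y z
    proof -
      obtain v w where "y = f v" "z = f w" using \<open>y \<in> range f\<close> \<open>z \<in> range f\<close> by blast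
      then show ?thesis by (intro range_eqI[of _ _ "v + w"]) (simp add: f.add)
    qed
    show "s2 c y \<in> range f" if "y \<in> range f" for c y
    proof -
      obtain v where "y = f v" using \<open>y \<in> range f\<close> by blast
      then show ?thesis by (intro range_eqI[of _ _ "s1 c v"]) (simp add: f.scale)
    qed
  qed
  have "finite ((\<lambda>y. {y + z | z. z \<in> range f}) ` UNIV)"
    using assms(1) by (simp add: pseudo_isomorphism_def pseudo_null_def)
  then obtain N' where N': "\<And>y. y \<in> UNIV \<Longrightarrow> s2 (a ^ N') y \<in> range f"
    by (rule m2.power_mem_subspace_of_finite_quotient[OF range f.m2.subspace_UNIV _ unit]) blast+
  have "\<forall>x. f x = 0 \<longrightarrow> s1 (a ^ N) x = 0" using N by simp
  moreover have "\<forall>y. \<exists>x. s2 (a ^ N') y = f x" using N' by auto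
  ultimately show ?thesis
    unfolding local_iso_def using f.module_hom_axioms not_dvd by blast
qed

text \<open>The annihilators \<open>I\<close> of the kernel and \<open>J\<close> of the cokernel lie
  in no \<open>(q)\<close>. The kernel is handled by \<open>finite_annihilated_submodule\<close>; in
  the cokernel the coefficients of the generators matter only modulo \<open>J\<close>, which has
  finite quotient.\<close>

lemma pseudo_isomorphism_if_local_isos:
  fixes s1 :: "'a fps \<Rightarrow> 'm::ab_group_add \<Rightarrow> 'm" and s2 :: "'a fps \<Rightarrow> 'n::ab_group_add \<Rightarrow> 'n"
  assumes hom: "Modules.module_hom s1 s2 f"
    and gen1: "Modules.module.span s1 (g1 ` {..<n1 :: nat}) = UNIV"
    and gen2: "Modules.module.span s2 (g2 ` {..<n2 :: nat}) = UNIV"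
    and iso: "\<And>q. prime_elem q \<Longrightarrow> local_iso s1 s2 q f"
  shows "pseudo_isomorphism s1 s2 f"
proof -
  interpret f: Modules.module_hom s1 s2 f by fact
  interpret m1: idom_module s1 by (simp add: idom_module_def f.m1.module_axioms)
  interpret m2: idom_module s2 by (simp add: idom_module_def f.m2.module_axioms)
  define I where "I = {v. \<forall>x. f x = 0 \<longrightarrow> s1 v x = 0}"
  define J where "J = {v. \<forall>y. \<exists>x. s2 v y = f x}"
  have "\<not> I \<subseteq> {x. q dvd x}" if "prime_elem q" for q
    using iso[OF that] unfolding local_iso_def I_def by blast
  then have "finite {x \<in> f.m1.span (g1 ` {..<n1}). \<forall>v\<in>I. s1 v x = 0}"
    by (rule finite_annihilated_submodule[OF m1.idom_module_axioms])
  moreover have "{x. f x = 0} \<subseteq> {x \<in> f.m1.span (g1 ` {..<n1}). \<forall>v\<in>I. s1 v x = 0}"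
    unfolding gen1 by (auto simp: I_def)
  ultimately have ker: "finite {x. f x = 0}" using finite_subset by blast
  have noJ: "\<not> J \<subseteq> {x. q dvd x}" if "prime_elem q" for q
    using iso[OF that] unfolding local_iso_def J_def by blast
  have J: "is_ideal J"
    unfolding is_ideal_def
  proof (intro conjI ballI allI)
    show "0 \<in> J" unfolding J_def by (auto intro: exI[of _ 0] simp: f.zero)
  next
    fix v w assume "v \<in> J" "w \<in> J"
    then show "v + w \<in> J" unfolding J_def by (auto simp: f.m2.scale_left_distrib) (metis f.add)
  next
    fix r v assume "v \<in> J"
    then show "r * v \<in> J" unfolding J_def by (auto simp flip: f.m2.scale_scale) (metis f.scale)
  qed
  obtain F where F: "finite F" "\<And>x. \<exists>y\<in>F. x - y \<in> J" using finite_quotient[OF J noJ] by metis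
  let ?C = "\<lambda>y. {y + z | z. z \<in> range f}"
  have coset: "?C y = ?C y'" if "y - y' = f x" for y y' x
  proof -
    have "y + f w = y' + f (x + w)" for w using that by (simp add: f.add algebra_simps)
    moreover have "y' + f w = y + f (w - x)" for w using that by (simp add: f.diff algebra_simps)
    ultimately show ?thesis by (metis (no_types, opaque_lifting) rangeE rangeI)
  qed
  have "range ?C \<subseteq> (\<lambda>c. ?C (\<Sum>i<n2. s2 (c i) (g2 i))) ` ({..<n2} \<rightarrow>\<^sub>E F)"
  proof (rule image_subsetI)
    fix y
    have "y \<in> f.m2.span (g2 ` {..<n2})" by (simp add: gen2)
    then obtain c where c: "y = (\<Sum>i<n2. s2 (c i) (g2 i))" by (rule m2.span_image_eq_sum[OF finite_lessThan])
    obtain d where d: "\<And>i. d i \<in> F" "\<And>i. c i - d i \<in> J" using F(2)[of "c _"] by metis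
    have "\<exists>x. s2 (c i - d i) (g2 i) = f x" for i using d(2) unfolding J_def by blast
    then obtain x where x: "\<And>i. s2 (c i - d i) (g2 i) = f (x i)" by metis
    have "y - (\<Sum>i<n2. s2 (restrict d {..<n2} i) (g2 i)) = f (\<Sum>i<n2. x i)"
      by (simp add: c f.sum x[symmetric] f.m2.scale_left_diff_distrib sum_subtractf)
    then have "?C y = ?C (\<Sum>i<n2. s2 (restrict d {..<n2} i) (g2 i))" by (rule coset)
    moreover have "restrict d {..<n2} \<in> {..<n2} \<rightarrow>\<^sub>E F" using d(1) by auto
    ultimately show "?C y \<in> (\<lambda>c. ?C (\<Sum>i<n2. s2 (c i) (g2 i))) ` ({..<n2} \<rightarrow>\<^sub>E F)" by (rule image_eqI)
  qed
  moreover have "finite ({..<n2} \<rightarrow>\<^sub>E F)" using F(1) by (intro finite_PiE) auto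
  ultimately have "finite (range ?C)" using finite_surj by blast
  then show ?thesis
    unfolding pseudo_isomorphism_def pseudo_null_def using hom ker by blast
qed

lemma pseudo_isomorphic_iff_local_isos:
  fixes s1 :: "'a fps \<Rightarrow> 'm::ab_group_add \<Rightarrow> 'm" and s2 :: "'a fps \<Rightarrow> 'n::ab_group_add \<Rightarrow> 'n"
  assumes "idom_module s1" "idom_module s2"
    and gen1: "Modules.module.span s1 (g1 ` {..<n1 :: nat}) = UNIV"
    and gen2: "Modules.module.span s2 (g2 ` {..<n2 :: nat}) = UNIV"
    and r: "r \<noteq> 0" and ann1: "\<And>x. s1 r x = 0" and ann2: "\<And>y. s2 r y = 0"
  shows "pseudo_isomorphic s1 s2 \<longleftrightarrow> (\<forall>q. prime_elem q \<longrightarrow> (\<exists>f. local_iso s1 s2 q f))"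
proof
  assume "pseudo_isomorphic s1 s2"
  then show "\<forall>q. prime_elem q \<longrightarrow> (\<exists>f. local_iso s1 s2 q f)"
    unfolding pseudo_isomorphic_def using pseudo_isomorphism_local_iso by blast
next
  assume loc: "\<forall>q. prime_elem q \<longrightarrow> (\<exists>f. local_iso s1 s2 q f)"
  interpret m1: idom_module s1 by fact
  interpret m2: idom_module s2 by fact
  interpret idom_module_pair s1 s2 ..
  obtain u qs where qs: "u dvd 1" "\<forall>q\<in>set qs. prime_elem q" "r = u * prod_list qs"
    by (rule prime_factorization_exists[OF r])
  have "\<exists>f. Modules.module_hom s1 s2 f \<and> (\<forall>q\<in>set qs. local_iso s1 s2 q f)"
    using qs(2) finite_valuation_prime loc by (intro local_isos_glue[OF r ann2]) blast+
  then obtain f where hom: "Modules.module_hom s1 s2 f" and f: "\<forall>q\<in>set qs. local_iso s1 s2 q f" by blast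
  interpret f: Modules.module_hom s1 s2 f by fact
  have "local_iso s1 s2 q f" if q: "prime_elem q" for q
  proof (cases "q dvd r")
    case True
    then have "q dvd prod_list qs"
      using prime_elem_dvd_multD[OF q] not_prime_dvd_unit[OF q qs(1)] qs(3) by blast
    then obtain b where b: "b \<in> set qs" "q dvd b" using prime_dvd_prod_listD[OF q] by blast
    then have "b dvd q" using prime_elem_dvd_imp_dvd[OF q] qs(2) by blast
    then show ?thesis using f b(1) local_iso_assoc by blast
  next
    \<comment> \<open>Here \<open>r\<close> itself is the multiplier: it kills both modules, so
      every homomorphism is a local isomorphism at \<open>q\<close>.\<close>
    case False
    moreover have "s2 r y = f 0" for y by (simp add: ann2 f.zero)
    ultimately show ?thesis unfolding local_iso_def using hom ann1 by blast
  qed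
  then have "pseudo_isomorphism s1 s2 f"
    by (rule pseudo_isomorphism_if_local_isos[OF hom gen1 gen2])
  then show "pseudo_isomorphic s1 s2" unfolding pseudo_isomorphic_def by blast
qed

lemma local_iso_iff_exponents:
  fixes s1 :: "'a fps \<Rightarrow> 'm::ab_group_add \<Rightarrow> 'm" and s2 :: "'a fps \<Rightarrow> 'n::ab_group_add \<Rightarrow> 'n"
  assumes "idom_module s1" "idom_module s2" and q: "prime_elem q"
    and d1: "local_decomp s1 q n1 h1 e1" and d2: "local_decomp s2 q n2 h2 e2"
  shows "(\<exists>f. local_iso s1 s2 q f) \<longleftrightarrow> (\<forall>i. sum e1 {i..<n1} = sum e2 {i..<n2})"
proof -
  interpret m1: idom_module s1 by fact
  interpret m2: idom_module s2 by fact
  interpret idom_module_pair s1 s2 ..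
  have ext: "sum e {i..<n} = sum e {i..<max n m}" if "\<And>j. n \<le> j \<Longrightarrow> e j = (0::nat)" for e and i n m :: nat
    using that by (intro sum.mono_neutral_left) auto
  \<comment> \<open>This includes \<open>i \<ge> n\<close>, where both sums are empty and
    \<open>e i = 0\<close>; so every exponent is a difference of consecutive tail sums.\<close>
  have step: "sum e {i..<n} = e i + sum e {Suc i..<n}" if "\<And>j. n \<le> j \<Longrightarrow> e j = (0::nat)" for e and i n :: nat
    using that[of i] by (cases "i < n") (simp_all add: sum.atLeast_Suc_lessThan)
  have "(\<forall>i. sum e1 {i..<n1} = sum e2 {i..<n2}) \<longleftrightarrow> e1 = e2"
  proof
    assume eq: "\<forall>i. sum e1 {i..<n1} = sum e2 {i..<n2}"
    show "e1 = e2"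
    proof
      fix i
      show "e1 i = e2 i"
        using eq step[of n1 e1 i] step[of n2 e2 i] local_decompD(2)[OF d1] local_decompD(2)[OF d2] by simp
    qed
  next
    assume "e1 = e2"
    then show "\<forall>i. sum e1 {i..<n1} = sum e2 {i..<n2}"
      using ext[of n1 e1 _ n2] ext[of n2 e2 _ n1] local_decompD(2)[OF d1] local_decompD(2)[OF d2]
      by (simp add: max.commute)
  qed
  moreover have "(\<exists>f. local_iso s1 s2 q f) \<longleftrightarrow> e1 = e2"
  proof
    assume "\<exists>f. local_iso s1 s2 q f"
    then obtain f where "local_iso s1 s2 q f" by blast
    then have "local_decomp s2 q n1 (\<lambda>j. f (h1 j)) e1" by (rule local_decomp_transport[OF q _ d1])
    then show "e1 = e2"
      by (rule m2.local_decomp_exponent_unique[OF q finite_valuation_prime[OF q] _ d2])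
  next
    assume "e1 = e2"
    then have "local_decomp s1 q (max n1 n2) (\<lambda>j. if j < n1 then h1 j else 0) e1"
      "local_decomp s2 q (max n1 n2) (\<lambda>j. if j < n2 then h2 j else 0) e1"
      using m1.local_decomp_pad[OF d1] m2.local_decomp_pad[OF d2] by simp_all
    then show "\<exists>f. local_iso s1 s2 q f" using local_iso_exists[OF q] by metis
  qed
  ultimately show ?thesis by simp
qed

end

theorem theorem2p8:
  fixes sM :: "'a::idom fps \<Rightarrow> 'm::ab_group_add \<Rightarrow> 'm"
    and sN :: "'a fps \<Rightarrow> 'n::ab_group_add \<Rightarrow> 'n"
  assumes "complete_DVR_finite_residue TYPE('a)"
    and "Modules.module sM" and "Modules.module sN"
    and "fin_gen sM" and "fin_gen sN"
    and "torsion_module sM" and "torsion_module sN"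
    and "(UNIV :: 'm set) \<noteq> {0}" and "(UNIV :: 'n set) \<noteq> {0}"
  shows "pseudo_isomorphic sM sN \<longleftrightarrow>
           (\<forall>i::nat. ideal_sim (fitting_ideal sM i) (fitting_ideal sN i))"
proof -
  obtain p :: 'a where "complete_dvr p" by (rule complete_DVR_uniformizer[OF assms(1)])
  interpret complete_dvr p by fact
  interpret M: idom_module sM using assms(2) by (simp add: idom_module_def)
  interpret N: idom_module sN using assms(3) by (simp add: idom_module_def)
  obtain gM nM where gM: "M.span (gM ` {..<nM}) = UNIV"
    and fM: "\<And>i. fitting_ideal sM i = ideal_gen (minors sM gM nM (nM - i))"
    using fitting_ideal_presentation[OF assms(4)] by metis
  obtain gN nN where gN: "N.span (gN ` {..<nN}) = UNIV"
    and fN: "\<And>i. fitting_ideal sN i = ideal_gen (minors sN gN nN (nN - i))"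
    using fitting_ideal_presentation[OF assms(5)] by metis
  obtain rM where rM: "rM \<noteq> 0" "\<And>x. sM rM x = 0"
    using M.annihilator_exists[OF assms(6) finite_lessThan gM] by metis
  obtain rN where rN: "rN \<noteq> 0" "\<And>x. sN rN x = 0"
    using N.annihilator_exists[OF assms(7) finite_lessThan gN] by metis
  have r: "rM * rN \<noteq> 0" "\<And>x. sM (rM * rN) x = 0" "\<And>y. sN (rM * rN) y = 0"
    using rM rN by (simp_all add: mult.commute[of rM] flip: M.scale_scale)
      (metis N.scale_scale N.scale_zero_right mult.commute)
  have ideals: "is_ideal (fitting_ideal sM i)" "is_ideal (fitting_ideal sN i)" for i
    by (simp_all add: fM fN ideal_gen_is_ideal)
  have local: "(\<exists>f. local_iso sM sN q f) \<longleftrightarrow>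
      (\<forall>i. (\<exists>t. \<not> q dvd t \<and> (\<forall>x\<in>fitting_ideal sM i. t * x \<in> fitting_ideal sN i)) \<and>
           (\<exists>t. \<not> q dvd t \<and> (\<forall>x\<in>fitting_ideal sN i. t * x \<in> fitting_ideal sM i)))"
    if q: "prime_elem q" for q
  proof -
    note val = finite_valuation_prime[OF q]
    obtain hM eM where dM: "local_decomp sM q nM hM eM"
      and vM: "\<And>i x. x \<in> fitting_ideal sM i \<Longrightarrow> q ^ sum eM {i..<nM} dvd x"
        "\<And>i. \<exists>t. \<not> q dvd t \<and> q ^ sum eM {i..<nM} * t \<in> fitting_ideal sM i"
      unfolding fM by (rule M.fitting_valuation[OF q val rM gM]) blast
    obtain hN eN where dN: "local_decomp sN q nN hN eN"
      and vN: "\<And>i x. x \<in> fitting_ideal sN i \<Longrightarrow> q ^ sum eN {i..<nN} dvd x"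
        "\<And>i. \<exists>t. \<not> q dvd t \<and> q ^ sum eN {i..<nN} * t \<in> fitting_ideal sN i"
      unfolding fN by (rule N.fitting_valuation[OF q val rN gN]) blast
    have valM: "val_at q (fitting_ideal sM i) (sum eM {i..<nM})" for i using vM unfolding val_at_def by blast
    have valN: "val_at q (fitting_ideal sN i) (sum eN {i..<nN})" for i using vN unfolding val_at_def by blast
    \<comment> \<open>The two multiplier conditions turn into opposite inequalities between the tail
      sums, so together they express equality.\<close>
    show ?thesis
      unfolding local_iso_iff_exponents[OF M.idom_module_axioms N.idom_module_axioms q dM dN]
        val_at_le_iff[OF q ideals(2) valM valN] val_at_le_iff[OF q ideals(1) valN valM]
      by (auto intro: antisym)
  qed
  have "pseudo_isomorphic sM sN \<longleftrightarrow> (\<forall>q. prime_elem q \<longrightarrow> (\<exists>f. local_iso sM sN q f))"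
    by (rule pseudo_isomorphic_iff_local_isos[OF M.idom_module_axioms N.idom_module_axioms gM gN r])
  also have "\<dots> \<longleftrightarrow> (\<forall>i. ideal_sim (fitting_ideal sM i) (fitting_ideal sN i))"
    unfolding ideal_sim_def ideal_prec_iff[OF ideals(1)] ideal_prec_iff[OF ideals(2)]
    using local by meson
  finally show ?thesis .
qed

end
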